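(* Let $d\ge2$, let $k$ be an integer with $1\le k\le d+1$, and let $\gamma=(\gamma_1,\dots,\gamma_{d-k+1})$ with $\gamma_i>-1$ (no $\gamma$ if $k=d+1$). Let $B=\{d-k+2,\dots,d+1\}$. Define $\mathcal U_n^d(W_{\gamma,-\mathbf 1_k})$ as follows. (i) $k=1$: $\mathcal U_0^d=\mathrm{span}\{1\}$ and for $n\ge1$, $\mathcal U_n^d(W_{\gamma,-1})=x_{d+1}\mathcal V_{n-1}^d(W_{\gamma,1})+H_{n,\{d+1\}}^d(W_{(\gamma,0)})$. (ii) $2\le k\le d$: $\mathcal U_0^d=\mathrm{span}\{1\}$ and for $n\ge1$, $\mathcal U_n^d(W_{\gamma,-\mathbf 1_k})=x_B\,\mathcal V_{n-k}^d(W_{\gamma,\mathbf 1_k})+\sum_{j=1}^{k-1}\sum_{J\subset B,|J|=j}x_J\,H^d_{n-j,B\setminus J}(W_{\varepsilon^J})+H_{n,B}^d(W_{(\gamma,\mathbf 0_k)})$. (iii) $k=d+1$: $\mathcal U_0^d=\mathrm{span}\{1\}$, $\mathcal U_1^d=\mathrm{span}\{x_1+c_1,\dots,x_d+c_d\}$ with arbitrary real $c_1,\dots,c_d$, and for $n\ge2$, $\mathcal U_n^d(W_{-\mathbf 1})=x_1\cdots x_{d+1}\mathcal V_{n-d-1}^d(W_{\mathbf 1})+\sum_{j=2}^{d}\sum_{J\subset\{1,\dots,d+1\},|J|=j}x_J\,H^d_{n-j,\{1,\dots,d+1\}\setminus J}(W_{\varepsilon^J})$. Then every element of $\mathcal U_n^d(W_{\gamma,-\mathbf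 1_k})$ is a polynomial solution of $L_{(\gamma,-\mathbf 1_k)}u=-n(n+|\gamma|+d-k)u$, $\dim\mathcal U_n^d(W_{\gamma,-\mathbf 1_k})=\binom{n+d-1}{n}$, and the displayed sums are direct.
   Context: $x\in\mathbb R^d$, $|x|=x_1+\dots+x_d$, $x_{d+1}:=1-|x|$, $T^d=\{x:x_i\ge0,\ 1-|x|\ge0\}$; for $J\subset\{1,\dots,d+1\}$, $x_J=\prod_{i\in J}x_i$. For $\boldsymbol\varepsilon\in\mathbb R^{d+1}$, $W_{\boldsymbol\varepsilon}=\prod_{i=1}^{d+1}x_i^{\varepsilon_i}$ and $|\boldsymbol\varepsilon|=\sum\varepsilon_i$; $(\gamma,-\mathbf 1_k)$, $(\gamma,\mathbf 1_k)$, $(\gamma,\mathbf 0_k)$ denote $\gamma$ followed by $k$ entries $-1$, $1$, $0$; $|\gamma|=\sum_i\gamma_i$. For $J\subset B$, $\varepsilon^J\in\mathbb R^{d+1}$ has $\varepsilon^J_i=\gamma_i$ for $i\le d-k+1$, $\varepsilon^J_i=1$ for $i\in J$, $\varepsilon^J_i=0$ for $i\in B\setminus J$. For parameters $>-1$, $\mathcal V_m^d(W)$ is the space of polynomials of degree $m$ orthogonal in $L^2(W,T^d)$ to all polynomials of degree $\le m-1$. The operator: $L_{\boldsymbol\varepsilon}=\sum_{i=1}^dx_i(1-x_i)\partial_i^2-2\sum_{i<j\le d}x_ix_j\partial_i\partial_j+\sum_{i=1}^d(\varepsilon_i+1-(|\boldsymbol\varepsilon|+d+1)x_i)\partial_i$.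 Face spaces: for $S\subset\{1,\dots,d+1\}$ and $\boldsymbol\varepsilon$ with $\varepsilon_i>-1$ for $i\notin S$, choose $r\notin S$ ($r=d+1$ if $d+1\notin S$, else a fixed element of $\{1,\dots,d\}\setminus S$); $A=\{1,\dots,d+1\}\setminus(S\cup\{r\})$, $D_i=\partial/\partial x_i-\partial/\partial x_r$ with $\partial/\partial x_{d+1}:=0$; for $\mathbf m\in\mathbb N_0^A$, $R_{\mathbf m}=\big(\prod_{i\in A\cup\{r\}}x_i^{-\varepsilon_i}\big)\prod_{i\in A}D_i^{m_i}\big[\big(\prod_{i\in A}x_i^{\varepsilon_i+m_i}\big)x_r^{\varepsilon_r+|\mathbf m|}\big]$, and $H_{m,S}^d(W_{\boldsymbol\varepsilon})=\mathrm{span}\{R_{\mathbf m}:|\mathbf m|=m\}$ (independent of $\varepsilon_i$, $i\in S$). Conventions: all spaces with negative index are $\{0\}$, and $H_{m,S}^d=\{0\}$ whenever $|S|\ge d$. *)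

theory Defs
  imports "HOL-Analysis.Analysis"
begin

text \<open>Points of R^d are represented as functions nat => real; only the
coordinates 1..d matter.  Functions on R^d are of type (nat => real) => real.\<close>

type_synonym pt = "nat \<Rightarrow> real"
type_synonym fn = "pt \<Rightarrow> real"

definition xx :: "nat \<Rightarrow> pt \<Rightarrow> nat \<Rightarrow> real" where
  "xx d x i = (if i = d + 1 then 1 - (\<Sum>j=1..d. x j) else x i)"

definition xprod :: "nat \<Rightarrow> nat set \<Rightarrow> pt \<Rightarrow> real" where
  "xprod d J x = (\<Prod>i\<in>J. xx d x i)"

definition monomset :: "nat \<Rightarrow> nat \<Rightarrow> (nat \<Rightarrow> nat) set" where
  "monomset d N = {\<alpha>. (\<forall>i. i \<notin> {1..d} \<longrightarrow> \<alpha> i = 0) \<and> (\<Sum>i=1..d. \<alpha> i) \<le> N}"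

definition poly_le :: "nat \<Rightarrow> nat \<Rightarrow> fn \<Rightarrow> bool" where
  "poly_le d N p \<longleftrightarrow>
     (\<exists>c. p = (\<lambda>x. \<Sum>\<alpha>\<in>monomset d N. c \<alpha> * (\<Prod>i=1..d. x i ^ \<alpha> i)))"

definition polyfun :: "nat \<Rightarrow> fn \<Rightarrow> bool" where
  "polyfun d p \<longleftrightarrow> (\<exists>N. poly_le d N p)"

definition Tsimp :: "nat \<Rightarrow> pt set" where
  "Tsimp d = {x. (\<forall>i\<in>{1..d}. 0 \<le> x i) \<and> (\<Sum>i=1..d. x i) \<le> 1}"

definition Tint :: "nat \<Rightarrow> pt set" where
  "Tint d = {x. (\<forall>i\<in>{1..d}. 0 < x i) \<and> (\<Sum>i=1..d. x i) < 1}"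

definition weight :: "nat \<Rightarrow> (nat \<Rightarrow> real) \<Rightarrow> pt \<Rightarrow> real" where
  "weight d \<epsilon> x = (\<Prod>i=1..d+1. xx d x i powr \<epsilon> i)"

definition Vsp :: "nat \<Rightarrow> int \<Rightarrow> (nat \<Rightarrow> real) \<Rightarrow> fn set" where
  "Vsp d m \<epsilon> = (if m < 0 then {\<lambda>x. 0} else
     {p. poly_le d (nat m) p \<and>
         (\<forall>q N. N < nat m \<longrightarrow> poly_le d N q \<longrightarrow>
            (LINT x:Tsimp d|PiM {1..d} (\<lambda>_. lborel). p x * q x * weight d \<epsilon> x) = 0)})"

definition pd :: "nat \<Rightarrow> fn \<Rightarrow> fn" where
  "pd i f x = deriv (\<lambda>t. f (x(i := t))) (x i)"

definition Dop :: "nat \<Rightarrow> nat \<Rightarrow> nat \<Rightarrow> fn \<Rightarrow> fn" where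
  "Dop d r i f = (\<lambda>x. pd i f x - (if r = d + 1 then 0 else pd r f x))"

definition rchoice :: "nat \<Rightarrow> nat set \<Rightarrow> nat" where
  "rchoice d S = (if d + 1 \<notin> S then d + 1 else Min ({1..d} - S))"

definition Aset :: "nat \<Rightarrow> nat set \<Rightarrow> nat set" where
  "Aset d S = {1..d+1} - (S \<union> {rchoice d S})"

definition multis :: "nat set \<Rightarrow> nat \<Rightarrow> (nat \<Rightarrow> nat) set" where
  "multis A m = {mm. (\<forall>i. i \<notin> A \<longrightarrow> mm i = 0) \<and> sum mm A = m}"

text \<open>Rodrigues-type function R_m (on the interior of the Tsimp).\<close>
definition Rfun :: "nat \<Rightarrow> nat set \<Rightarrow> (nat \<Rightarrow> real) \<Rightarrow> (nat \<Rightarrow> nat) \<Rightarrow> fn" where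
  "Rfun d S \<epsilon> mm = (let r = rchoice d S; A = Aset d S; M = sum mm A in
     (\<lambda>x. (\<Prod>i\<in>A \<union> {r}. xx d x i powr (- \<epsilon> i)) *
        fold (\<lambda>i g. (Dop d r i ^^ mm i) g) (sorted_list_of_set A)
          (\<lambda>y. (\<Prod>i\<in>A. xx d y i powr (\<epsilon> i + real (mm i))) * xx d y r powr (\<epsilon> r + real M)) x))"

definition Hsp :: "nat \<Rightarrow> int \<Rightarrow> nat set \<Rightarrow> (nat \<Rightarrow> real) \<Rightarrow> fn set" where
  "Hsp d m S \<epsilon> = (if m < 0 \<or> card S \<ge> d then {\<lambda>x. 0} else
     {p. polyfun d p \<and> (\<exists>c. \<forall>x\<in>Tint d.
          p x = (\<Sum>mm\<in>multis (Aset d S) (nat m). c mm * Rfun d S \<epsilon> mm x))})"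

definition times_sp :: "nat \<Rightarrow> nat set \<Rightarrow> fn set \<Rightarrow> fn set" where
  "times_sp d J P = {(\<lambda>x. xprod d J x * p x) | p. p \<in> P}"

definition sum_sp :: "'i set \<Rightarrow> ('i \<Rightarrow> fn set) \<Rightarrow> fn set" where
  "sum_sp I U = {(\<lambda>x. \<Sum>J\<in>I. f J x) | f. \<forall>J\<in>I. f J \<in> U J}"

definition direct_sp :: "'i set \<Rightarrow> ('i \<Rightarrow> fn set) \<Rightarrow> bool" where
  "direct_sp I U \<longleftrightarrow> (\<forall>f. (\<forall>J\<in>I. f J \<in> U J) \<longrightarrow> (\<lambda>x. \<Sum>J\<in>I. f J x) = (\<lambda>x. 0)
      \<longrightarrow> (\<forall>J\<in>I. f J = (\<lambda>x. 0)))"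

definition has_dim :: "fn set \<Rightarrow> nat \<Rightarrow> bool" where
  "has_dim P N \<longleftrightarrow> (\<exists>b. (\<forall>i<N. b i \<in> P) \<and>
      (\<forall>a. (\<lambda>x. \<Sum>i<N. a i * b i x) = (\<lambda>x. 0) \<longrightarrow> (\<forall>i<N. a i = 0)) \<and>
      P = {(\<lambda>x. \<Sum>i<N. a i * b i x) | a. True})"

definition Lop :: "nat \<Rightarrow> (nat \<Rightarrow> real) \<Rightarrow> fn \<Rightarrow> fn" where
  "Lop d \<epsilon> u x =
     (\<Sum>i=1..d. x i * (1 - x i) * pd i (pd i u) x)
     - 2 * (\<Sum>i\<in>{1..d}. \<Sum>j\<in>{i<..d}. x i * x j * pd i (pd j u) x)
     + (\<Sum>i=1..d. (\<epsilon> i + 1 - ((\<Sum>l=1..d+1. \<epsilon> l) + real d + 1) * x i) * pd i u x)"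

definition epsneg :: "nat \<Rightarrow> nat \<Rightarrow> (nat \<Rightarrow> real) \<Rightarrow> nat \<Rightarrow> real" where
  "epsneg d k \<gamma> = (\<lambda>i. if i \<le> d + 1 - k then \<gamma> i else -1)"

definition epsJ :: "nat \<Rightarrow> nat \<Rightarrow> (nat \<Rightarrow> real) \<Rightarrow> nat set \<Rightarrow> nat \<Rightarrow> real" where
  "epsJ d k \<gamma> J = (\<lambda>i. if i \<le> d + 1 - k then \<gamma> i else if i \<in> J then 1 else 0)"

definition Bset :: "nat \<Rightarrow> nat \<Rightarrow> nat set" where
  "Bset d k = {d + 2 - k..d + 1}"

text \<open>Summand indexed by J subset B: J = B gives x_B V_{n-k}(W_{gamma,1_k});
  otherwise x_J H_{n-|J|, B-J}(W_{eps^J}) (J = {} gives H_{n,B}(W_{(gamma,0_k)})).\<close>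
definition summand :: "nat \<Rightarrow> nat \<Rightarrow> (nat \<Rightarrow> real) \<Rightarrow> nat \<Rightarrow> nat set \<Rightarrow> fn set" where
  "summand d k \<gamma> n J = (if J = Bset d k
     then times_sp d J (Vsp d (int n - int k) (epsJ d k \<gamma> J))
     else times_sp d J (Hsp d (int n - int (card J)) (Bset d k - J) (epsJ d k \<gamma> J)))"

definition Iset :: "nat \<Rightarrow> nat \<Rightarrow> nat set set" where
  "Iset d k = (if k = 1 then {{}, Bset d k}
     else if k \<le> d then {J. J \<subseteq> Bset d k}
     else {J. J \<subseteq> Bset d k \<and> 2 \<le> card J})"

definition Ucal :: "nat \<Rightarrow> nat \<Rightarrow> (nat \<Rightarrow> real) \<Rightarrow> (nat \<Rightarrow> real) \<Rightarrow> nat \<Rightarrow> fn set" where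
  "Ucal d k \<gamma> c n = (if n = 0 then {(\<lambda>x. a) | a. True}
     else if k = d + 1 \<and> n = 1 then {(\<lambda>x. \<Sum>i=1..d. a i * (x i + c i)) | a. True}
     else sum_sp (Iset d k) (summand d k \<gamma> n))"

end

theory Submission
  imports Defs
begin

text \<open>Write a polynomial of degree at most \<open>n\<close> as a homogeneous form \<open>F\<close> of degree \<open>n\<close> in the barycentric
  coordinates \<open>x\<^sub>1, \<dots>, x\<^bsub>d+1\<^esub>\<close>. Then \<open>L\<^sub>\<epsilon> F = -n (n + |\<epsilon>| + d) F\<close> holds as soon as
  \<open>M\<^sub>\<epsilon> F = \<Sum>\<^sub>i (x\<^sub>i \<partial>\<^sub>i\<^sup>2 + (\<epsilon>\<^sub>i + 1) \<partial>\<^sub>i) F = 0\<close>. If \<open>\<epsilon>\<^sub>i = -1\<close>, the \<open>i\<close>-th summand kills \<open>1\<close> and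
  \<open>x\<^sub>i\<close>, so \<open>M\<^sub>\<epsilon>\<close> respects the splitting of forms according to the set \<open>J \<subseteq> B\<close> of those singular
  variables that occur in a monomial, and on the \<open>J\<close>-part \<open>x\<^sub>J G\<close> it becomes \<open>M\<close> for the exponents \<open>\<epsilon>\<^sup>J\<close>
  on the face spanned by the variables outside \<open>B - J\<close>. On each face the kernel is the span of the
  Rodrigues polynomials, because a kernel form is determined by its restriction to \<open>x\<^sub>r = 0\<close> and the
  Rodrigues polynomials restrict there to nonzero multiples of the distinct monomials. For \<open>J = B\<close> the
  kernel is the space of orthogonal polynomials, by Green's formula for the Dirichlet moments. The
  dimensions add up by Vandermonde's identity.\<close>

section \<open>Multi-indices and barycentric monomials\<close>

text \<open>The barycentric coordinates sum to 1, so a polynomial alone does not reveal which of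
  them it contains. A form of one fixed degree does: any positive vector, divided by its coordinate
  sum, is a point of the open simplex, so the values there determine all coefficients. For this
  reason all summands are rewritten as forms of the same degree \<open>n\<close>, and the operator
  is studied on coefficient families. The exponent 1 in \<open>epsJ\<close> comes from (a + 1)((a +
  1) - 1) = a (a + 1): removing one factor \<open>x_i\<close> turns the coefficient belonging to
  exponent -1 into the one belonging to exponent 1. Rodrigues functions contain real powers and are
  meaningful only for positive coordinates. They are compared with polynomials on the open simplex,
  which suffices because two polynomials equal there are equal. Green's formula alone shows that
  kernel forms are orthogonal. The converse needs positivity as well: if F is orthogonal to lower
  degrees, then the form obtained by applying the operator to F is orthogonal to itself. In the
  dimension count, a face with one more variable carries forms of one degree less, so all the
  binomials have the same upper index.\<close>

abbreviation inc :: "nat \<Rightarrow> (nat \<Rightarrow> nat) \<Rightarrow> nat \<Rightarrow> nat" where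
  "inc i \<alpha> \<equiv> \<alpha>(i := Suc (\<alpha> i))"
abbreviation dec :: "nat \<Rightarrow> (nat \<Rightarrow> nat) \<Rightarrow> nat \<Rightarrow> nat" where
  "dec i \<alpha> \<equiv> \<alpha>(i := \<alpha> i - 1)"

lemma finite_multis [simp]: "finite A \<Longrightarrow> finite (multis A m)"
proof -
  assume A: "finite A"
  have "multis A m \<subseteq> {f. \<forall>x. (x \<in> A \<longrightarrow> f x \<in> {..m}) \<and> (x \<notin> A \<longrightarrow> f x = 0)}"
    using A by (auto simp: multis_def intro: member_le_sum)
  then show ?thesis
    using finite_set_of_finite_funs[OF A, of "{..m}" 0] finite_subset by blast
qed

lemma sum_inc: "finite A \<Longrightarrow> i \<in> A \<Longrightarrow> sum (inc i \<alpha>) A = Suc (sum \<alpha> A)"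
  by (simp add: sum.remove)

lemma inc_mem_multis:
  "finite A \<Longrightarrow> i \<in> A \<Longrightarrow> inc i \<beta> \<in> multis A m \<longleftrightarrow> m > 0 \<and> \<beta> \<in> multis A (m - 1)"
proof -
  assume A: "finite A" "i \<in> A"
  have "(\<forall>j. j \<notin> A \<longrightarrow> inc i \<beta> j = 0) \<longleftrightarrow> (\<forall>j. j \<notin> A \<longrightarrow> \<beta> j = 0)"
    using A by auto
  then show ?thesis
    unfolding multis_def mem_Collect_eq sum_inc[OF A] by auto
qed

lemma inc_mem_multis_Suc:
  "finite A \<Longrightarrow> i \<in> A \<Longrightarrow> inc i \<beta> \<in> multis A (Suc m) \<longleftrightarrow> \<beta> \<in> multis A m"
  by (simp add: inc_mem_multis)

lemma inc_dec: "\<alpha> i > 0 \<Longrightarrow> inc i (dec i \<alpha>) = \<alpha>"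
  by auto

lemma multis_mono: "A \<subseteq> A' \<Longrightarrow> finite A' \<Longrightarrow> multis A m \<subseteq> multis A' m"
proof
  fix \<alpha> assume "A \<subseteq> A'" "finite A'" "\<alpha> \<in> multis A m"
  moreover from this have "sum \<alpha> A' = sum \<alpha> A"
    by (intro sum.mono_neutral_right) (auto simp: multis_def)
  ultimately show "\<alpha> \<in> multis A' m"
    by (auto simp: multis_def)
qed

lemma multis_0: "finite A \<Longrightarrow> multis A 0 = {\<lambda>_. 0}"
  by (auto simp: multis_def fun_eq_iff)

text \<open>Stars and bars by Pascal's rule: either the new index has exponent 0, or one unit can be
  taken from it. The truncated subtraction is harmless for empty \<open>A\<close>, where the value
  is 0 choose 0 = 1 for \<open>m = 0\<close> and (m - 1) choose m = 0 otherwise.\<close>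

lemma card_multis: "finite A \<Longrightarrow> card (multis A m) = (m + card A - 1) choose m"
proof (induction A arbitrary: m rule: finite_induct)
  case empty
  have "multis {} m = (if m = 0 then {\<lambda>_. 0} else {})"
    by (auto simp: multis_def)
  then show ?case by simp
next
  case (insert a A)
  have fin: "finite (insert a A)" using insert by simp
  show ?case
  proof (induction m)
    case 0
    then show ?case using fin by (simp add: multis_0)
  next
    case (Suc m)
    have eq: "multis (insert a A) (Suc m) = multis A (Suc m) \<union> inc a ` multis (insert a A) m"
    proof (intro equalityI subsetI)
      fix \<alpha> assume \<alpha>: "\<alpha> \<in> multis (insert a A) (Suc m)"
      show "\<alpha> \<in> multis A (Suc m) \<union> inc a ` multis (insert a A) m"
      proof (cases "\<alpha> a = 0")
        case True
        then have "\<alpha> \<in> multis A (Suc m)"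
          using \<alpha> insert.hyps by (auto simp: multis_def) metis
        then show ?thesis ..
      next
        case False
        then have "\<alpha> = inc a (dec a \<alpha>)" by auto
        moreover from this \<alpha> have "dec a \<alpha> \<in> multis (insert a A) m"
          using inc_mem_multis_Suc[OF fin, of a "dec a \<alpha>" m] by auto
        ultimately show ?thesis by blast
      qed
    next
      fix \<alpha> assume "\<alpha> \<in> multis A (Suc m) \<union> inc a ` multis (insert a A) m"
      then show "\<alpha> \<in> multis (insert a A) (Suc m)"
        using multis_mono[of A "insert a A" "Suc m"] fin inc_mem_multis_Suc[OF fin, of a _ m] by auto
    qed
    have disj: "multis A (Suc m) \<inter> inc a ` multis (insert a A) m = {}"
      using insert.hyps by (auto simp: multis_def)
    have inj: "inj_on (inc a) (multis (insert a A) m)"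
    proof (rule inj_onI)
      fix x y assume *: "inc a x = inc a y"
      show "x = y"
      proof
        fix i show "x i = y i" using fun_cong[OF *, of i] by (auto split: if_splits)
      qed
    qed
    have "card (multis (insert a A) (Suc m)) = card (multis A (Suc m)) + card (multis (insert a A) m)"
      unfolding eq using fin insert.hyps disj inj by (simp add: card_Un_disjoint card_image)
    also have "\<dots> = (m + card A choose Suc m) + (m + card A choose m)"
      using insert.IH[of "Suc m"] Suc insert.hyps by simp
    also have "\<dots> = (Suc m + card (insert a A) - 1) choose Suc m"
      using insert.hyps by simp
    finally show ?case .
  qed
qed

section \<open>Barycentric monomials, their derivatives, and the differential operator on
  them\<close>

definition mon :: "nat \<Rightarrow> (nat \<Rightarrow> nat) \<Rightarrow> fn" where
  "mon d \<alpha> x = (\<Prod>i=1..d+1. xx d x i ^ \<alpha> i)"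

text \<open>The restriction of a form in d + 1 independent variables to the hyperplane where they
  sum to 1. The family \<open>c\<close> matters only on multi-indices of degree
  \<open>N\<close>.\<close>

definition hp :: "nat \<Rightarrow> nat \<Rightarrow> ((nat \<Rightarrow> nat) \<Rightarrow> real) \<Rightarrow> fn" where
  "hp d N c x = (\<Sum>\<alpha>\<in>multis {1..d+1} N. c \<alpha> * mon d \<alpha> x)"

text \<open>Differentiability is demanded at every point, so that \<open>pd_eq\<close> gives an
  equation between functions, which can be differentiated again.\<close>

definition has_pd :: "nat \<Rightarrow> fn \<Rightarrow> fn \<Rightarrow> bool" where
  "has_pd i f f' \<longleftrightarrow> (\<forall>x. ((\<lambda>t. f (x(i := t))) has_real_derivative f' x) (at (x i)))"

lemma pd_eq: "has_pd i f f' \<Longrightarrow> pd i f = f'"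
  unfolding has_pd_def pd_def by (auto intro!: ext DERIV_imp_deriv)

lemma has_pd_sum:
  "(\<And>k. k \<in> K \<Longrightarrow> has_pd i (f k) (f' k)) \<Longrightarrow>
   has_pd i (\<lambda>x. \<Sum>k\<in>K. f k x) (\<lambda>x. \<Sum>k\<in>K. f' k x)"
  unfolding has_pd_def by (auto intro!: DERIV_sum)

lemma has_pd_cmult: "has_pd i f f' \<Longrightarrow> has_pd i (\<lambda>x. c * f x) (\<lambda>x. c * f' x)"
  unfolding has_pd_def by (auto intro!: DERIV_cmult)

lemma has_pd_diff:
  "has_pd i f f' \<Longrightarrow> has_pd i g g' \<Longrightarrow> has_pd i (\<lambda>x. f x - g x) (\<lambda>x. f' x - g' x)"
  unfolding has_pd_def by (auto intro!: DERIV_diff)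

lemma sum_xx: "(\<Sum>i=1..d+1. xx d x i) = 1"
  by (simp add: xx_def)

lemma xx_le: "i \<le> d \<Longrightarrow> xx d x i = x i"
  by (simp add: xx_def)

lemma xx_upd:
  assumes "i \<in> {1..d}"
  shows "xx d (x(i := t)) j = (if j = i then t else if j = d + 1 then xx d x (d+1) + x i - t else xx d x j)"
proof -
  have "(\<Sum>j=1..d. (x(i := t)) j) = t + (\<Sum>j\<in>{1..d}-{i}. (x(i := t)) j)"
    using assms by (subst sum.remove[of _ i]) auto
  also have "(\<Sum>j\<in>{1..d}-{i}. (x(i := t)) j) = (\<Sum>j\<in>{1..d}-{i}. x j)"
    by (rule sum.cong) auto
  also have "\<dots> = (\<Sum>j=1..d. x j) - x i"
    using assms by (subst sum.remove[of "{1..d}" i]) auto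
  finally show ?thesis using assms by (auto simp: xx_def)
qed

lemma prod_two:
  fixes f :: "nat \<Rightarrow> 'a::comm_monoid_mult"
  assumes "finite A" "i \<in> A" "r \<in> A" "i \<noteq> r"
  shows "prod f A = f i * f r * prod f (A - {i,r})"
proof -
  have "A - {i} - {r} = A - {i,r}" by auto
  then show ?thesis
    using assms prod.remove[of A i f] prod.remove[of "A - {i}" r f] by (simp add: mult.assoc)
qed

lemma sum_two:
  fixes f :: "nat \<Rightarrow> 'a::comm_monoid_add"
  assumes "finite A" "i \<in> A" "r \<in> A" "i \<noteq> r"
  shows "sum f A = f i + f r + sum f (A - {i,r})"
proof -
  have "A - {i} - {r} = A - {i,r}" by auto
  then show ?thesis
    using assms sum.remove[of A i f] sum.remove[of "A - {i}" r f] by (simp add: add.assoc)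
qed

lemma mon_inc:
  assumes "i \<in> {1..d+1}" shows "mon d (inc i \<alpha>) x = xx d x i * mon d \<alpha> x"
proof -
  have "(\<Prod>j\<in>{1..d+1}-{i}. xx d x j ^ inc i \<alpha> j) = (\<Prod>j\<in>{1..d+1}-{i}. xx d x j ^ \<alpha> j)"
    by (rule prod.cong) auto
  then show ?thesis
    unfolding mon_def
    using assms prod.remove[of "{1..d+1}" i "\<lambda>j. xx d x j ^ inc i \<alpha> j"]
      prod.remove[of "{1..d+1}" i "\<lambda>j. xx d x j ^ \<alpha> j"] by (simp add: mult.assoc)
qed

lemma xx_mult_mon_dec:
  assumes "i \<in> {1..d+1}"
  shows "xx d x i * (real (\<alpha> i) * mon d (dec i \<alpha>) x) = real (\<alpha> i) * mon d \<alpha> x"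
  using mon_inc[OF assms, of "dec i \<alpha>" x] inc_dec[of \<alpha> i] by (cases "\<alpha> i = 0") auto

text \<open>Chain rule: since the last coordinate is 1 minus the others, the derivative in
  \<open>x_i\<close> acts on forms as the formal difference of the i-th and the (d+1)-st derivative.
  A vanishing exponent does no harm, as its factor 0 suppresses the truncated
  \<open>dec\<close>.\<close>

lemma has_pd_mon:
  assumes i: "i \<in> {1..d}"
  shows "has_pd i (mon d \<alpha>)
    (\<lambda>x. real (\<alpha> i) * mon d (dec i \<alpha>) x - real (\<alpha> (d+1)) * mon d (dec (d+1) \<alpha>) x)"
  unfolding has_pd_def
proof
  fix x :: pt
  let ?r = "d + 1"
  let ?P = "\<Prod>j\<in>{1..d+1}-{i,?r}. xx d x j ^ \<alpha> j"
  have ir: "i \<in> {1..d+1}" "?r \<in> {1..d+1}" "i \<noteq> ?r" using i by auto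
  have split: "mon d \<beta> y = xx d y i ^ \<beta> i * xx d y ?r ^ \<beta> ?r * (\<Prod>j\<in>{1..d+1}-{i,?r}. xx d y j ^ \<beta> j)"
    for \<beta> y unfolding mon_def by (rule prod_two) (use ir in auto)
  have c: "(\<Prod>j\<in>{1..d+1}-{i,?r}. xx d (x(i := t)) j ^ \<beta> j) = ?P"
    if "\<And>j. j \<notin> {i,?r} \<Longrightarrow> \<beta> j = \<alpha> j" for \<beta> t
    by (rule prod.cong) (auto simp: xx_upd[OF i] that)
  have c': "(\<Prod>j\<in>{1..d+1}-{i,?r}. xx d x j ^ \<beta> j) = ?P"
    if "\<And>j. j \<notin> {i,?r} \<Longrightarrow> \<beta> j = \<alpha> j" for \<beta>
    by (rule prod.cong) (auto simp: that)
  have f: "mon d \<alpha> (x(i := t)) = t ^ \<alpha> i * (xx d x ?r + x i - t) ^ \<alpha> ?r * ?P" for t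
    unfolding split[of \<alpha> "x(i := t)"] by (subst c) (use i in \<open>auto simp: xx_upd[OF i]\<close>)
  have "((\<lambda>t. t ^ \<alpha> i * (xx d x ?r + x i - t) ^ \<alpha> ?r * ?P) has_real_derivative
     (real (\<alpha> i) * x i ^ (\<alpha> i - 1) * xx d x ?r ^ \<alpha> ?r - real (\<alpha> ?r) * x i ^ \<alpha> i * xx d x ?r ^ (\<alpha> ?r - 1)) * ?P) (at (x i))"
    by (auto intro!: derivative_eq_intros simp: algebra_simps)
  moreover have "mon d (dec i \<alpha>) x = x i ^ (\<alpha> i - 1) * xx d x ?r ^ \<alpha> ?r * ?P"
    unfolding split[of "dec i \<alpha>" x] by (subst c') (use i in \<open>auto simp: xx_le\<close>)
  moreover have "mon d (dec ?r \<alpha>) x = x i ^ \<alpha> i * xx d x ?r ^ (\<alpha> ?r - 1) * ?P"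
    unfolding split[of "dec ?r \<alpha>" x] by (subst c') (use i in \<open>auto simp: xx_le\<close>)
  ultimately show "((\<lambda>t. mon d \<alpha> (x(i := t))) has_real_derivative
     real (\<alpha> i) * mon d (dec i \<alpha>) x - real (\<alpha> ?r) * mon d (dec ?r \<alpha>) x) (at (x i))"
    unfolding f by (simp add: algebra_simps)
qed

text \<open>Turns the sum over i < j in \<open>Lop\<close> into the full square, where sums can be
  evaluated coordinate by coordinate.\<close>

lemma sum_symmetric_split:
  fixes f :: "nat \<Rightarrow> nat \<Rightarrow> real"
  assumes "\<And>i j. f i j = f j i"
  shows "(\<Sum>i=1..d. \<Sum>j=1..d. f i j) = (\<Sum>i=1..d. f i i) + 2 * (\<Sum>i\<in>{1..d}. \<Sum>j\<in>{i<..d}. f i j)"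
proof (induction d)
  case (Suc d)
  have a: "(\<Sum>i=1..Suc d. \<Sum>j=1..Suc d. f i j)
      = (\<Sum>i=1..d. \<Sum>j=1..d. f i j) + 2 * (\<Sum>i=1..d. f i (Suc d)) + f (Suc d) (Suc d)"
    using assms by (simp add: sum.distrib)
  have "(\<Sum>j\<in>{i<..Suc d}. f i j) = (\<Sum>j\<in>{i<..d}. f i j) + f i (Suc d)" if "i \<in> {1..d}" for i
  proof -
    have "{i<..Suc d} = insert (Suc d) {i<..d}" using that by auto
    then show ?thesis by simp
  qed
  then have "(\<Sum>i\<in>{1..Suc d}. \<Sum>j\<in>{i<..Suc d}. f i j)
      = (\<Sum>i\<in>{1..d}. \<Sum>j\<in>{i<..d}. f i j) + (\<Sum>i=1..d. f i (Suc d))"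
    by (simp add: sum.distrib)
  then show ?case using a Suc by simp
qed simp


definition mon_pd :: "nat \<Rightarrow> nat \<Rightarrow> (nat \<Rightarrow> nat) \<Rightarrow> fn" where
  "mon_pd d i \<alpha> x = real (\<alpha> i) * mon d (dec i \<alpha>) x - real (\<alpha> (d+1)) * mon d (dec (d+1) \<alpha>) x"

definition mon_pd2 :: "nat \<Rightarrow> nat \<Rightarrow> nat \<Rightarrow> (nat \<Rightarrow> nat) \<Rightarrow> fn" where
  "mon_pd2 d i j \<alpha> x = real (\<alpha> j) * mon_pd d i (dec j \<alpha>) x
     - real (\<alpha> (d+1)) * mon_pd d i (dec (d+1) \<alpha>) x"

lemma has_pd_mon_pd: "i \<in> {1..d} \<Longrightarrow> has_pd i (mon d \<alpha>) (mon_pd d i \<alpha>)"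
  unfolding mon_pd_def by (rule has_pd_mon)

lemma has_pd_mon_pd2: "i \<in> {1..d} \<Longrightarrow> has_pd i (mon_pd d j \<alpha>) (mon_pd2 d i j \<alpha>)"
  unfolding mon_pd2_def mon_pd_def[of d j, abs_def]
  by (intro has_pd_diff has_pd_cmult has_pd_mon_pd)

text \<open>The computation behind the eigenvalue. Euler's relation turns each product of a
  coordinate with a formal derivative in the same variable into a multiple of a lower derivative.
  What survives is the operator that lowers the degree by one, and a scalar multiple of the
  monomial.\<close>

lemma mon_pd2_mon:
  assumes \<alpha>: "\<alpha> \<in> multis {1..d+1} N"
  defines "r \<equiv> d + 1"
  shows "(\<Sum>i=1..d. x i * (1 - x i) * mon_pd2 d i i \<alpha> x)
     - 2 * (\<Sum>i\<in>{1..d}. \<Sum>j\<in>{i<..d}. x i * x j * mon_pd2 d i j \<alpha> x)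
     + (\<Sum>i=1..d. (\<epsilon> i + 1 - ((\<Sum>l=1..d+1. \<epsilon> l) + real d + 1) * x i) * mon_pd d i \<alpha> x)
   = (\<Sum>i=1..d+1. real (\<alpha> i) * (real (\<alpha> i) + \<epsilon> i) * mon d (dec i \<alpha>) x)
     - real N * (real N + (\<Sum>l=1..d+1. \<epsilon> l) + real d) * mon d \<alpha> x" (is "?L = ?R")
proof -
  let ?D = "{1..d+1}"
  define a where "a i = real (\<alpha> i)" for i
  define u where "u = mon d \<alpha> x"
  \<comment> \<open>\<open>G i\<close> and \<open>H j i\<close> are the formal first and second
    derivatives of the monomial, with all d + 1 coordinates treated as independent;
    \<open>xG\<close> and \<open>xH\<close> are Euler's relations for them.\<close>
  define G where "G i = a i * mon d (dec i \<alpha>) x" for i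
  define H where "H j i = a j * (real (dec j \<alpha> i) * mon d (dec i (dec j \<alpha>)) x)" for i j
  have xG: "xx d x i * G i = a i * u" if "i \<in> ?D" for i
    using xx_mult_mon_dec[OF that, of x \<alpha>] by (simp add: G_def a_def u_def)
  have xH: "xx d x i * H j i = (a i - of_bool (i = j)) * G j" if "i \<in> ?D" for i j
  proof -
    have "xx d x i * H j i = a j * (real (dec j \<alpha> i) * mon d (dec j \<alpha>) x)"
      unfolding H_def using xx_mult_mon_dec[OF that, of x "dec j \<alpha>"] by (simp only: mult.left_commute)
    also have "a j * real (dec j \<alpha> i) = a j * (a i - of_bool (i = j))"
      by (cases "\<alpha> j = 0") (auto simp: a_def of_nat_diff)
    then have "a j * (real (dec j \<alpha> i) * mon d (dec j \<alpha>) x) = (a i - of_bool (i = j)) * G j"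
      by (simp only: G_def mult.assoc[symmetric]) (simp add: mult.commute)
    finally show ?thesis .
  qed
  have Hsym: "H i j = H j i" for i j
  proof (cases "i = j")
    case False
    then have "dec j (dec i \<alpha>) = dec i (dec j \<alpha>)" by (auto simp: fun_eq_iff)
    then show ?thesis using False by (simp add: H_def a_def)
  qed simp
  have p1: "mon_pd d i \<alpha> x = G i - G r" for i
    by (simp add: mon_pd_def G_def a_def r_def)
  have p2: "mon_pd2 d i j \<alpha> x = H j i - H j r - H r i + H r r" for i j
    by (simp add: mon_pd2_def mon_pd_def H_def a_def r_def algebra_simps)
  define A where "A = (\<Sum>i=1..d. a i)"
  define X where "X = (\<Sum>i=1..d. x i)"
  have rD: "r \<in> ?D" by (simp add: r_def)
  have xi: "xx d x i = x i" "i \<in> ?D" "i \<noteq> r" if "i \<in> {1..d}" for i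
    using that by (auto simp: xx_def r_def)
  have xr: "xx d x r = 1 - X" by (simp add: xx_def r_def X_def)
  \<comment> \<open>The last coordinate equals 1 - \<open>X\<close>, so its Euler relations remove
    every factor \<open>X\<close>, including the square of \<open>X\<close> in front of
    \<open>H r r\<close>.\<close>
  have XG: "X * G r = G r - a r * u" using xG[OF rD] xr by (simp add: algebra_simps)
  have XH: "X * H r r = H r r - (a r - 1) * G r" using xH[OF rD, of r] xr by (simp add: algebra_simps)
  have NA: "real N = A + a r"
  proof -
    have "N = sum \<alpha> {1..d} + \<alpha> (d+1)" using \<alpha> by (simp add: multis_def)
    then show ?thesis by (simp add: A_def a_def r_def)
  qed
  have s1: "(\<Sum>i=1..d. x i * G i) = A * u"
    unfolding A_def sum_distrib_right by (rule sum.cong) (use xG xi in fastforce)+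
  have s2: "x i * H j i = (a i - of_bool (i = j)) * G j" if "i \<in> {1..d}" for i j
    using xH[of i j] xi[OF that] by simp
  have s3: "(\<Sum>i=1..d. x i * H r i) = A * G r"
    unfolding A_def sum_distrib_right by (rule sum.cong) (use s2 xi in fastforce)+
  have s4: "(\<Sum>i=1..d. x i * H i i) = (\<Sum>i=1..d. (a i - 1) * G i)"
    by (rule sum.cong) (use s2 in auto)
  have s5: "(\<Sum>i=1..d. \<Sum>j=1..d. x i * x j * H j i) = (A * A - A) * u"
  proof -
    have "(\<Sum>i=1..d. \<Sum>j=1..d. x i * x j * H j i) = (\<Sum>i=1..d. \<Sum>j=1..d. (a i - of_bool (i = j)) * (a j * u))"
    proof (intro sum.cong refl)
      fix i j assume i: "i \<in> {1..d}" and j: "j \<in> {1..d}"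
      have "x i * x j * H j i = x j * (x i * H j i)" by simp
      also have "\<dots> = (a i - of_bool (i = j)) * (x j * G j)" using s2[OF i, of j] by simp
      also have "x j * G j = a j * u" using xG[of j] xi[OF j] by simp
      finally show "x i * x j * H j i = (a i - of_bool (i = j)) * (a j * u)" .
    qed
    also have "\<dots> = (\<Sum>i=1..d. a i * (A * u) - a i * u)"
    proof (intro sum.cong refl)
      fix i assume i: "i \<in> {1..d}"
      have "(\<Sum>j=1..d. (a i - of_bool (i = j)) * (a j * u))
         = (\<Sum>j=1..d. a i * (a j * u)) - (\<Sum>j=1..d. if i = j then a j * u else 0)"
        unfolding sum_subtractf[symmetric] by (rule sum.cong) (auto simp: algebra_simps)
      moreover have "(\<Sum>j=1..d. if i = j then a j * u else 0) = a i * u"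
        using i by (simp add: sum.delta)
      ultimately show "(\<Sum>j=1..d. (a i - of_bool (i = j)) * (a j * u)) = a i * (A * u) - a i * u"
        by (simp only: A_def sum_distrib_left sum_distrib_right)
    qed
    also have "\<dots> = (A * A - A) * u"
    proof -
      have "(\<Sum>i=1..d. a i * (A * u)) = A * (A * u)" "(\<Sum>i=1..d. a i * u) = A * u"
        unfolding A_def sum_distrib_right by auto
      then show ?thesis by (simp add: sum_subtractf left_diff_distrib mult.assoc)
    qed
    finally show ?thesis .
  qed
  have s6: "(\<Sum>i=1..d. \<Sum>j=1..d. x i * x j * H j r) = X * (A * G r)"
  proof -
    have "(\<Sum>i=1..d. \<Sum>j=1..d. x i * x j * H j r) = (\<Sum>i=1..d. x i * (\<Sum>j=1..d. x j * H r j))"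
      unfolding sum_distrib_left by (intro sum.cong refl) (use Hsym in \<open>simp add: mult.assoc\<close>)
    then show ?thesis using s3 by (simp add: X_def sum_distrib_right)
  qed
  have s7: "(\<Sum>i=1..d. \<Sum>j=1..d. x i * x j * H r i) = X * (A * G r)"
  proof -
    have "(\<Sum>i=1..d. \<Sum>j=1..d. x i * x j * H r i) = (\<Sum>j=1..d. \<Sum>i=1..d. x j * x i * H i r)"
      by (subst sum.swap, intro sum.cong refl) (use Hsym in \<open>simp add: mult.commute\<close>)
    then show ?thesis using s6 by simp
  qed
  have s8: "(\<Sum>i=1..d. \<Sum>j=1..d. x i * x j * H r r) = X * X * H r r"
    by (simp add: X_def sum_product) (simp add: sum_distrib_right)
  have dbl: "(\<Sum>i=1..d. \<Sum>j=1..d. x i * x j * mon_pd2 d i j \<alpha> x)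
     = (A * A - A) * u - 2 * (X * (A * G r)) + X * X * H r r"
    unfolding p2 using s5 s6 s7 s8 by (simp add: ring_distribs sum.distrib sum_subtractf)
  have dg: "(\<Sum>i=1..d. x i * mon_pd2 d i i \<alpha> x) = (\<Sum>i=1..d. (a i - 1) * G i) - 2 * (A * G r) + X * H r r"
  proof -
    have "(\<Sum>i=1..d. x i * mon_pd2 d i i \<alpha> x) = (\<Sum>i=1..d. x i * H i i - x i * H r i - x i * H r i + x i * H r r)"
    proof (intro sum.cong refl)
      fix i show "x i * mon_pd2 d i i \<alpha> x = x i * H i i - x i * H r i - x i * H r i + x i * H r r"
        unfolding p2 using Hsym[of i r] by (simp add: ring_distribs)
    qed
    then show ?thesis unfolding sum.distrib sum_subtractf s3 s4 by (simp add: X_def sum_distrib_right)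
  qed
  have sym: "x i * x j * mon_pd2 d i j \<alpha> x = x j * x i * mon_pd2 d j i \<alpha> x" for i j
    unfolding p2 using Hsym by simp
  define E where "E = (\<Sum>l=1..d. \<epsilon> l)"
  have Es: "(\<Sum>l=1..d+1. \<epsilon> l) = E + \<epsilon> r" by (simp add: E_def r_def)
  \<comment> \<open>The squares \<open>x_i * x_i\<close> in the diagonal part complete the
    off-diagonal part to the full double sum.\<close>
  have "(\<Sum>i=1..d. x i * (1 - x i) * mon_pd2 d i i \<alpha> x)
     - 2 * (\<Sum>i\<in>{1..d}. \<Sum>j\<in>{i<..d}. x i * x j * mon_pd2 d i j \<alpha> x)
    = (\<Sum>i=1..d. x i * mon_pd2 d i i \<alpha> x) - (\<Sum>i=1..d. \<Sum>j=1..d. x i * x j * mon_pd2 d i j \<alpha> x)"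
    by (subst sum_symmetric_split[OF sym]) (simp add: right_diff_distrib left_diff_distrib sum_subtractf)
  also have "\<dots> = (\<Sum>i=1..d. (a i - 1) * G i) + (a r - 1) * G r - (real N * real N - real N) * u"
    (is "?s = _")
  proof -
    have "?s = (\<Sum>i=1..d. (a i - 1) * G i) - 2 * A * (G r - X * G r) + (X * H r r) - X * (X * H r r) - (A * A - A) * u"
      unfolding dbl dg by (simp add: algebra_simps)
    also have "X * (X * H r r) = X * H r r - (a r - 1) * (X * G r)"
      unfolding XH by (simp add: algebra_simps XH)
    finally show ?thesis unfolding XG NA by (simp add: algebra_simps)
  qed
  finally have second: "(\<Sum>i=1..d. x i * (1 - x i) * mon_pd2 d i i \<alpha> x)
     - 2 * (\<Sum>i\<in>{1..d}. \<Sum>j\<in>{i<..d}. x i * x j * mon_pd2 d i j \<alpha> x)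
    = (\<Sum>i=1..d. (a i - 1) * G i) + (a r - 1) * G r - (real N * real N - real N) * u" .
  let ?c = "E + \<epsilon> r + real d + 1"
  have "(\<Sum>i=1..d. (\<epsilon> i + 1 - ?c * x i) * mon_pd d i \<alpha> x)
     = (\<Sum>i=1..d. (\<epsilon> i + 1) * G i) - (\<Sum>i=1..d. (\<epsilon> i + 1) * G r) - (\<Sum>i=1..d. ?c * (x i * G i)) + (\<Sum>i=1..d. x i * (?c * G r))"
    unfolding p1 sum_subtractf[symmetric] sum.distrib[symmetric]
    by (rule sum.cong) (auto simp: algebra_simps)
  also have "\<dots> = (\<Sum>i=1..d. (\<epsilon> i + 1) * G i) - (E + real d) * G r - ?c * (A * u) + ?c * (X * G r)"
    unfolding s1[symmetric] sum_distrib_left[symmetric] sum_distrib_right[symmetric] X_def[symmetric]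
    by (simp add: sum.distrib E_def)
  also have "\<dots> = (\<Sum>i=1..d. (\<epsilon> i + 1) * G i) + (\<epsilon> r + 1) * G r - ?c * real N * u"
    unfolding XG NA by (simp add: algebra_simps)
  finally have first: "(\<Sum>i=1..d. (\<epsilon> i + 1 - ?c * x i) * mon_pd d i \<alpha> x)
    = (\<Sum>i=1..d. (\<epsilon> i + 1) * G i) + (\<epsilon> r + 1) * G r - ?c * real N * u" .
  have R: "(\<Sum>i=1..d+1. real (\<alpha> i) * (real (\<alpha> i) + \<epsilon> i) * mon d (dec i \<alpha>) x)
    = (\<Sum>i=1..d. (a i - 1) * G i) + (\<Sum>i=1..d. (\<epsilon> i + 1) * G i) + (a r + \<epsilon> r) * G r"
  proof -
    have "(\<Sum>i=1..d+1. real (\<alpha> i) * (real (\<alpha> i) + \<epsilon> i) * mon d (dec i \<alpha>) x) = (\<Sum>i=1..d+1. (a i + \<epsilon> i) * G i)"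
      by (rule sum.cong) (auto simp: G_def a_def)
    also have "\<dots> = (\<Sum>i=1..d. (a i + \<epsilon> i) * G i) + (a r + \<epsilon> r) * G r"
      by (simp add: r_def)
    also have "(\<Sum>i=1..d. (a i + \<epsilon> i) * G i) = (\<Sum>i=1..d. (a i - 1) * G i) + (\<Sum>i=1..d. (\<epsilon> i + 1) * G i)"
      unfolding sum.distrib[symmetric] by (rule sum.cong) (auto simp: algebra_simps)
    finally show ?thesis .
  qed
  show ?thesis
    unfolding second R Es first u_def[symmetric] by (simp add: algebra_simps)
qed

lemma sum_combine3:
  fixes c :: "'a \<Rightarrow> real"
  shows "(\<Sum>k\<in>K. c k * A k) - 2 * (\<Sum>k\<in>K. c k * B k) + (\<Sum>k\<in>K. c k * C k)
    = (\<Sum>k\<in>K. c k * (A k - 2 * B k + C k))"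
  by (simp add: distrib_left right_diff_distrib sum.distrib sum_subtractf sum_distrib_left mult.left_commute)

lemma sum_combine2:
  fixes c :: "'a \<Rightarrow> real"
  shows "(\<Sum>k\<in>K. c k * (A k - l * B k)) = (\<Sum>k\<in>K. c k * A k) - l * (\<Sum>k\<in>K. c k * B k)"
  by (simp add: right_diff_distrib sum_subtractf sum_distrib_left mult.left_commute)

text \<open>The index set is arbitrary, so that sums over shifted exponents
  \<open>addJ J \<alpha>\<close> are covered without reindexing.\<close>

lemma Lop_mon_sum:
  assumes K: "finite K" "\<And>k. k \<in> K \<Longrightarrow> \<alpha> k \<in> multis {1..d+1} N"
  shows "Lop d \<epsilon> (\<lambda>x. \<Sum>k\<in>K. c k * mon d (\<alpha> k) x) x
     = (\<Sum>k\<in>K. c k * (\<Sum>i=1..d+1. real (\<alpha> k i) * (real (\<alpha> k i) + \<epsilon> i) * mon d (dec i (\<alpha> k)) x))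
       - real N * (real N + (\<Sum>l=1..d+1. \<epsilon> l) + real d) * (\<Sum>k\<in>K. c k * mon d (\<alpha> k) x)"
proof -
  let ?f = "\<lambda>x. \<Sum>k\<in>K. c k * mon d (\<alpha> k) x"
  have p1: "pd i ?f = (\<lambda>x. \<Sum>k\<in>K. c k * mon_pd d i (\<alpha> k) x)" if "i \<in> {1..d}" for i
    by (intro pd_eq has_pd_sum has_pd_cmult has_pd_mon_pd that)
  have p2: "pd i (pd j ?f) = (\<lambda>x. \<Sum>k\<in>K. c k * mon_pd2 d i j (\<alpha> k) x)" if "i \<in> {1..d}" "j \<in> {1..d}" for i j
    unfolding p1[OF that(2)] by (intro pd_eq has_pd_sum has_pd_cmult has_pd_mon_pd2 that)
  let ?c = "(\<Sum>l=1..d+1. \<epsilon> l) + real d + 1"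
  have "Lop d \<epsilon> ?f x = (\<Sum>i=1..d. x i * (1 - x i) * (\<Sum>k\<in>K. c k * mon_pd2 d i i (\<alpha> k) x))
     - 2 * (\<Sum>i\<in>{1..d}. \<Sum>j\<in>{i<..d}. x i * x j * (\<Sum>k\<in>K. c k * mon_pd2 d i j (\<alpha> k) x))
     + (\<Sum>i=1..d. (\<epsilon> i + 1 - ?c * x i) * (\<Sum>k\<in>K. c k * mon_pd d i (\<alpha> k) x))"
    unfolding Lop_def
    by (intro arg_cong2[where f = "(+)"] arg_cong2[where f = "(-)"] arg_cong2[where f = "(*)"] sum.cong refl)
      (use p1 p2 in \<open>simp_all cong: sum.cong_simp\<close>)
  also have "(\<Sum>i=1..d. x i * (1 - x i) * (\<Sum>k\<in>K. c k * mon_pd2 d i i (\<alpha> k) x))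
     = (\<Sum>k\<in>K. c k * (\<Sum>i=1..d. x i * (1 - x i) * mon_pd2 d i i (\<alpha> k) x))"
    unfolding sum_distrib_left by (subst sum.swap) (simp add: mult_ac)
  also have "(\<Sum>i\<in>{1..d}. \<Sum>j\<in>{i<..d}. x i * x j * (\<Sum>k\<in>K. c k * mon_pd2 d i j (\<alpha> k) x))
     = (\<Sum>k\<in>K. c k * (\<Sum>i\<in>{1..d}. \<Sum>j\<in>{i<..d}. x i * x j * mon_pd2 d i j (\<alpha> k) x))"
  proof -
    have "(\<Sum>i\<in>{1..d}. \<Sum>j\<in>{i<..d}. x i * x j * (\<Sum>k\<in>K. c k * mon_pd2 d i j (\<alpha> k) x))
      = (\<Sum>i\<in>{1..d}. \<Sum>k\<in>K. \<Sum>j\<in>{i<..d}. x i * x j * (c k * mon_pd2 d i j (\<alpha> k) x))"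
      unfolding sum_distrib_left by (intro sum.cong refl sum.swap)
    also have "\<dots> = (\<Sum>k\<in>K. \<Sum>i\<in>{1..d}. \<Sum>j\<in>{i<..d}. x i * x j * (c k * mon_pd2 d i j (\<alpha> k) x))"
      by (rule sum.swap)
    finally show ?thesis by (simp add: sum_distrib_left mult_ac)
  qed
  also have "(\<Sum>i=1..d. (\<epsilon> i + 1 - ?c * x i) * (\<Sum>k\<in>K. c k * mon_pd d i (\<alpha> k) x))
     = (\<Sum>k\<in>K. c k * (\<Sum>i=1..d. (\<epsilon> i + 1 - ?c * x i) * mon_pd d i (\<alpha> k) x))"
    unfolding sum_distrib_left by (subst sum.swap) (simp add: mult_ac)
  also have "(\<Sum>k\<in>K. c k * (\<Sum>i=1..d. x i * (1 - x i) * mon_pd2 d i i (\<alpha> k) x))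
      - 2 * (\<Sum>k\<in>K. c k * (\<Sum>i\<in>{1..d}. \<Sum>j\<in>{i<..d}. x i * x j * mon_pd2 d i j (\<alpha> k) x))
      + (\<Sum>k\<in>K. c k * (\<Sum>i=1..d. (\<epsilon> i + 1 - ?c * x i) * mon_pd d i (\<alpha> k) x))
    = (\<Sum>k\<in>K. c k * ((\<Sum>i=1..d. x i * (1 - x i) * mon_pd2 d i i (\<alpha> k) x)
      - 2 * (\<Sum>i\<in>{1..d}. \<Sum>j\<in>{i<..d}. x i * x j * mon_pd2 d i j (\<alpha> k) x)
      + (\<Sum>i=1..d. (\<epsilon> i + 1 - ?c * x i) * mon_pd d i (\<alpha> k) x)))"
    by (rule sum_combine3)
  also have "\<dots> = (\<Sum>k\<in>K. c k * ((\<Sum>i=1..d+1. real (\<alpha> k i) * (real (\<alpha> k i) + \<epsilon> i) * mon d (dec i (\<alpha> k)) x)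
     - real N * (real N + (\<Sum>l=1..d+1. \<epsilon> l) + real d) * mon d (\<alpha> k) x))"
    using mon_pd2_mon[OF K(2)] by (intro sum.cong refl arg_cong2[where f = "(*)"]) auto
  also have "\<dots> = (\<Sum>k\<in>K. c k * (\<Sum>i=1..d+1. real (\<alpha> k i) * (real (\<alpha> k i) + \<epsilon> i) * mon d (dec i (\<alpha> k)) x))
       - real N * (real N + (\<Sum>l=1..d+1. \<epsilon> l) + real d) * (\<Sum>k\<in>K. c k * mon d (\<alpha> k) x)"
    by (rule sum_combine2)
  finally show ?thesis .
qed

section \<open>Homogeneous forms and the kernel of the operator\<close>

lemma finite_monomset [simp]: "finite (monomset d N)"
proof -
  have "monomset d N \<subseteq> {f. \<forall>x. (x \<in> {1..d} \<longrightarrow> f x \<in> {..N}) \<and> (x \<notin> {1..d} \<longrightarrow> f x = 0)}"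
  proof
    fix \<alpha> assume \<alpha>: "\<alpha> \<in> monomset d N"
    have "\<alpha> i \<le> N" if "i \<in> {1..d}" for i
      using member_le_sum[of i "{1..d}" \<alpha>] that \<alpha> by (auto simp: monomset_def)
    with \<alpha> show "\<alpha> \<in> {f. \<forall>x. (x \<in> {1..d} \<longrightarrow> f x \<in> {..N}) \<and> (x \<notin> {1..d} \<longrightarrow> f x = 0)}"
      by (auto simp: monomset_def)
  qed
  then show ?thesis
    using finite_set_of_finite_funs[of "{1..d}" "{..N}" 0] finite_subset by blast
qed

lemma poly_le_monomial:
  assumes "\<alpha> \<in> monomset d N" shows "poly_le d N (\<lambda>x. \<Prod>i=1..d. x i ^ \<alpha> i)"
  unfolding poly_le_def
proof
  have "(\<Sum>\<beta>\<in>monomset d N. of_bool (\<beta> = \<alpha>) * (\<Prod>i=1..d. x i ^ \<beta> i)) = (\<Prod>i=1..d. x i ^ \<alpha> i)"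
    for x :: pt
  proof -
    have "(\<Sum>\<beta>\<in>monomset d N. of_bool (\<beta> = \<alpha>) * (\<Prod>i=1..d. x i ^ \<beta> i))
       = (\<Sum>\<beta>\<in>monomset d N. if \<beta> = \<alpha> then \<Prod>i=1..d. x i ^ \<beta> i else 0)"
      by (rule sum.cong) auto
    then show ?thesis using assms by (simp add: sum.delta)
  qed
  then show "(\<lambda>x::pt. \<Prod>i=1..d. x i ^ \<alpha> i)
     = (\<lambda>x. \<Sum>\<beta>\<in>monomset d N. of_bool (\<beta> = \<alpha>) * (\<Prod>i=1..d. x i ^ \<beta> i))"
    by (intro ext) (rule sym)
qed

lemma poly_le_cmult: "poly_le d N p \<Longrightarrow> poly_le d N (\<lambda>x. a * p x)"
proof -
  assume "poly_le d N p"
  then obtain c where c: "p = (\<lambda>x. \<Sum>\<alpha>\<in>monomset d N. c \<alpha> * (\<Prod>i=1..d. x i ^ \<alpha> i))"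
    by (auto simp: poly_le_def)
  show ?thesis unfolding poly_le_def
    by (rule exI[of _ "\<lambda>\<alpha>. a * c \<alpha>"]) (simp add: c sum_distrib_left mult.assoc)
qed

lemma poly_le_sum:
  assumes "\<And>k. k \<in> K \<Longrightarrow> poly_le d N (p k)" shows "poly_le d N (\<lambda>x. \<Sum>k\<in>K. p k x)"
proof -
  have "\<forall>k\<in>K. \<exists>c. p k = (\<lambda>x. \<Sum>\<alpha>\<in>monomset d N. c \<alpha> * (\<Prod>i=1..d. x i ^ \<alpha> i))"
    using assms unfolding poly_le_def by auto
  then obtain c where c: "\<And>k. k \<in> K \<Longrightarrow> p k = (\<lambda>x. \<Sum>\<alpha>\<in>monomset d N. c k \<alpha> * (\<Prod>i=1..d. x i ^ \<alpha> i))"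
    using bchoice[of K "\<lambda>k c. p k = (\<lambda>x. \<Sum>\<alpha>\<in>monomset d N. c \<alpha> * (\<Prod>i=1..d. x i ^ \<alpha> i))"] by blast
  show ?thesis unfolding poly_le_def
  proof (rule exI[of _ "\<lambda>\<alpha>. \<Sum>k\<in>K. c k \<alpha>"], rule ext)
    fix x
    have "(\<Sum>k\<in>K. p k x) = (\<Sum>k\<in>K. \<Sum>\<alpha>\<in>monomset d N. c k \<alpha> * (\<Prod>i=1..d. x i ^ \<alpha> i))"
      using c by (intro sum.cong) auto
    also have "\<dots> = (\<Sum>\<alpha>\<in>monomset d N. (\<Sum>k\<in>K. c k \<alpha>) * (\<Prod>i=1..d. x i ^ \<alpha> i))"
      by (subst sum.swap) (simp add: sum_distrib_right)
    finally show "(\<Sum>k\<in>K. p k x) = (\<Sum>\<alpha>\<in>monomset d N. (\<Sum>k\<in>K. c k \<alpha>) * (\<Prod>i=1..d. x i ^ \<alpha> i))" .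
  qed
qed

text \<open>Multiplication by a fixed \<open>h\<close> is linear, so a degree bound need only be
  checked on monomials; \<open>h = 1\<close> gives monotonicity in the degree.\<close>

lemma poly_le_expand:
  assumes "poly_le d N p"
    and "\<And>\<alpha>. \<alpha> \<in> monomset d N \<Longrightarrow> poly_le d M (\<lambda>x. h x * (\<Prod>i=1..d. x i ^ \<alpha> i))"
  shows "poly_le d M (\<lambda>x. h x * p x)"
proof -
  obtain c where c: "p = (\<lambda>x. \<Sum>\<alpha>\<in>monomset d N. c \<alpha> * (\<Prod>i=1..d. x i ^ \<alpha> i))"
    using assms(1) by (auto simp: poly_le_def)
  have "poly_le d M (\<lambda>x. \<Sum>\<alpha>\<in>monomset d N. c \<alpha> * (h x * (\<Prod>i=1..d. x i ^ \<alpha> i)))"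
    by (intro poly_le_sum poly_le_cmult assms(2))
  then show ?thesis by (simp add: c sum_distrib_left mult.left_commute)
qed

lemma poly_le_mono: "poly_le d N p \<Longrightarrow> N \<le> M \<Longrightarrow> poly_le d M p"
  using poly_le_expand[of d N p M "\<lambda>_. 1"] poly_le_monomial[of _ d M]
  by (auto simp: monomset_def)

lemma poly_le_diff: "poly_le d N p \<Longrightarrow> poly_le d N q \<Longrightarrow> poly_le d N (\<lambda>x. p x - q x)"
  using poly_le_sum[of "{True, False}" d N "\<lambda>b. if b then p else (\<lambda>x. (-1) * q x)"]
    poly_le_cmult[of d N q "-1"] by auto

lemma poly_le_mult_var:
  assumes "poly_le d N p" "i \<in> {1..d}" shows "poly_le d (Suc N) (\<lambda>x. x i * p x)"
proof (rule poly_le_expand[OF assms(1)])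
  fix \<alpha> assume \<alpha>: "\<alpha> \<in> monomset d N"
  have "inc i \<alpha> \<in> monomset d (Suc N)"
    using \<alpha> assms(2) unfolding monomset_def mem_Collect_eq by (subst sum_inc) auto
  moreover have "(\<Prod>j=1..d. x j ^ inc i \<alpha> j) = x i * (\<Prod>j=1..d. x j ^ \<alpha> j)" for x :: pt
  proof -
    have "(\<Prod>j\<in>{1..d}-{i}. x j ^ inc i \<alpha> j) = (\<Prod>j\<in>{1..d}-{i}. x j ^ \<alpha> j)"
      by (rule prod.cong) auto
    then show ?thesis
      using assms(2) prod.remove[of "{1..d}" i "\<lambda>j. x j ^ inc i \<alpha> j"]
        prod.remove[of "{1..d}" i "\<lambda>j. x j ^ \<alpha> j"] by (simp add: mult.assoc)
  qed
  ultimately show "poly_le d (Suc N) (\<lambda>x. x i * (\<Prod>i=1..d. x i ^ \<alpha> i))"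
    using poly_le_monomial[of "inc i \<alpha>" d "Suc N"] by simp
qed

lemma poly_le_mult_xx:
  assumes "poly_le d N p" "i \<in> {1..d+1}" shows "poly_le d (Suc N) (\<lambda>x. xx d x i * p x)"
proof (cases "i = d + 1")
  case True
  have "poly_le d (Suc N) (\<lambda>x. p x - (\<Sum>j\<in>{1..d}. x j * p x))"
    by (intro poly_le_diff poly_le_sum poly_le_mult_var poly_le_mono[OF assms(1)] assms(1)) auto
  then show ?thesis using True by (simp add: xx_def left_diff_distrib sum_distrib_right)
next
  case False
  then show ?thesis using poly_le_mult_var[OF assms(1), of i] assms(2) by (simp add: xx_def)
qed

lemma exists_pos_of_multis_Suc:
  assumes "\<alpha> \<in> multis A (Suc N)" "finite A"
  obtains i where "i \<in> A" "\<alpha> i > 0" "dec i \<alpha> \<in> multis A N"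
proof -
  have "\<exists>i\<in>A. \<alpha> i > 0"
  proof (rule ccontr)
    assume "\<not> ?thesis"
    then have "sum \<alpha> A = 0" by auto
    then show False using assms by (auto simp: multis_def)
  qed
  then obtain i where i: "i \<in> A" "\<alpha> i > 0" by blast
  then have "dec i \<alpha> \<in> multis A N"
    using assms inc_mem_multis_Suc[OF assms(2), of i "dec i \<alpha>" N] inc_dec[of \<alpha> i] by simp
  with i that show ?thesis by blast
qed

lemma mon_zero [simp]: "mon d (\<lambda>_. 0) x = 1"
  by (simp add: mon_def)

lemma poly_le_const: "poly_le d N (\<lambda>_. a)"
proof -
  have "poly_le d N (\<lambda>x. \<Prod>i=1..d. x i ^ 0)"
    by (rule poly_le_monomial) (simp add: monomset_def)
  then show ?thesis using poly_le_cmult[of d N "\<lambda>x. 1" a] by simp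
qed

lemma poly_le_mon: "\<alpha> \<in> multis {1..d+1} N \<Longrightarrow> poly_le d N (mon d \<alpha>)"
proof (induction N arbitrary: \<alpha>)
  case 0
  then have "mon d \<alpha> = (\<lambda>x. 1)" by (auto simp: multis_0)
  then show ?case using poly_le_const[of d 0 1] by simp
next
  case (Suc N)
  from Suc.prems obtain i where i: "i \<in> {1..d+1}" "\<alpha> i > 0" "dec i \<alpha> \<in> multis {1..d+1} N"
    by (rule exists_pos_of_multis_Suc) auto
  have "mon d \<alpha> = (\<lambda>x. xx d x i * mon d (dec i \<alpha>) x)"
    using mon_inc[OF i(1), of "dec i \<alpha>"] inc_dec[of \<alpha> i] i(2) by auto
  then show ?case using poly_le_mult_xx[OF Suc.IH[OF i(3)] i(1)] by (simp only:)
qed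

lemma poly_le_hp: "poly_le d N (hp d N c)"
proof -
  have "poly_le d N (\<lambda>x. \<Sum>\<alpha>\<in>multis {1..d+1} N. c \<alpha> * mon d \<alpha> x)"
    by (intro poly_le_sum poly_le_cmult poly_le_mon)
  then show ?thesis by (simp add: hp_def[abs_def])
qed

lemma hp_sum: "(\<lambda>x. \<Sum>k\<in>K. a k * hp d N (c k) x) = hp d N (\<lambda>\<alpha>. \<Sum>k\<in>K. a k * c k \<alpha>)"
proof
  fix x
  have "(\<Sum>k\<in>K. a k * hp d N (c k) x) = (\<Sum>k\<in>K. \<Sum>\<alpha>\<in>multis {1..d+1} N. a k * c k \<alpha> * mon d \<alpha> x)"
    by (simp add: hp_def sum_distrib_left mult.assoc)
  also have "\<dots> = hp d N (\<lambda>\<alpha>. \<Sum>k\<in>K. a k * c k \<alpha>) x"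
    unfolding hp_def by (subst sum.swap) (simp add: sum_distrib_right)
  finally show "(\<Sum>k\<in>K. a k * hp d N (c k) x) = hp d N (\<lambda>\<alpha>. \<Sum>k\<in>K. a k * c k \<alpha>) x" .
qed

lemma hp_single:
  assumes "\<alpha> \<in> multis {1..d+1} N" shows "hp d N (\<lambda>\<beta>. of_bool (\<beta> = \<alpha>)) = mon d \<alpha>"
proof
  fix x
  have "hp d N (\<lambda>\<beta>. of_bool (\<beta> = \<alpha>)) x = (\<Sum>\<beta>\<in>multis {1..d+1} N. if \<beta> = \<alpha> then mon d \<beta> x else 0)"
    unfolding hp_def by (rule sum.cong) auto
  then show "hp d N (\<lambda>\<beta>. of_bool (\<beta> = \<alpha>)) x = mon d \<alpha> x"
    using assms by (simp add: sum.delta)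
qed

lemma hp_mult_xx:
  assumes "i \<in> {1..d+1}" shows "\<exists>c'. (\<lambda>x. xx d x i * hp d N c x) = hp d (Suc N) c'"
proof -
  have "(\<lambda>x. xx d x i * hp d N c x)
     = (\<lambda>x. \<Sum>\<alpha>\<in>multis {1..d+1} N. c \<alpha> * hp d (Suc N) (\<lambda>\<beta>. of_bool (\<beta> = inc i \<alpha>)) x)"
  proof
    fix x
    have "(\<Sum>\<alpha>\<in>multis {1..d+1} N. c \<alpha> * hp d (Suc N) (\<lambda>\<beta>. of_bool (\<beta> = inc i \<alpha>)) x)
       = (\<Sum>\<alpha>\<in>multis {1..d+1} N. c \<alpha> * (xx d x i * mon d \<alpha> x))"
    proof (intro sum.cong refl)
      fix \<alpha> assume "\<alpha> \<in> multis {1..d+1} N"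
      then have "inc i \<alpha> \<in> multis {1..d+1} (Suc N)"
        using inc_mem_multis_Suc[of "{1..d+1}" i] assms by simp
      then show "c \<alpha> * hp d (Suc N) (\<lambda>\<beta>. of_bool (\<beta> = inc i \<alpha>)) x = c \<alpha> * (xx d x i * mon d \<alpha> x)"
        using hp_single[of "inc i \<alpha>" d "Suc N"] mon_inc[OF assms] by simp
    qed
    then show "xx d x i * hp d N c x = (\<Sum>\<alpha>\<in>multis {1..d+1} N. c \<alpha> * hp d (Suc N) (\<lambda>\<beta>. of_bool (\<beta> = inc i \<alpha>)) x)"
      by (simp add: hp_def sum_distrib_left mult.left_commute)
  qed
  then show ?thesis unfolding hp_sum by blast
qed

text \<open>Homogenisation: multiply by \<open>x\<^sub>1 + \<dots> + x\<^bsub>d+1\<^esub> = 1\<close>.\<close>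
lemma hp_Suc: "\<exists>c'. hp d N c = hp d (Suc N) c'"
proof -
  have "\<forall>i\<in>{1..d+1}. \<exists>c'. (\<lambda>x. xx d x i * hp d N c x) = hp d (Suc N) c'"
    using hp_mult_xx by blast
  then obtain c' where c': "\<And>i. i \<in> {1..d+1} \<Longrightarrow> (\<lambda>x. xx d x i * hp d N c x) = hp d (Suc N) (c' i)"
    using bchoice[of "{1..d+1}" "\<lambda>i c'. (\<lambda>x. xx d x i * hp d N c x) = hp d (Suc N) c'"] by blast
  have "hp d N c = (\<lambda>x. \<Sum>i\<in>{1..d+1}. 1 * hp d (Suc N) (c' i) x)"
  proof
    fix x
    have "hp d N c x = (\<Sum>i\<in>{1..d+1}. xx d x i) * hp d N c x" unfolding sum_xx by simp
    also have "\<dots> = (\<Sum>i\<in>{1..d+1}. hp d (Suc N) (c' i) x)"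
      unfolding sum_distrib_right by (intro sum.cong refl fun_cong[OF c'])
    finally show "hp d N c x = (\<Sum>i\<in>{1..d+1}. 1 * hp d (Suc N) (c' i) x)" by simp
  qed
  then show ?thesis unfolding hp_sum by blast
qed

text \<open>A monomial of smaller degree is lifted by \<open>hp_Suc\<close>; one of full degree
  sheds a variable and is recovered by \<open>hp_mult_xx\<close>.\<close>

lemma monomial_hp:
  "\<alpha> \<in> monomset d N \<Longrightarrow> \<exists>c. (\<lambda>x. \<Prod>i=1..d. x i ^ \<alpha> i) = hp d N c"
proof (induction N arbitrary: \<alpha>)
  case 0
  then have "\<forall>i\<in>{1..d}. \<alpha> i = 0" by (simp add: monomset_def)
  then have "(\<lambda>x. \<Prod>i=1..d. x i ^ \<alpha> i) = mon d (\<lambda>_. 0)" by (auto simp: mon_def)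
  then show ?case using hp_single[of "\<lambda>_. 0" d 0] by (auto simp: multis_0 intro!: exI[of _ "\<lambda>\<beta>. of_bool (\<beta> = (\<lambda>_. 0))"])
next
  case (Suc N)
  show ?case
  proof (cases "sum \<alpha> {1..d} \<le> N")
    case True
    then have "\<alpha> \<in> monomset d N" using Suc.prems by (simp add: monomset_def)
    then obtain c where "(\<lambda>x. \<Prod>i=1..d. x i ^ \<alpha> i) = hp d N c" using Suc.IH by blast
    then show ?thesis using hp_Suc[of d N c] by simp
  next
    case False
    then have "\<alpha> \<in> multis {1..d} (Suc N)" using Suc.prems by (auto simp: monomset_def multis_def)
    then obtain i where i: "i \<in> {1..d}" "\<alpha> i > 0" "dec i \<alpha> \<in> multis {1..d} N"
      by (rule exists_pos_of_multis_Suc) auto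
    then have "dec i \<alpha> \<in> monomset d N" by (auto simp: monomset_def multis_def)
    then obtain c where c: "(\<lambda>x. \<Prod>j=1..d. x j ^ dec i \<alpha> j) = hp d N c" using Suc.IH by blast
    have "(\<lambda>x. \<Prod>j=1..d. x j ^ \<alpha> j) = (\<lambda>x. xx d x i * hp d N c x)"
    proof
      fix x :: pt
      have "(\<Prod>j\<in>{1..d}-{i}. x j ^ dec i \<alpha> j) = (\<Prod>j\<in>{1..d}-{i}. x j ^ \<alpha> j)"
        by (rule prod.cong) auto
      then have "(\<Prod>j=1..d. x j ^ \<alpha> j) = x i * (\<Prod>j=1..d. x j ^ dec i \<alpha> j)"
        using i prod.remove[of "{1..d}" i "\<lambda>j. x j ^ dec i \<alpha> j"]
          prod.remove[of "{1..d}" i "\<lambda>j. x j ^ \<alpha> j"] power_minus_mult[of "\<alpha> i" "x i"]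
        by (simp add: mult_ac)
      moreover have "xx d x i = x i" using i by (simp add: xx_def)
      ultimately show "(\<Prod>j=1..d. x j ^ \<alpha> j) = xx d x i * hp d N c x"
        using fun_cong[OF c, of x] by (simp only:)
    qed
    then show ?thesis using hp_mult_xx[of i d N c] i(1) by auto
  qed
qed

lemma poly_le_iff_hp: "poly_le d N p \<longleftrightarrow> (\<exists>c. p = hp d N c)"
proof
  assume "poly_le d N p"
  then obtain c where c: "p = (\<lambda>x. \<Sum>\<alpha>\<in>monomset d N. c \<alpha> * (\<Prod>i=1..d. x i ^ \<alpha> i))"
    by (auto simp: poly_le_def)
  obtain c' where c': "\<And>\<alpha>. \<alpha> \<in> monomset d N \<Longrightarrow> (\<lambda>x. \<Prod>i=1..d. x i ^ \<alpha> i) = hp d N (c' \<alpha>)"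
    using bchoice[of "monomset d N" "\<lambda>\<alpha> c. (\<lambda>x. \<Prod>i=1..d. x i ^ \<alpha> i) = hp d N c"] monomial_hp by blast
  have "p = (\<lambda>x. \<Sum>\<alpha>\<in>monomset d N. c \<alpha> * hp d N (c' \<alpha>) x)"
    unfolding c by (intro ext sum.cong refl arg_cong2[where f = "(*)"] fun_cong[OF c'])
  then show "\<exists>c. p = hp d N c" unfolding hp_sum by blast
qed (use poly_le_hp in blast)

text \<open>Induction on the variables. The exponent set is an arbitrary finite \<open>S\<close>
  separated by the variables in \<open>A\<close>: after one variable is removed, the induction
  hypothesis is needed for the slice of \<open>S\<close> with a prescribed exponent in that
  variable. Only positive points are tested, since only these can be scaled into the open
  simplex.\<close>

lemma coeffs_zero_of_vanishing:
  fixes c :: "(nat \<Rightarrow> nat) \<Rightarrow> real"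
  assumes "finite A" "finite S"
    and "\<And>\<alpha> \<beta>. \<alpha> \<in> S \<Longrightarrow> \<beta> \<in> S \<Longrightarrow> (\<forall>i\<in>A. \<alpha> i = \<beta> i) \<Longrightarrow> \<alpha> = \<beta>"
    and "\<And>y::pt. (\<forall>i. y i > 0) \<Longrightarrow> (\<Sum>\<alpha>\<in>S. c \<alpha> * (\<Prod>i\<in>A. y i ^ \<alpha> i)) = 0"
    and "\<alpha> \<in> S"
  shows "c \<alpha> = 0"
  using assms
proof (induction A arbitrary: S \<alpha> rule: finite_induct)
  case empty
  then have "S = {\<alpha>}" by auto
  then show ?case using empty.prems(3)[of "\<lambda>_. 1"] by simp
next
  case (insert v A)
  define k where "k = \<alpha> v"
  define S' where "S' = {\<beta> \<in> S. \<beta> v = k}"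
  show ?case
  proof (rule insert.IH[of S'])
    show "finite S'" "\<alpha> \<in> S'" using insert.prems by (auto simp: S'_def k_def)
    show "\<beta> = \<delta>" if "\<beta> \<in> S'" "\<delta> \<in> S'" "\<forall>i\<in>A. \<beta> i = \<delta> i" for \<beta> \<delta>
      using insert.prems(2)[of \<beta> \<delta>] that by (auto simp: S'_def)
    show "(\<Sum>\<alpha>\<in>S'. c \<alpha> * (\<Prod>i\<in>A. y i ^ \<alpha> i)) = 0" if y: "\<forall>i. y i > 0" for y :: pt
    proof -
      define K where "K = Max ((\<lambda>\<beta>. \<beta> v) ` S)"
      have K: "\<beta> v \<le> K" if "\<beta> \<in> S" for \<beta>
        using that insert.prems(1) by (auto simp: K_def)
      \<comment> \<open>\<open>b j\<close> is the coefficient of \<open>t ^ j\<close> when the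
        coordinate \<open>v\<close> alone runs through the positive reals; a one-variable polynomial
        with infinitely many zeros has zero coefficients.\<close>
      define b where "b j = (\<Sum>\<beta>\<in>{\<beta> \<in> S. \<beta> v = j}. c \<beta> * (\<Prod>i\<in>A. y i ^ \<beta> i))" for j
      have root: "(\<Sum>j\<le>K. b j * t ^ j) = 0" if t: "t > 0" for t
      proof -
        let ?y = "y(v := t)"
        have "0 = (\<Sum>\<beta>\<in>S. c \<beta> * (\<Prod>i\<in>insert v A. ?y i ^ \<beta> i))"
          using insert.prems(3)[of ?y] y t by auto
        also have "\<dots> = (\<Sum>\<beta>\<in>S. c \<beta> * (\<Prod>i\<in>A. y i ^ \<beta> i) * t ^ \<beta> v)"
        proof (intro sum.cong refl)
          fix \<beta>
          have "(\<Prod>i\<in>A. ?y i ^ \<beta> i) = (\<Prod>i\<in>A. y i ^ \<beta> i)"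
            using insert.hyps by (intro prod.cong) auto
          then show "c \<beta> * (\<Prod>i\<in>insert v A. ?y i ^ \<beta> i) = c \<beta> * (\<Prod>i\<in>A. y i ^ \<beta> i) * t ^ \<beta> v"
            using insert.hyps by simp
        qed
        also have "\<dots> = (\<Sum>j\<le>K. \<Sum>\<beta>\<in>{\<beta> \<in> S. \<beta> v = j}. c \<beta> * (\<Prod>i\<in>A. y i ^ \<beta> i) * t ^ \<beta> v)"
          using insert.prems(1) K by (intro sum.group[symmetric]) auto
        also have "\<dots> = (\<Sum>j\<le>K. b j * t ^ j)"
          unfolding b_def sum_distrib_right by (intro sum.cong refl) auto
        finally show ?thesis by simp
      qed
      have "\<not> finite {t. (\<Sum>j\<le>K. b j * t ^ j) = 0}"
      proof
        assume "finite {t. (\<Sum>j\<le>K. b j * t ^ j) = 0}"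
        moreover have "{0<..<1} \<subseteq> {t. (\<Sum>j\<le>K. b j * t ^ j) = 0}" using root by auto
        ultimately have "finite {0<..<1::real}" by (rule finite_subset[rotated])
        then show False using infinite_Ioo[of 0 "1::real"] by simp
      qed
      then have "\<forall>j\<le>K. b j = 0" using polyfun_finite_roots[of b K] by blast
      moreover have "k \<le> K" using K insert.prems by (simp add: k_def)
      ultimately show ?thesis by (simp add: b_def S'_def)
    qed
  qed
qed

text \<open>Homogeneity compensates for the relation between the coordinates: a positive
  \<open>y\<close> with coordinate sum \<open>s\<close> gives the point \<open>z\<close> = y / s of
  the open simplex, and the form at \<open>y\<close> is \<open>s ^ N\<close> times its value at
  \<open>z\<close>.\<close>

lemma hp_zero_Tint:
  assumes "\<And>x. x \<in> Tint d \<Longrightarrow> hp d N c x = 0" "\<alpha> \<in> multis {1..d+1} N"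
  shows "c \<alpha> = 0"
proof (rule coeffs_zero_of_vanishing[of "{1..d+1}" "multis {1..d+1} N" c \<alpha>])
  show "\<beta> = \<delta>" if "\<beta> \<in> multis {1..d+1} N" "\<delta> \<in> multis {1..d+1} N" "\<forall>i\<in>{1..d+1}. \<beta> i = \<delta> i" for \<beta> \<delta>
  proof
    fix i show "\<beta> i = \<delta> i" using that by (cases "i \<in> {1..d+1}") (auto simp: multis_def)
  qed
  fix y :: pt assume y: "\<forall>i. y i > 0"
  define s where "s = (\<Sum>i=1..d+1. y i)"
  have s: "s > 0" unfolding s_def using y by (intro sum_pos) auto
  define z where "z i = y i / s" for i
  have zd: "(\<Sum>i=1..d. z i) = 1 - z (d+1)"
    unfolding z_def sum_divide_distrib[symmetric] using s by (simp add: s_def field_simps)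
  have z: "z \<in> Tint d"
    using y s zd by (auto simp: Tint_def z_def)
  have xz: "xx d z i = z i" if "i \<in> {1..d+1}" for i
    using zd by (auto simp: xx_def)
  have mz: "mon d \<beta> z * s ^ N = (\<Prod>i=1..d+1. y i ^ \<beta> i)" if "\<beta> \<in> multis {1..d+1} N" for \<beta>
  proof -
    have "mon d \<beta> z = (\<Prod>i=1..d+1. y i ^ \<beta> i / s ^ \<beta> i)"
      unfolding mon_def by (intro prod.cong refl) (simp add: xz z_def power_divide)
    also have "\<dots> = (\<Prod>i=1..d+1. y i ^ \<beta> i) / s ^ N"
      unfolding prod_dividef power_sum[symmetric] using that by (simp add: multis_def)
    finally show ?thesis using s by simp
  qed
  have "(\<Sum>\<beta>\<in>multis {1..d+1} N. c \<beta> * (\<Prod>i=1..d+1. y i ^ \<beta> i)) = hp d N c z * s ^ N"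
    unfolding hp_def sum_distrib_right by (intro sum.cong refl) (simp add: mz mult.assoc)
  then show "(\<Sum>\<beta>\<in>multis {1..d+1} N. c \<beta> * (\<Prod>i=1..d+1. y i ^ \<beta> i)) = 0"
    using assms(1)[OF z] by simp
qed (use assms in auto)

lemma hp_eq_iff: "hp d N c = hp d N c' \<longleftrightarrow> (\<forall>\<alpha>\<in>multis {1..d+1} N. c \<alpha> = c' \<alpha>)"
proof
  assume eq: "hp d N c = hp d N c'"
  have "hp d N (\<lambda>\<alpha>. c \<alpha> - c' \<alpha>) x = 0" for x
    using fun_cong[OF eq, of x] by (simp add: hp_def left_diff_distrib sum_subtractf)
  then show "\<forall>\<alpha>\<in>multis {1..d+1} N. c \<alpha> = c' \<alpha>"
    using hp_zero_Tint[of d N "\<lambda>\<alpha>. c \<alpha> - c' \<alpha>"] by auto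
qed (auto simp: hp_def)

text \<open>Both polynomials become forms of the larger of the two degrees, where values on the open
  simplex determine the coefficients.\<close>

lemma poly_le_Tint_eq:
  assumes "poly_le d N p" "poly_le d M q" "\<And>x. x \<in> Tint d \<Longrightarrow> p x = q x"
  shows "p = q"
proof -
  let ?K = "max N M"
  have "poly_le d ?K (\<lambda>x. p x - q x)"
    using assms by (intro poly_le_diff) (auto elim: poly_le_mono)
  then obtain c where c: "(\<lambda>x. p x - q x) = hp d ?K c" by (auto simp: poly_le_iff_hp)
  have "c \<alpha> = 0" if "\<alpha> \<in> multis {1..d+1} ?K" for \<alpha>
    by (rule hp_zero_Tint[of d ?K c]) (use assms(3) that fun_cong[OF c, symmetric] in auto)
  then have "hp d ?K c = (\<lambda>x. 0)" by (simp add: hp_def[abs_def])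
  then have "p x - q x = 0" for x using fun_cong[OF c, of x] by simp
  then show ?thesis by auto
qed

text \<open>Coefficient families of the homogeneous polynomials of degree \<open>N\<close> in the variables \<open>C\<close> that are
  annihilated by \<open>\<Sum>\<^sub>i (x\<^sub>i \<partial>\<^sub>i\<^sup>2 + (\<epsilon>\<^sub>i + 1) \<partial>\<^sub>i)\<close>, which maps \<open>x\<^sub>i\<^sup>a\<close> to \<open>a (a + \<epsilon>\<^sub>i) x\<^sub>i\<^sup>a\<^sup>-\<^sup>1\<close>.\<close>
definition ker_coeffs :: "nat set \<Rightarrow> (nat \<Rightarrow> real) \<Rightarrow> nat \<Rightarrow> ((nat \<Rightarrow> nat) \<Rightarrow> real) set" where
  "ker_coeffs C \<epsilon> N = {c. (\<forall>\<beta>. \<beta> \<notin> multis C N \<longrightarrow> c \<beta> = 0) \<and>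
     (\<forall>\<beta>. (\<Sum>j\<in>C. (real (\<beta> j) + 1) * (real (\<beta> j) + 1 + \<epsilon> j) * c (inc j \<beta>)) = 0)}"

lemma ker_coeffs_supp: "c \<in> ker_coeffs C \<epsilon> N \<Longrightarrow> \<beta> \<notin> multis C N \<Longrightarrow> c \<beta> = 0"
  by (simp add: ker_coeffs_def)

lemma ker_coeffs_eq: "c \<in> ker_coeffs C \<epsilon> N \<Longrightarrow> (\<Sum>j\<in>C. (real (\<beta> j) + 1) * (real (\<beta> j) + 1 + \<epsilon> j) * c (inc j \<beta>)) = 0"
  by (simp add: ker_coeffs_def)

lemma ker_coeffs_sum: "(\<And>k. k \<in> K \<Longrightarrow> c k \<in> ker_coeffs C \<epsilon> N) \<Longrightarrow> (\<lambda>\<beta>. \<Sum>k\<in>K. a k * c k \<beta>) \<in> ker_coeffs C \<epsilon> N"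
proof -
  assume c: "\<And>k. k \<in> K \<Longrightarrow> c k \<in> ker_coeffs C \<epsilon> N"
  have "(\<Sum>j\<in>C. (real (\<beta> j) + 1) * (real (\<beta> j) + 1 + \<epsilon> j) * (\<Sum>k\<in>K. a k * c k (inc j \<beta>))) = 0" for \<beta>
  proof -
    have "(\<Sum>j\<in>C. (real (\<beta> j) + 1) * (real (\<beta> j) + 1 + \<epsilon> j) * (\<Sum>k\<in>K. a k * c k (inc j \<beta>)))
      = (\<Sum>k\<in>K. a k * (\<Sum>j\<in>C. (real (\<beta> j) + 1) * (real (\<beta> j) + 1 + \<epsilon> j) * c k (inc j \<beta>)))"
      unfolding sum_distrib_left by (subst sum.swap) (simp add: mult.left_commute)
    then show ?thesis using ker_coeffs_eq[OF c] by simp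
  qed
  then show ?thesis using ker_coeffs_supp[OF c] by (simp add: ker_coeffs_def)
qed

lemma hp_restrict:
  assumes "C \<subseteq> {1..d+1}" "\<And>\<beta>. \<beta> \<notin> multis C N \<Longrightarrow> c \<beta> = 0"
  shows "hp d N c x = (\<Sum>\<alpha>\<in>multis C N. c \<alpha> * mon d \<alpha> x)"
  unfolding hp_def
  by (rule sum.mono_neutral_right) (use assms multis_mono[of C "{1..d+1}" N] in auto)

text \<open>Moves the degree-lowering operator from monomials to coefficients. The function
  \<open>h\<close> stands for an arbitrary linear functional given on monomials; it is evaluation at
  a point in the eigenvalue argument and a Dirichlet moment in the orthogonality argument.\<close>

lemma sum_lower_exponents:
  fixes c h :: "(nat \<Rightarrow> nat) \<Rightarrow> real"
  assumes C: "finite C"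
  shows "(\<Sum>\<alpha>\<in>multis C (Suc M). c \<alpha> * (\<Sum>i\<in>C. real (\<alpha> i) * (real (\<alpha> i) + \<epsilon> i) * h (dec i \<alpha>)))
    = (\<Sum>\<beta>\<in>multis C M. (\<Sum>i\<in>C. (real (\<beta> i) + 1) * (real (\<beta> i) + 1 + \<epsilon> i) * c (inc i \<beta>)) * h \<beta>)"
proof -
  have one: "(\<Sum>\<alpha>\<in>multis C (Suc M). c \<alpha> * (real (\<alpha> i) * (real (\<alpha> i) + \<epsilon> i) * h (dec i \<alpha>)))
     = (\<Sum>\<beta>\<in>multis C M. (real (\<beta> i) + 1) * (real (\<beta> i) + 1 + \<epsilon> i) * c (inc i \<beta>) * h \<beta>)"
    if i: "i \<in> C" for i
  proof -
    have "(\<Sum>\<alpha>\<in>multis C (Suc M). c \<alpha> * (real (\<alpha> i) * (real (\<alpha> i) + \<epsilon> i) * h (dec i \<alpha>)))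
       = (\<Sum>\<alpha>\<in>{\<alpha> \<in> multis C (Suc M). \<alpha> i > 0}. c \<alpha> * (real (\<alpha> i) * (real (\<alpha> i) + \<epsilon> i) * h (dec i \<alpha>)))"
      using C by (intro sum.mono_neutral_right) auto
    also have "\<dots> = (\<Sum>\<beta>\<in>multis C M. (real (\<beta> i) + 1) * (real (\<beta> i) + 1 + \<epsilon> i) * c (inc i \<beta>) * h \<beta>)"
    proof (rule sum.reindex_bij_witness[of _ "inc i" "dec i"])
      fix \<alpha> assume \<alpha>: "\<alpha> \<in> {\<alpha> \<in> multis C (Suc M). \<alpha> i > 0}"
      then show *: "inc i (dec i \<alpha>) = \<alpha>" by auto
      have "inc i (dec i \<alpha>) \<in> multis C (Suc M)" unfolding * using \<alpha> by simp
      then show "dec i \<alpha> \<in> multis C M" unfolding inc_mem_multis_Suc[OF C i] .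
      have "real (dec i \<alpha> i) + 1 = real (\<alpha> i)" using \<alpha> by (simp add: of_nat_diff)
      then show "(real (dec i \<alpha> i) + 1) * (real (dec i \<alpha> i) + 1 + \<epsilon> i) * c (inc i (dec i \<alpha>)) * h (dec i \<alpha>)
        = c \<alpha> * (real (\<alpha> i) * (real (\<alpha> i) + \<epsilon> i) * h (dec i \<alpha>))"
        unfolding * by (simp only: mult.commute mult.left_commute)
    next
      fix \<beta> assume \<beta>: "\<beta> \<in> multis C M"
      show "dec i (inc i \<beta>) = \<beta>" by auto
      have "inc i \<beta> \<in> multis C (Suc M)" unfolding inc_mem_multis_Suc[OF C i] by (rule \<beta>)
      then show "inc i \<beta> \<in> {\<alpha> \<in> multis C (Suc M). \<alpha> i > 0}" by simp
    qed
    finally show ?thesis .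
  qed
  have "(\<Sum>\<alpha>\<in>multis C (Suc M). c \<alpha> * (\<Sum>i\<in>C. real (\<alpha> i) * (real (\<alpha> i) + \<epsilon> i) * h (dec i \<alpha>)))
     = (\<Sum>i\<in>C. \<Sum>\<alpha>\<in>multis C (Suc M). c \<alpha> * (real (\<alpha> i) * (real (\<alpha> i) + \<epsilon> i) * h (dec i \<alpha>)))"
    unfolding sum_distrib_left by (rule sum.swap)
  also have "\<dots> = (\<Sum>i\<in>C. \<Sum>\<beta>\<in>multis C M. (real (\<beta> i) + 1) * (real (\<beta> i) + 1 + \<epsilon> i) * c (inc i \<beta>) * h \<beta>)"
    by (intro sum.cong refl one)
  also have "\<dots> = (\<Sum>\<beta>\<in>multis C M. (\<Sum>i\<in>C. (real (\<beta> i) + 1) * (real (\<beta> i) + 1 + \<epsilon> i) * c (inc i \<beta>)) * h \<beta>)"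
    unfolding sum_distrib_right by (rule sum.swap)
  finally show ?thesis .
qed

lemma ker_coeffs_sum_lower:
  assumes C: "finite C" and c: "c \<in> ker_coeffs C \<epsilon> N"
  shows "(\<Sum>\<alpha>\<in>multis C N. c \<alpha> * (\<Sum>i\<in>C. real (\<alpha> i) * (real (\<alpha> i) + \<epsilon> i) * h (dec i \<alpha>))) = (0::real)"
proof (cases N)
  case 0
  then show ?thesis using C by (simp add: multis_0)
next
  case (Suc M)
  show ?thesis unfolding Suc sum_lower_exponents[OF C] ker_coeffs_eq[OF c] by simp
qed

section \<open>Multiplication by the product of the variables in a set\<close>

definition addJ :: "nat set \<Rightarrow> (nat \<Rightarrow> nat) \<Rightarrow> nat \<Rightarrow> nat" where
  "addJ J \<alpha> i = \<alpha> i + of_bool (i \<in> J)"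

lemma addJ_multis:
  assumes "finite A" "C \<subseteq> A" "J \<subseteq> A" "\<alpha> \<in> multis C m"
  shows "addJ J \<alpha> \<in> multis A (m + card J)"
proof -
  have "sum (addJ J \<alpha>) A = sum \<alpha> A + (\<Sum>i\<in>A. of_bool (i \<in> J))"
    by (simp add: addJ_def sum.distrib)
  also have "(\<Sum>i\<in>A. of_bool (i \<in> J)) = card J"
  proof -
    have "A \<inter> J = J" using assms by auto
    then show ?thesis using assms(1) by (simp add: of_bool_def sum.If_cases Int_def)
  qed
  finally show ?thesis
    using multis_mono[OF assms(2,1), of m] assms(3,4) by (auto simp: multis_def addJ_def)
qed

lemma mon_addJ:
  assumes "J \<subseteq> {1..d+1}" shows "mon d (addJ J \<alpha>) x = xprod d J x * mon d \<alpha> x"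
proof -
  have "(\<Prod>i=1..d+1. xx d x i ^ of_bool (i \<in> J)) = (\<Prod>i=1..d+1. if i \<in> J then xx d x i else 1)"
    by (rule prod.cong) auto
  also have "\<dots> = (\<Prod>i\<in>{1..d+1} \<inter> J. xx d x i)"
    by (rule prod.inter_restrict[symmetric]) simp
  also have "{1..d+1} \<inter> J = J" using assms by auto
  finally have "xprod d J x = (\<Prod>i=1..d+1. xx d x i ^ of_bool (i \<in> J))" by (simp add: xprod_def)
  then show ?thesis
    by (simp add: mon_def addJ_def power_add prod.distrib mult.commute)
qed

text \<open>The singular operator on \<open>xprod d J x\<close> times a form reduces to the
  nonsingular one on the form itself, which vanishes on the kernel; only the eigenvalue term of the
  full degree \<open>m + card J\<close> remains.\<close>

lemma Lop_ker:
  assumes J: "J \<subseteq> C" "C \<subseteq> {1..d+1}" and c: "c \<in> ker_coeffs C \<epsilon>' m"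
    and e: "\<And>i. i \<in> J \<Longrightarrow> \<epsilon> i = -1 \<and> \<epsilon>' i = 1" "\<And>i. i \<in> C - J \<Longrightarrow> \<epsilon> i = \<epsilon>' i"
  shows "Lop d \<epsilon> (\<lambda>x. xprod d J x * hp d m c x) x
    = - (real (m + card J) * (real (m + card J) + (\<Sum>l=1..d+1. \<epsilon> l) + real d)) * (xprod d J x * hp d m c x)"
proof -
  have fC: "finite C" using J finite_subset by blast
  have JD: "J \<subseteq> {1..d+1}" using J by auto
  have f: "xprod d J y * hp d m c y = (\<Sum>\<alpha>\<in>multis C m. c \<alpha> * mon d (addJ J \<alpha>) y)" for y
    using hp_restrict[OF J(2), of m c y] ker_coeffs_supp[OF c]
    by (simp add: mon_addJ[OF JD] sum_distrib_left mult.left_commute)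
  have inner: "(\<Sum>i=1..d+1. real (addJ J \<alpha> i) * (real (addJ J \<alpha> i) + \<epsilon> i) * mon d (dec i (addJ J \<alpha>)) x)
      = (\<Sum>i\<in>C. real (\<alpha> i) * (real (\<alpha> i) + \<epsilon>' i) * (xprod d J x * mon d (dec i \<alpha>) x))"
    if \<alpha>: "\<alpha> \<in> multis C m" for \<alpha>
  proof -
    \<comment> \<open>Variables outside \<open>C\<close> have exponent 0, which annihilates their
      summand whatever the value of \<open>\<epsilon> i\<close>.\<close>
    have "(\<Sum>i=1..d+1. real (addJ J \<alpha> i) * (real (addJ J \<alpha> i) + \<epsilon> i) * mon d (dec i (addJ J \<alpha>)) x)
      = (\<Sum>i\<in>C. real (addJ J \<alpha> i) * (real (addJ J \<alpha> i) + \<epsilon> i) * mon d (dec i (addJ J \<alpha>)) x)"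
      by (rule sum.mono_neutral_right) (use J \<alpha> in \<open>auto simp: addJ_def multis_def\<close>)
    also have "\<dots> = (\<Sum>i\<in>C. real (\<alpha> i) * (real (\<alpha> i) + \<epsilon>' i) * (xprod d J x * mon d (dec i \<alpha>) x))"
    proof (intro sum.cong refl)
      fix i assume i: "i \<in> C"
      \<comment> \<open>For \<open>i\<close> in \<open>J\<close> this is (a + 1)((a + 1) - 1) = a (a
        + 1), with a the exponent before the shift.\<close>
      have coef: "real (addJ J \<alpha> i) * (real (addJ J \<alpha> i) + \<epsilon> i) = real (\<alpha> i) * (real (\<alpha> i) + \<epsilon>' i)"
        using e i by (cases "i \<in> J") (auto simp: addJ_def)
      show "real (addJ J \<alpha> i) * (real (addJ J \<alpha> i) + \<epsilon> i) * mon d (dec i (addJ J \<alpha>)) x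
          = real (\<alpha> i) * (real (\<alpha> i) + \<epsilon>' i) * (xprod d J x * mon d (dec i \<alpha>) x)"
      proof (cases "\<alpha> i = 0")
        case False
        then have "dec i (addJ J \<alpha>) = addJ J (dec i \<alpha>)" by (auto simp: addJ_def fun_eq_iff)
        then show ?thesis unfolding coef by (simp add: mon_addJ[OF JD])
      qed (simp add: coef)
    qed
    finally show ?thesis .
  qed
  have "Lop d \<epsilon> (\<lambda>x. xprod d J x * hp d m c x) x
    = (\<Sum>\<alpha>\<in>multis C m. c \<alpha> * (\<Sum>i=1..d+1. real (addJ J \<alpha> i) * (real (addJ J \<alpha> i) + \<epsilon> i) * mon d (dec i (addJ J \<alpha>)) x))
       - real (m + card J) * (real (m + card J) + (\<Sum>l=1..d+1. \<epsilon> l) + real d) * (xprod d J x * hp d m c x)"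
    unfolding f by (rule Lop_mon_sum) (use fC J JD addJ_multis in auto)
  also have "(\<Sum>\<alpha>\<in>multis C m. c \<alpha> * (\<Sum>i=1..d+1. real (addJ J \<alpha> i) * (real (addJ J \<alpha> i) + \<epsilon> i) * mon d (dec i (addJ J \<alpha>)) x)) = 0"
    using ker_coeffs_sum_lower[OF fC c, of "\<lambda>\<beta>. xprod d J x * mon d \<beta> x"] inner by simp
  finally show ?thesis by simp
qed

text \<open>A kernel element is determined by its restriction to \<open>x\<^sub>r = 0\<close>: the kernel equation expresses the
  coefficients with exponent \<open>b + 1\<close> in \<open>x\<^sub>r\<close> through those with exponent \<open>b\<close>.\<close>
lemma ker_coeffs_eq_zero:
  assumes C: "finite C" "r \<in> C" and \<epsilon>: "\<epsilon> r > -1" and c: "c \<in> ker_coeffs C \<epsilon> N"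
    and z: "\<And>\<beta>. \<beta> \<in> multis C N \<Longrightarrow> \<beta> r = 0 \<Longrightarrow> c \<beta> = 0"
  shows "c = (\<lambda>_. 0)"
proof
  fix \<beta>
  show "c \<beta> = 0"
  proof (induction "\<beta> r" arbitrary: \<beta>)
    case 0
    then show ?case using z[of \<beta>] ker_coeffs_supp[OF c, of \<beta>] by (cases "\<beta> \<in> multis C N") simp_all
  next
    case (Suc b)
    let ?\<beta> = "dec r \<beta>"
    have b: "inc r ?\<beta> = \<beta>" using Suc.hyps(2) inc_dec[of \<beta> r] by simp
    have "(\<Sum>j\<in>C-{r}. (real (?\<beta> j) + 1) * (real (?\<beta> j) + 1 + \<epsilon> j) * c (inc j ?\<beta>)) = 0"
    proof (intro sum.neutral ballI)
      fix j assume "j \<in> C - {r}"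
      then have "c (inc j ?\<beta>) = 0" using Suc.hyps(2) by (intro Suc.hyps(1)) auto
      then show "(real (?\<beta> j) + 1) * (real (?\<beta> j) + 1 + \<epsilon> j) * c (inc j ?\<beta>) = 0" by simp
    qed
    then have "(real (?\<beta> r) + 1) * (real (?\<beta> r) + 1 + \<epsilon> r) * c \<beta> = 0"
      using ker_coeffs_eq[OF c, of ?\<beta>] sum.remove[OF C, of "\<lambda>j. (real (?\<beta> j) + 1) * (real (?\<beta> j) + 1 + \<epsilon> j) * c (inc j ?\<beta>)"]
      unfolding b by simp
    moreover have "real (?\<beta> r) + 1 + \<epsilon> r > 0" using \<epsilon> by simp
    ultimately show ?case by (smt (verit) mult_eq_0_iff of_nat_0_le_iff)
  qed
qed

section \<open>The Rodrigues formula\<close>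

text \<open>The exponents of \<open>x_i * x_r\<close> times the weight, so that one differentiation
  brings the weight back with a factor of degree one.\<close>

definition bump :: "nat \<Rightarrow> nat \<Rightarrow> (nat \<Rightarrow> real) \<Rightarrow> nat \<Rightarrow> real" where
  "bump i r \<epsilon> j = \<epsilon> j + of_bool (j = i) + of_bool (j = r)"

text \<open>With \<open>W\<close> the weight of exponents \<open>\<epsilon>\<close>, this is the map \<open>p \<mapsto> W\<^sup>-\<^sup>1 (\<partial>\<^sub>i - \<partial>\<^sub>r) (x\<^sub>i x\<^sub>r W p)\<close>
  on coefficients; it sends \<open>x\<^sup>\<gamma>\<close> to \<open>(\<epsilon>\<^sub>i + 1 + \<gamma>\<^sub>i) x\<^sub>r x\<^sup>\<gamma> - (\<epsilon>\<^sub>r + 1 + \<gamma>\<^sub>r) x\<^sub>i x\<^sup>\<gamma>\<close>.\<close>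
definition rod :: "nat \<Rightarrow> nat \<Rightarrow> (nat \<Rightarrow> real) \<Rightarrow> ((nat \<Rightarrow> nat) \<Rightarrow> real) \<Rightarrow> (nat \<Rightarrow> nat) \<Rightarrow> real" where
  "rod i r \<epsilon> c \<beta> = (\<epsilon> i + 1 + real (\<beta> i)) * (if \<beta> r = 0 then 0 else c (dec r \<beta>))
     - (\<epsilon> r + 1 + real (\<beta> r)) * (if \<beta> i = 0 then 0 else c (dec i \<beta>))"

lemma dec_mem_multis:
  assumes "finite C" "i \<in> C" "\<beta> i > 0"
  shows "dec i \<beta> \<in> multis C N \<longleftrightarrow> \<beta> \<in> multis C (Suc N)"
  using inc_mem_multis_Suc[OF assms(1,2), of "dec i \<beta>" N] inc_dec[of \<beta> i] assms(3) by simp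

text \<open>One Rodrigues step raises the degree by one and lowers the parameters back from
  \<open>bump i r \<epsilon>\<close> to \<open>\<epsilon>\<close> while preserving the kernel
  property. The equation at \<open>\<beta>\<close> is a linear combination of the two equations for
  \<open>c\<close> at \<open>dec r \<beta>\<close> and \<open>dec i \<beta>\<close>.\<close>

lemma rod_ker:
  assumes C: "finite C" "i \<in> C" "r \<in> C" "i \<noteq> r" and c: "c \<in> ker_coeffs C (bump i r \<epsilon>) N"
  shows "rod i r \<epsilon> c \<in> ker_coeffs C \<epsilon> (Suc N)"
proof -
  have supp: "rod i r \<epsilon> c \<beta> = 0" if "\<beta> \<notin> multis C (Suc N)" for \<beta>
  proof -
    have "\<beta> i > 0 \<longrightarrow> c (dec i \<beta>) = 0" "\<beta> r > 0 \<longrightarrow> c (dec r \<beta>) = 0"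
      using ker_coeffs_supp[OF c] dec_mem_multis[OF C(1,2), of \<beta> N] dec_mem_multis[OF C(1,3), of \<beta> N] that by auto
    then show ?thesis by (auto simp: rod_def)
  qed
  have eq: "(\<Sum>j\<in>C. (real (\<beta> j) + 1) * (real (\<beta> j) + 1 + \<epsilon> j) * rod i r \<epsilon> c (inc j \<beta>)) = 0" for \<beta>
  proof -
    let ?C = "C - {i,r}"
    define w where "w j = (real (\<beta> j) + 1) * (real (\<beta> j) + 1 + \<epsilon> j)" for j
    \<comment> \<open>The default 0 covers the case where the exponent cannot be lowered;
      \<open>P\<close> or \<open>Q\<close> below then reads 0 = 0.\<close>
    define U where "U j = (if \<beta> r = 0 then 0 else c (inc j (dec r \<beta>)))" for j
    define V where "V j = (if \<beta> i = 0 then 0 else c (inc j (dec i \<beta>)))" for j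
    define a where "a = \<epsilon> i + 1 + real (\<beta> i)"
    define b where "b = \<epsilon> r + 1 + real (\<beta> r)"
    have P: "(\<Sum>j\<in>?C. w j * U j) + (real (\<beta> i) + 1) * (a + 1) * U i + real (\<beta> r) * b * c \<beta> = 0"
    proof (cases "\<beta> r = 0")
      case False
      have "0 = (\<Sum>j\<in>C. (real (dec r \<beta> j) + 1) * (real (dec r \<beta> j) + 1 + bump i r \<epsilon> j) * c (inc j (dec r \<beta>)))"
        using ker_coeffs_eq[OF c, of "dec r \<beta>"] by simp
      also have "\<dots> = (real (\<beta> i) + 1) * (a + 1) * U i + real (\<beta> r) * b * c \<beta>
         + (\<Sum>j\<in>?C. (real (dec r \<beta> j) + 1) * (real (dec r \<beta> j) + 1 + bump i r \<epsilon> j) * c (inc j (dec r \<beta>)))"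
        unfolding sum_two[OF C] using False C(4)
        by (simp add: a_def b_def U_def bump_def of_nat_diff algebra_simps)
      also have "(\<Sum>j\<in>?C. (real (dec r \<beta> j) + 1) * (real (dec r \<beta> j) + 1 + bump i r \<epsilon> j) * c (inc j (dec r \<beta>)))
         = (\<Sum>j\<in>?C. w j * U j)"
        using False by (intro sum.cong refl) (auto simp: w_def U_def bump_def)
      finally show ?thesis by simp
    qed (simp add: U_def)
    have Q: "(\<Sum>j\<in>?C. w j * V j) + (real (\<beta> r) + 1) * (b + 1) * V r + real (\<beta> i) * a * c \<beta> = 0"
    proof (cases "\<beta> i = 0")
      case False
      have "0 = (\<Sum>j\<in>C. (real (dec i \<beta> j) + 1) * (real (dec i \<beta> j) + 1 + bump i r \<epsilon> j) * c (inc j (dec i \<beta>)))"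
        using ker_coeffs_eq[OF c, of "dec i \<beta>"] by simp
      also have "\<dots> = (real (\<beta> r) + 1) * (b + 1) * V r + real (\<beta> i) * a * c \<beta>
         + (\<Sum>j\<in>?C. (real (dec i \<beta> j) + 1) * (real (dec i \<beta> j) + 1 + bump i r \<epsilon> j) * c (inc j (dec i \<beta>)))"
        unfolding sum_two[OF C] using False C(4)
        by (simp add: a_def b_def V_def bump_def of_nat_diff algebra_simps)
      also have "(\<Sum>j\<in>?C. (real (dec i \<beta> j) + 1) * (real (dec i \<beta> j) + 1 + bump i r \<epsilon> j) * c (inc j (dec i \<beta>)))
         = (\<Sum>j\<in>?C. w j * V j)"
        using False by (intro sum.cong refl) (auto simp: w_def V_def bump_def)
      finally show ?thesis by simp
    qed (simp add: V_def)
    have ri: "rod i r \<epsilon> c (inc i \<beta>) = (a + 1) * U i - b * c \<beta>"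
    proof -
      have "dec r (inc i \<beta>) = inc i (dec r \<beta>)" using C(4) by (auto simp: fun_eq_iff)
      moreover have "dec i (inc i \<beta>) = \<beta>" by auto
      ultimately show ?thesis using C(4) by (simp add: rod_def U_def a_def b_def)
    qed
    have rr: "rod i r \<epsilon> c (inc r \<beta>) = a * c \<beta> - (b + 1) * V r"
    proof -
      have "dec i (inc r \<beta>) = inc r (dec i \<beta>)" using C(4) by (auto simp: fun_eq_iff)
      moreover have "dec r (inc r \<beta>) = \<beta>" by auto
      ultimately show ?thesis using C(4) by (simp add: rod_def V_def a_def b_def)
    qed
    have rj: "rod i r \<epsilon> c (inc j \<beta>) = a * U j - b * V j" if "j \<in> ?C" for j
    proof -
      have "dec i (inc j \<beta>) = inc j (dec i \<beta>)" "dec r (inc j \<beta>) = inc j (dec r \<beta>)"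
        using that by (auto simp: fun_eq_iff)
      then show ?thesis using that by (simp add: rod_def U_def V_def a_def b_def)
    qed
    have wir: "w i = (real (\<beta> i) + 1) * a" "w r = (real (\<beta> r) + 1) * b"
      by (auto simp: w_def a_def b_def)
    have "(\<Sum>j\<in>C. w j * rod i r \<epsilon> c (inc j \<beta>))
       = w i * ((a + 1) * U i - b * c \<beta>) + w r * (a * c \<beta> - (b + 1) * V r)
         + (\<Sum>j\<in>?C. w j * rod i r \<epsilon> c (inc j \<beta>))"
      unfolding sum_two[OF C] ri rr by simp
    also have "(\<Sum>j\<in>?C. w j * rod i r \<epsilon> c (inc j \<beta>)) = (\<Sum>j\<in>?C. a * (w j * U j) - b * (w j * V j))"
      by (intro sum.cong refl) (simp add: rj algebra_simps)
    also have "\<dots> = a * (\<Sum>j\<in>?C. w j * U j) - b * (\<Sum>j\<in>?C. w j * V j)"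
      by (simp add: sum_subtractf sum_distrib_left)
    \<comment> \<open>The whole expression is \<open>a\<close> times the left side of
      \<open>P\<close> minus \<open>b\<close> times the left side of \<open>Q\<close>; the terms
      with \<open>c \<beta>\<close> match because the two shifts by 1 cancel.\<close>
    also have "w i * ((a + 1) * U i - b * c \<beta>) + w r * (a * c \<beta> - (b + 1) * V r) + \<dots>
       = a * ((\<Sum>j\<in>?C. w j * U j) + (real (\<beta> i) + 1) * (a + 1) * U i + real (\<beta> r) * b * c \<beta>)
         - b * ((\<Sum>j\<in>?C. w j * V j) + (real (\<beta> r) + 1) * (b + 1) * V r + real (\<beta> i) * a * c \<beta>)"
      unfolding wir by algebra
    finally have "(\<Sum>j\<in>C. w j * rod i r \<epsilon> c (inc j \<beta>)) = 0" unfolding P Q by (simp only: mult_zero_right diff_self)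
    then show ?thesis by (simp only: w_def)
  qed
  show ?thesis using supp eq by (simp add: ker_coeffs_def)
qed

text \<open>Coefficients of the Rodrigues polynomial whose differentiations are spelled by the word,
  outermost letter first. The parameters grow towards the inner letters, since each outer letter
  contributes one more factor \<open>x_i * x_r\<close> under the derivative.\<close>

primrec rodw :: "nat \<Rightarrow> nat list \<Rightarrow> (nat \<Rightarrow> real) \<Rightarrow> (nat \<Rightarrow> nat) \<Rightarrow> real" where
  "rodw r [] \<epsilon> = (\<lambda>\<beta>. of_bool (\<beta> = (\<lambda>_. 0)))"
| "rodw r (i # w) \<epsilon> = rod i r \<epsilon> (rodw r w (bump i r \<epsilon>))"

lemma rodw_ker:
  assumes "finite C" "r \<in> C" "set w \<subseteq> C - {r}"
  shows "rodw r w \<epsilon> \<in> ker_coeffs C \<epsilon> (length w)"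
  using assms(3)
proof (induction w arbitrary: \<epsilon>)
  case Nil
  have "inc j \<beta> \<noteq> (\<lambda>_. 0)" for j \<beta> by (metis fun_upd_same nat.distinct(1))
  then show ?case using assms by (simp add: ker_coeffs_def multis_0)
next
  case (Cons i w)
  then show ?case using rod_ker[of C i r "rodw r w (bump i r \<epsilon>)" \<epsilon> "length w"] assms by auto
qed

text \<open>At exponent 0 in \<open>x_r\<close> the first term of \<open>rod\<close> disappears, so
  each letter \<open>i\<close> only multiplies by \<open>x_i\<close> and by
  -(\<open>\<epsilon> r\<close> + 1), taken with the current parameter. This stays nonzero because
  \<open>bump\<close> increases \<open>\<epsilon> r\<close>. As a function,
  \<open>count_list w\<close> is the multi-index of the word.\<close>

lemma rodw_restrict:
  assumes "\<epsilon> r > -1" "r \<notin> set w"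
  shows "\<exists>\<kappa>. \<kappa> \<noteq> 0 \<and> (\<forall>\<beta>. \<beta> r = 0 \<longrightarrow> rodw r w \<epsilon> \<beta> = \<kappa> * of_bool (\<beta> = count_list w))"
  using assms
proof (induction w arbitrary: \<epsilon>)
  case Nil
  have "count_list [] = (\<lambda>_::nat. 0::nat)" by auto
  then show ?case by (intro exI[of _ 1]) simp
next
  case (Cons i w)
  have ir: "i \<noteq> r" using Cons.prems by auto
  have "\<exists>\<kappa>. \<kappa> \<noteq> 0 \<and> (\<forall>\<beta>. \<beta> r = 0 \<longrightarrow> rodw r w (bump i r \<epsilon>) \<beta> = \<kappa> * of_bool (\<beta> = count_list w))"
    using Cons.prems ir by (intro Cons.IH) (auto simp: bump_def)
  then obtain \<kappa> where \<kappa>: "\<kappa> \<noteq> 0" "\<And>\<beta>. \<beta> r = 0 \<Longrightarrow> rodw r w (bump i r \<epsilon>) \<beta> = \<kappa> * of_bool (\<beta> = count_list w)"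
    by blast
  have "rodw r (i # w) \<epsilon> \<beta> = (- (\<epsilon> r + 1) * \<kappa>) * of_bool (\<beta> = count_list (i # w))" if \<beta>: "\<beta> r = 0" for \<beta>
  proof -
    have cl: "count_list (i # w) = inc i (count_list w)" by auto
    show ?thesis
    proof (cases "\<beta> i = 0")
      case True
      then have "\<beta> \<noteq> inc i (count_list w)" by (metis fun_upd_same nat.distinct(1))
      then show ?thesis using True \<beta> unfolding cl by (simp add: rod_def)
    next
      case False
      have "dec i \<beta> = count_list w \<longleftrightarrow> \<beta> = inc i (count_list w)"
      proof
        assume "dec i \<beta> = count_list w"
        then have "inc i (dec i \<beta>) = inc i (count_list w)" by (rule arg_cong)
        then show "\<beta> = inc i (count_list w)" using inc_dec[of \<beta> i] False by simp
      qed auto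
      moreover have "dec i \<beta> r = 0" using \<beta> ir by simp
      ultimately show ?thesis using False \<beta> \<kappa>(2)[of "dec i \<beta>"] unfolding cl by (simp add: rod_def algebra_simps)
    qed
  qed
  moreover have "- (\<epsilon> r + 1) * \<kappa> \<noteq> 0" using \<kappa> Cons.prems by simp
  ultimately show ?case by blast
qed

section \<open>Real powers on the open simplex and the Rodrigues operator\<close>

definition wt :: "nat \<Rightarrow> nat set \<Rightarrow> (nat \<Rightarrow> real) \<Rightarrow> pt \<Rightarrow> real" where
  "wt d C \<delta> x = (\<Prod>j\<in>C. xx d x j powr \<delta> j)"

lemma Tint_pos: "x \<in> Tint d \<Longrightarrow> j \<in> {1..d+1} \<Longrightarrow> xx d x j > 0"
  by (auto simp: Tint_def xx_def)

lemma wt_add: "wt d C (\<lambda>j. \<delta> j + \<delta>' j) x = wt d C \<delta> x * wt d C \<delta>' x"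
  by (simp add: wt_def powr_add prod.distrib)

lemma wt_mon:
  assumes "x \<in> Tint d" "C \<subseteq> {1..d+1}" "\<gamma> \<in> multis C N"
  shows "wt d C (\<lambda>j. real (\<gamma> j)) x = mon d \<gamma> x"
proof -
  have "mon d \<gamma> x = (\<Prod>j\<in>C. xx d x j ^ \<gamma> j)"
    unfolding mon_def by (rule prod.mono_neutral_right) (use assms in \<open>auto simp: multis_def\<close>)
  also have "\<dots> = wt d C (\<lambda>j. real (\<gamma> j)) x"
    unfolding wt_def using Tint_pos[OF assms(1)] assms(2) by (intro prod.cong refl) (auto simp: powr_realpow)
  finally show ?thesis by simp
qed

text \<open>The derivative of the j-th barycentric coordinate with respect to the i-th Cartesian
  one.\<close>

definition dxx :: "nat \<Rightarrow> nat \<Rightarrow> nat \<Rightarrow> real" where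
  "dxx d i j = (if j = i then 1 else if j = d + 1 then -1 else 0)"

lemma wt_has_derivative:
  assumes x: "x \<in> Tint d" and i: "i \<in> {1..d}" and C: "C \<subseteq> {1..d+1}"
  shows "((\<lambda>t. wt d C \<delta> (x(i := t))) has_real_derivative
     (\<Sum>j\<in>C. dxx d i j * \<delta> j * wt d C (\<delta>(j := \<delta> j - 1)) x)) (at (x i))"
proof -
  have fC: "finite C" using C finite_subset by blast
  have xi: "x(i := x i) = x" by simp
  have "((\<lambda>t. xx d (x(i := t)) j powr \<delta> j) has_real_derivative
      dxx d i j * \<delta> j * xx d x j powr (\<delta> j - 1)) (at (x i))" if j: "j \<in> C" for j
  proof -
    have pos: "xx d x j > 0" using Tint_pos[OF x] j C by auto
    have "((\<lambda>t. xx d (x(i := t)) j) has_real_derivative dxx d i j) (at (x i))"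
      unfolding xx_upd[OF i] dxx_def using i by (auto intro!: derivative_eq_intros)
    from DERIV_powr[OF this _ DERIV_const, of "\<delta> j"] pos
    have "((\<lambda>t. xx d (x(i := t)) j powr \<delta> j) has_real_derivative
      xx d x j powr \<delta> j * (dxx d i j * \<delta> j / xx d x j)) (at (x i))"
      by (simp add: xi)
    moreover have "xx d x j powr (\<delta> j - 1) = xx d x j powr \<delta> j / xx d x j"
      using pos by (simp add: powr_diff)
    ultimately show ?thesis by (simp add: mult_ac)
  qed
  from has_field_derivative_prod[OF this, of C "\<lambda>j. j"]
  have "((\<lambda>t. wt d C \<delta> (x(i := t))) has_real_derivative
      (\<Sum>j\<in>C. dxx d i j * \<delta> j * xx d x j powr (\<delta> j - 1) * (\<Prod>k\<in>C-{j}. xx d x k powr \<delta> k))) (at (x i))"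
    by (simp add: wt_def xi)
  also have "(\<Sum>j\<in>C. dxx d i j * \<delta> j * xx d x j powr (\<delta> j - 1) * (\<Prod>k\<in>C-{j}. xx d x k powr \<delta> k))
    = (\<Sum>j\<in>C. dxx d i j * \<delta> j * wt d C (\<delta>(j := \<delta> j - 1)) x)"
  proof (intro sum.cong refl)
    fix j assume j: "j \<in> C"
    have "(\<Prod>k\<in>C-{j}. xx d x k powr (\<delta>(j := \<delta> j - 1)) k) = (\<Prod>k\<in>C-{j}. xx d x k powr \<delta> k)"
      by (rule prod.cong) auto
    then have "wt d C (\<delta>(j := \<delta> j - 1)) x = xx d x j powr (\<delta> j - 1) * (\<Prod>k\<in>C-{j}. xx d x k powr \<delta> k)"
      unfolding wt_def using prod.remove[OF fC j, of "\<lambda>k. xx d x k powr (\<delta>(j := \<delta> j - 1)) k"] by simp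
    then show "dxx d i j * \<delta> j * xx d x j powr (\<delta> j - 1) * (\<Prod>k\<in>C-{j}. xx d x k powr \<delta> k)
      = dxx d i j * \<delta> j * wt d C (\<delta>(j := \<delta> j - 1)) x" by simp
  qed
  finally show ?thesis .
qed

lemma Tint_slice:
  assumes x: "x \<in> Tint d" and i: "i \<in> {1..d}"
  shows "eventually (\<lambda>t. x(i := t) \<in> Tint d) (nhds (x i))"
proof -
  have ev1: "eventually (\<lambda>t. t > 0) (nhds (x i))"
    using order_tendstoD(1)[OF filterlim_ident, of 0 "x i"] x i by (auto simp: Tint_def)
  have ev2: "eventually (\<lambda>t. t < xx d x (d+1) + x i) (nhds (x i))"
    using order_tendstoD(2)[OF filterlim_ident, of "x i" "xx d x (d+1) + x i"] Tint_pos[OF x, of "d+1"] by auto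
  show ?thesis
    using ev1 ev2
  proof eventually_elim
    case (elim t)
    have "xx d (x(i := t)) (d+1) > 0" unfolding xx_upd[OF i] using elim i by auto
    then show ?case using elim x by (auto simp: Tint_def xx_def)
  qed
qed

text \<open>An identity known only on the open simplex may be differentiated, since moving one
  coordinate slightly does not leave the simplex.\<close>

lemma Dop_cong_Tint:
  assumes x: "x \<in> Tint d" and "i \<in> {1..d}" "r \<in> {1..d+1}" "\<And>y. y \<in> Tint d \<Longrightarrow> f y = g y"
  shows "Dop d r i f x = Dop d r i g x"
proof -
  have "pd j f x = pd j g x" if j: "j \<in> {1..d}" for j
  proof -
    have "eventually (\<lambda>t. f (x(j := t)) = g (x(j := t))) (nhds (x j))"
      using Tint_slice[OF x j] by eventually_elim (rule assms(4))
    then show ?thesis unfolding pd_def by (rule deriv_cong_ev) simp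
  qed
  then show ?thesis using assms by (auto simp: Dop_def)
qed

text \<open>In both cases \<open>Dop d r i\<close> is the formal difference of the i-th and r-th
  derivatives: if \<open>r = d + 1\<close>, the chain rule produces the second derivative; if
  \<open>r \<le> d\<close>, the last coordinate does not occur in the powers and the second
  derivative is subtracted explicitly.\<close>

lemma Dop_wt_sum:
  assumes x: "x \<in> Tint d" and C: "C \<subseteq> {1..d+1}" and i: "i \<in> C" "i \<noteq> r" and r: "r \<in> C"
    and rd: "d + 1 \<in> C \<longrightarrow> r = d + 1"
  shows "Dop d r i (\<lambda>y. \<Sum>k\<in>K. c k * wt d C (\<delta> k) y) x
    = (\<Sum>k\<in>K. c k * (\<delta> k i * wt d C ((\<delta> k)(i := \<delta> k i - 1)) x - \<delta> k r * wt d C ((\<delta> k)(r := \<delta> k r - 1)) x))"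
proof -
  have fC: "finite C" using C finite_subset by blast
  define E where "E k j = \<delta> k j * wt d C ((\<delta> k)(j := \<delta> k j - 1)) x" for k j
  have p: "pd l (\<lambda>y. \<Sum>k\<in>K. c k * wt d C (\<delta> k) y) x = (\<Sum>k\<in>K. c k * (\<Sum>j\<in>C. dxx d l j * E k j))"
    if "l \<in> {1..d}" for l
    unfolding pd_def E_def mult.assoc[symmetric, of "dxx d l _"]
    by (intro DERIV_imp_deriv DERIV_sum DERIV_cmult wt_has_derivative x that C)
  have id: "i \<in> {1..d}" using i C rd r by (metis Suc_eq_plus1 atLeastAtMost_iff le_SucE subsetD)
  have two: "(\<Sum>j\<in>C. f j * E k j) = f i * E k i + f r * E k r" if "\<And>j. j \<in> C - {i,r} \<Longrightarrow> f j = 0" for f k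
    unfolding sum_two[OF fC i(1) r i(2)] using that by simp
  show ?thesis
  proof (cases "r = d + 1")
    case True
    have "(\<Sum>j\<in>C. dxx d i j * E k j) = E k i - E k r" for k
      by (subst two) (use True id in \<open>auto simp: dxx_def\<close>)
    then show ?thesis unfolding Dop_def using True p[OF id] by (simp add: E_def)
  next
    case False
    then have rd': "r \<in> {1..d}" "d + 1 \<notin> C" using r C rd by (force simp: le_Suc_eq)+
    have "(\<Sum>j\<in>C. dxx d i j * E k j) = E k i" "(\<Sum>j\<in>C. dxx d r j * E k j) = E k r" for k
      by (subst two; use False rd' id i in \<open>auto simp: dxx_def\<close>)+
    then show ?thesis unfolding Dop_def using False p[OF id] p[OF rd'(1)]
      by (simp add: E_def right_diff_distrib sum_subtractf)
  qed
qed

lemma sum_shift_multis: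
  fixes g :: "(nat \<Rightarrow> nat) \<Rightarrow> real"
  assumes "finite C" "i \<in> C"
  shows "(\<Sum>\<beta>\<in>multis C (Suc N). g \<beta> * (if \<beta> i = 0 then 0 else c (dec i \<beta>))) = (\<Sum>\<gamma>\<in>multis C N. g (inc i \<gamma>) * c \<gamma>)"
proof -
  have "(\<Sum>\<beta>\<in>multis C (Suc N). g \<beta> * (if \<beta> i = 0 then 0 else c (dec i \<beta>)))
     = (\<Sum>\<beta>\<in>{\<beta> \<in> multis C (Suc N). \<beta> i > 0}. g \<beta> * c (dec i \<beta>))"
    by (intro sum.mono_neutral_cong_right) (use assms in auto)
  also have "\<dots> = (\<Sum>\<gamma>\<in>multis C N. g (inc i \<gamma>) * c \<gamma>)"
  proof (rule sum.reindex_bij_witness[of _ "inc i" "dec i"])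
    fix \<beta> assume \<beta>: "\<beta> \<in> {\<beta> \<in> multis C (Suc N). \<beta> i > 0}"
    then show *: "inc i (dec i \<beta>) = \<beta>" by auto
    show "dec i \<beta> \<in> multis C N" using \<beta> dec_mem_multis[OF assms, of \<beta> N] by simp
    show "g (inc i (dec i \<beta>)) * c (dec i \<beta>) = g \<beta> * c (dec i \<beta>)" unfolding * ..
  next
    fix \<gamma> assume \<gamma>: "\<gamma> \<in> multis C N"
    show "dec i (inc i \<gamma>) = \<gamma>" by auto
    have "inc i \<gamma> \<in> multis C (Suc N)" unfolding inc_mem_multis_Suc[OF assms] by (rule \<gamma>)
    then show "inc i \<gamma> \<in> {\<beta> \<in> multis C (Suc N). \<beta> i > 0}" by simp
  qed
  finally show ?thesis .
qed

lemma hp_rod: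
  assumes C: "C \<subseteq> {1..d+1}" "i \<in> C" "r \<in> C" "i \<noteq> r" and c: "\<And>\<beta>. \<beta> \<notin> multis C N \<Longrightarrow> c \<beta> = 0"
  shows "hp d (Suc N) (rod i r \<epsilon> c) x
    = (\<Sum>\<gamma>\<in>multis C N. c \<gamma> * ((\<epsilon> i + 1 + real (\<gamma> i)) * mon d (inc r \<gamma>) x - (\<epsilon> r + 1 + real (\<gamma> r)) * mon d (inc i \<gamma>) x))"
proof -
  have fC: "finite C" using C finite_subset by blast
  have supp: "rod i r \<epsilon> c \<beta> = 0" if "\<beta> \<notin> multis C (Suc N)" for \<beta>
  proof -
    have "\<beta> i > 0 \<longrightarrow> c (dec i \<beta>) = 0" "\<beta> r > 0 \<longrightarrow> c (dec r \<beta>) = 0"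
      using c dec_mem_multis[OF fC C(2), of \<beta> N] dec_mem_multis[OF fC C(3), of \<beta> N] that by auto
    then show ?thesis by (auto simp: rod_def)
  qed
  have "hp d (Suc N) (rod i r \<epsilon> c) x = (\<Sum>\<beta>\<in>multis C (Suc N). rod i r \<epsilon> c \<beta> * mon d \<beta> x)"
    by (rule hp_restrict[OF C(1) supp])
  also have "\<dots> = (\<Sum>\<beta>\<in>multis C (Suc N). (\<epsilon> i + 1 + real (\<beta> i)) * mon d \<beta> x * (if \<beta> r = 0 then 0 else c (dec r \<beta>)))
     - (\<Sum>\<beta>\<in>multis C (Suc N). (\<epsilon> r + 1 + real (\<beta> r)) * mon d \<beta> x * (if \<beta> i = 0 then 0 else c (dec i \<beta>)))"
    unfolding sum_subtractf[symmetric] rod_def by (intro sum.cong refl) (simp add: algebra_simps)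
  also have "\<dots> = (\<Sum>\<gamma>\<in>multis C N. (\<epsilon> i + 1 + real (inc r \<gamma> i)) * mon d (inc r \<gamma>) x * c \<gamma>)
     - (\<Sum>\<gamma>\<in>multis C N. (\<epsilon> r + 1 + real (inc i \<gamma> r)) * mon d (inc i \<gamma>) x * c \<gamma>)"
    unfolding sum_shift_multis[OF fC C(3), where g="\<lambda>\<beta>. (\<epsilon> i + 1 + real (\<beta> i)) * mon d \<beta> x"]
      sum_shift_multis[OF fC C(2), where g="\<lambda>\<beta>. (\<epsilon> r + 1 + real (\<beta> r)) * mon d \<beta> x"] ..
  also have "\<dots> = (\<Sum>\<gamma>\<in>multis C N. c \<gamma> * ((\<epsilon> i + 1 + real (\<gamma> i)) * mon d (inc r \<gamma>) x - (\<epsilon> r + 1 + real (\<gamma> r)) * mon d (inc i \<gamma>) x))"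
    unfolding sum_subtractf[symmetric] using C(4) by (intro sum.cong refl) (simp add: algebra_simps)
  finally show ?thesis .
qed

text \<open>The iterated derivative keeps the shape weight times form. Peeling off the outermost
  letter changes the parameters, hence the induction over all \<open>\<epsilon>\<close>.\<close>

lemma foldr_Dop_rodw:
  assumes C: "C \<subseteq> {1..d+1}" "r \<in> C" "d + 1 \<in> C \<longrightarrow> r = d + 1" and w: "set w \<subseteq> C - {r}" and x: "x \<in> Tint d"
  shows "foldr (Dop d r) w (wt d C (\<lambda>j. \<epsilon> j + real (count_list w j) + of_bool (j = r) * real (length w))) x
    = wt d C \<epsilon> x * hp d (length w) (rodw r w \<epsilon>) x"
  using w x
proof (induction w arbitrary: \<epsilon> x)
  case Nil
  have "hp d 0 (\<lambda>\<beta>. of_bool (\<beta> = (\<lambda>_. 0))) = mon d (\<lambda>_. 0)"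
    by (rule hp_single) (simp add: multis_0)
  then show ?case by simp
next
  case (Cons i w)
  have fC: "finite C" using C finite_subset by blast
  have i: "i \<in> C" "i \<noteq> r" using Cons.prems by auto
  then have id: "i \<in> {1..d}" using C by (metis Suc_eq_plus1 atLeastAtMost_iff le_SucE subsetD)
  let ?c = "rodw r w (bump i r \<epsilon>)" and ?N = "length w"
  have c: "?c \<in> ker_coeffs C (bump i r \<epsilon>) ?N"
    using rodw_ker[OF fC C(2), of w] Cons.prems by auto
  \<comment> \<open>The same powers, read as belonging to the shorter word with bumped parameters:
    the letter \<open>i\<close> contributes one power of \<open>x_i\<close> and one of
    \<open>x_r\<close>.\<close>
  have ex: "(\<lambda>j. \<epsilon> j + real (count_list (i # w) j) + of_bool (j = r) * real (length (i # w)))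
     = (\<lambda>j. bump i r \<epsilon> j + real (count_list w j) + of_bool (j = r) * real (length w))"
    using i by (auto simp: bump_def fun_eq_iff)
  let ?F = "\<lambda>y. \<Sum>\<gamma>\<in>multis C ?N. ?c \<gamma> * wt d C (\<lambda>j. bump i r \<epsilon> j + real (\<gamma> j)) y"
  have F: "foldr (Dop d r) w (wt d C (\<lambda>j. bump i r \<epsilon> j + real (count_list w j) + of_bool (j = r) * real (length w))) y
     = ?F y" if y: "y \<in> Tint d" for y
  proof -
    have "hp d ?N ?c y = (\<Sum>\<gamma>\<in>multis C ?N. ?c \<gamma> * mon d \<gamma> y)"
      by (rule hp_restrict[OF C(1) ker_coeffs_supp[OF c]])
    then have "wt d C (bump i r \<epsilon>) y * hp d ?N ?c y = ?F y"
      by (simp add: sum_distrib_left wt_add wt_mon[OF y C(1)] mult.left_commute)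
    then show ?thesis using Cons.IH[of y "bump i r \<epsilon>"] Cons.prems y by (simp only: list.set insert_subset)
  qed
  have "foldr (Dop d r) (i # w) (wt d C (\<lambda>j. \<epsilon> j + real (count_list (i # w) j) + of_bool (j = r) * real (length (i # w)))) x
     = Dop d r i ?F x"
    unfolding ex foldr_Cons o_apply
    by (rule Dop_cong_Tint[OF Cons.prems(2) id]) (use C F in auto)
  also have "\<dots> = (\<Sum>\<gamma>\<in>multis C ?N. ?c \<gamma> * (wt d C \<epsilon> x *
      ((\<epsilon> i + 1 + real (\<gamma> i)) * mon d (inc r \<gamma>) x - (\<epsilon> r + 1 + real (\<gamma> r)) * mon d (inc i \<gamma>) x)))"
    unfolding Dop_wt_sum[OF Cons.prems(2) C(1) i C(2,3), where K = "multis C ?N" and c = ?c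
        and \<delta> = "\<lambda>\<gamma> j. bump i r \<epsilon> j + real (\<gamma> j)"]
  proof (intro sum.cong refl arg_cong2[where f = "(*)"])
    fix \<gamma> assume \<gamma>: "\<gamma> \<in> multis C ?N"
    let ?\<delta> = "\<lambda>j. bump i r \<epsilon> j + real (\<gamma> j)"
    \<comment> \<open>Lowering one of the two bumped exponents leaves the other factor behind:
      differentiation in \<open>x_i\<close> leaves \<open>x_r\<close>, and conversely.\<close>
    have e: "?\<delta>(i := ?\<delta> i - 1) = (\<lambda>j. \<epsilon> j + real (inc r \<gamma> j))" "?\<delta>(r := ?\<delta> r - 1) = (\<lambda>j. \<epsilon> j + real (inc i \<gamma> j))"
      using i by (auto simp: bump_def fun_eq_iff)
    have m: "inc r \<gamma> \<in> multis C (Suc ?N)" "inc i \<gamma> \<in> multis C (Suc ?N)"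
      unfolding inc_mem_multis_Suc[OF fC C(2)] inc_mem_multis_Suc[OF fC i(1)] by (rule \<gamma>)+
    have "?\<delta> i = \<epsilon> i + 1 + real (\<gamma> i)" "?\<delta> r = \<epsilon> r + 1 + real (\<gamma> r)" using i by (auto simp: bump_def)
    then show "?\<delta> i * wt d C (?\<delta>(i := ?\<delta> i - 1)) x - ?\<delta> r * wt d C (?\<delta>(r := ?\<delta> r - 1)) x
      = wt d C \<epsilon> x * ((\<epsilon> i + 1 + real (\<gamma> i)) * mon d (inc r \<gamma>) x - (\<epsilon> r + 1 + real (\<gamma> r)) * mon d (inc i \<gamma>) x)"
      unfolding e wt_add wt_mon[OF Cons.prems(2) C(1) m(1)] wt_mon[OF Cons.prems(2) C(1) m(2)]
      by (simp add: algebra_simps)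
  qed
  also have "\<dots> = wt d C \<epsilon> x * hp d (Suc ?N) (rod i r \<epsilon> ?c) x"
    by (subst hp_rod[OF C(1) i(1) C(2) i(2), of ?N]) (simp_all add: ker_coeffs_supp[OF c] sum_distrib_left mult.left_commute)
  finally show ?case by simp
qed

section \<open>Bases, dimensions and direct sums\<close>

text \<open>The list is reversed because \<open>fold\<close> in \<open>Rfun\<close> applies the
  smallest index first, whereas \<open>foldr\<close> starts with the last letter.\<close>

definition word :: "nat set \<Rightarrow> (nat \<Rightarrow> nat) \<Rightarrow> nat list" where
  "word A mm = concat (map (\<lambda>i. replicate (mm i) i) (rev (sorted_list_of_set A)))"

lemma set_word: "finite A \<Longrightarrow> set (word A mm) \<subseteq> A"
  by (auto simp: word_def)

lemma length_word: "finite A \<Longrightarrow> length (word A mm) = sum mm A"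
proof -
  assume "finite A"
  moreover have "length (concat (map (\<lambda>i. replicate (mm i) i) L)) = sum_list (map mm L)" for L
    by (induction L) auto
  ultimately show ?thesis
    by (simp add: word_def sum_list_distinct_conv_sum_set)
qed

lemma count_list_word:
  assumes "finite A" "\<And>i. i \<notin> A \<Longrightarrow> mm i = 0" shows "count_list (word A mm) = mm"
proof
  fix j :: nat
  have rep: "count_list (replicate n i) j = (if i = j then n else 0)" for n i
    by (induction n) auto
  have "count_list (concat (map (\<lambda>i. replicate (mm i) i) L)) j = (if j \<in> set L then mm j else 0)"
    if "distinct L" for L
    using that by (induction L) (auto simp: rep)
  then show "count_list (word A mm) j = mm j"
    using assms by (auto simp: word_def)
qed

lemma foldr_word: "finite A \<Longrightarrow> foldr F (word A mm) g = fold (\<lambda>i g. (F i ^^ mm i) g) (sorted_list_of_set A) g"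
proof -
  have "foldr F (concat (map (\<lambda>i. replicate (mm i) i) L)) g = foldr (\<lambda>i. F i ^^ mm i) L g" for L
    by (induction L) auto
  then show ?thesis by (simp add: word_def foldr_conv_fold)
qed

text \<open>Fewer than \<open>d\<close> excluded coordinates cannot cover {1..d}, so the minimum in
  \<open>rchoice\<close> is taken over a nonempty set.\<close>

lemma rchoice_props:
  assumes "S \<subseteq> {1..d+1}" "card S < d"
  shows "rchoice d S \<in> {1..d+1} - S" "d + 1 \<in> {1..d+1} - S \<longrightarrow> rchoice d S = d + 1"
    "Aset d S = {1..d+1} - S - {rchoice d S}"
proof -
  have "{1..d} - S \<noteq> {}"
  proof
    assume "{1..d} - S = {}"
    then have "card {1..d} \<le> card S" using assms(1) finite_subset by (intro card_mono) auto
    then show False using assms(2) by simp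
  qed
  then have "Min ({1..d} - S) \<in> {1..d} - S" by (intro Min_in) auto
  then show "rchoice d S \<in> {1..d+1} - S" by (auto simp: rchoice_def)
qed (auto simp: rchoice_def Aset_def)

lemma Rfun_eq:
  assumes S: "S \<subseteq> {1..d+1}" "card S < d" and mm: "mm \<in> multis (Aset d S) m" and x: "x \<in> Tint d"
  shows "Rfun d S \<epsilon> mm x = hp d m (rodw (rchoice d S) (word (Aset d S) mm) \<epsilon>) x"
proof -
  let ?r = "rchoice d S" and ?A = "Aset d S" and ?C = "{1..d+1} - S"
  note r = rchoice_props[OF S]
  let ?w = "word ?A mm"
  have fA: "finite ?A" by (simp add: Aset_def)
  have m: "sum mm ?A = m" "\<And>i. i \<notin> ?A \<Longrightarrow> mm i = 0" using mm by (auto simp: multis_def)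
  have len: "length ?w = m" using length_word[OF fA] m by simp
  have cl: "count_list ?w = mm" by (rule count_list_word[OF fA m(2)])
  have AC: "?A \<union> {?r} = ?C" "?r \<notin> ?A"
    unfolding r(3) using r(1) by blast+
  have w: "set ?w \<subseteq> ?C - {?r}" using set_word[OF fA] unfolding r(3) .
  have g: "(\<lambda>y. (\<Prod>i\<in>?A. xx d y i powr (\<epsilon> i + real (mm i))) * xx d y ?r powr (\<epsilon> ?r + real m))
     = wt d ?C (\<lambda>j. \<epsilon> j + real (count_list ?w j) + of_bool (j = ?r) * real (length ?w))"
  proof
    fix y
    have "(\<Prod>i\<in>?A. xx d y i powr (\<epsilon> i + real (mm i)))
       = (\<Prod>i\<in>?A. xx d y i powr (\<epsilon> i + real (count_list ?w i) + of_bool (i = ?r) * real (length ?w)))"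
      by (intro prod.cong refl) (use AC(2) cl in auto)
    then show "(\<Prod>i\<in>?A. xx d y i powr (\<epsilon> i + real (mm i))) * xx d y ?r powr (\<epsilon> ?r + real m)
      = wt d ?C (\<lambda>j. \<epsilon> j + real (count_list ?w j) + of_bool (j = ?r) * real (length ?w)) y"
      unfolding wt_def AC(1)[symmetric] using fA AC(2) cl len m(2)[OF AC(2)] by (simp add: mult.commute)
  qed
  have "Rfun d S \<epsilon> mm x = (\<Prod>i\<in>?A \<union> {?r}. xx d x i powr (- \<epsilon> i)) *
     fold (\<lambda>i g. (Dop d ?r i ^^ mm i) g) (sorted_list_of_set ?A)
       (\<lambda>y. (\<Prod>i\<in>?A. xx d y i powr (\<epsilon> i + real (mm i))) * xx d y ?r powr (\<epsilon> ?r + real m)) x"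
    by (simp only: Rfun_def Let_def m(1))
  also have "\<dots> = (\<Prod>i\<in>?C. xx d x i powr (- \<epsilon> i)) *
     foldr (Dop d ?r) ?w (wt d ?C (\<lambda>j. \<epsilon> j + real (count_list ?w j) + of_bool (j = ?r) * real (length ?w))) x"
    by (simp only: foldr_word[OF fA] AC(1) g)
  also have "foldr (Dop d ?r) ?w (wt d ?C (\<lambda>j. \<epsilon> j + real (count_list ?w j) + of_bool (j = ?r) * real (length ?w))) x
     = wt d ?C \<epsilon> x * hp d (length ?w) (rodw ?r ?w \<epsilon>) x"
    by (rule foldr_Dop_rodw[OF _ r(1,2) w x]) blast
  also have "(\<Prod>i\<in>?C. xx d x i powr (- \<epsilon> i)) * (wt d ?C \<epsilon> x * hp d (length ?w) (rodw ?r ?w \<epsilon>) x)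
     = (\<Prod>i\<in>?C. xx d x i powr (- \<epsilon> i) * xx d x i powr \<epsilon> i) * hp d (length ?w) (rodw ?r ?w \<epsilon>) x"
    by (simp add: wt_def prod.distrib)
  also have "(\<Prod>i\<in>?C. xx d x i powr (- \<epsilon> i) * xx d x i powr \<epsilon> i) = 1"
  proof (intro prod.neutral ballI)
    fix i assume "i \<in> ?C"
    then have "xx d x i > 0" using Tint_pos[OF x] by blast
    then show "xx d x i powr (- \<epsilon> i) * xx d x i powr \<epsilon> i = 1" by (simp add: powr_minus)
  qed
  finally show ?thesis using len by simp
qed

text \<open>At multi-indices with exponent 0 in \<open>x_r\<close> the evaluation matrix of the
  family \<open>b\<close> is diagonal with nonzero entries \<open>\<kappa>\<close>. This yields
  independence at once, and spanning through \<open>ker_coeffs_eq_zero\<close>.\<close>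

lemma ker_coeffs_basis:
  fixes \<epsilon> :: "nat \<Rightarrow> real" and N :: nat
  assumes C: "finite C" "r \<in> C" and \<epsilon>: "\<epsilon> r > -1"
  defines "b \<equiv> \<lambda>mm. rodw r (word (C - {r}) mm) \<epsilon>" and "K \<equiv> multis (C - {r}) N"
  shows "mm \<in> K \<Longrightarrow> b mm \<in> ker_coeffs C \<epsilon> N"
    and "c \<in> ker_coeffs C \<epsilon> N \<Longrightarrow> \<exists>a. c = (\<lambda>\<beta>. \<Sum>mm\<in>K. a mm * b mm \<beta>)"
    and "(\<And>\<beta>. (\<Sum>mm\<in>K. a mm * b mm \<beta>) = 0) \<Longrightarrow> mm \<in> K \<Longrightarrow> a mm = 0"
proof -
  let ?A = "C - {r}"
  have fA: "finite ?A" using C by simp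
  show 1: "b mm \<in> ker_coeffs C \<epsilon> N" if "mm \<in> K" for mm
    unfolding b_def using rodw_ker[OF C set_word[OF fA], of mm \<epsilon>] length_word[OF fA, of mm] that
    by (simp add: K_def multis_def)
  have ex: "\<forall>mm\<in>K. \<exists>\<kappa>. \<kappa> \<noteq> 0 \<and> (\<forall>\<beta>. \<beta> r = 0 \<longrightarrow> b mm \<beta> = \<kappa> * of_bool (\<beta> = mm))"
  proof
    fix mm assume mm: "mm \<in> K"
    have "r \<notin> set (word ?A mm)" using set_word[OF fA] by auto
    moreover have "count_list (word ?A mm) = mm"
      by (rule count_list_word[OF fA]) (use mm in \<open>simp add: K_def multis_def\<close>)
    ultimately show "\<exists>\<kappa>. \<kappa> \<noteq> 0 \<and> (\<forall>\<beta>. \<beta> r = 0 \<longrightarrow> b mm \<beta> = \<kappa> * of_bool (\<beta> = mm))"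
      unfolding b_def using rodw_restrict[where r = r and \<epsilon> = \<epsilon> and w = "word ?A mm", OF \<epsilon>] by (simp only: simp_thms)
  qed
  from bchoice[OF ex] obtain \<kappa> where
    \<kappa>': "\<forall>mm\<in>K. \<kappa> mm \<noteq> 0 \<and> (\<forall>\<beta>. \<beta> r = 0 \<longrightarrow> b mm \<beta> = \<kappa> mm * of_bool (\<beta> = mm))" ..
  have \<kappa>: "\<kappa> mm \<noteq> 0" "\<beta> r = 0 \<Longrightarrow> b mm \<beta> = \<kappa> mm * of_bool (\<beta> = mm)" if "mm \<in> K" for mm \<beta>
    using bspec[OF \<kappa>' that] by (simp_all only: simp_thms)
  have ev: "(\<Sum>mm\<in>K. a mm * b mm \<beta>) = a \<beta> * \<kappa> \<beta>" if \<beta>: "\<beta> \<in> K" for a :: "(nat \<Rightarrow> nat) \<Rightarrow> real" and \<beta>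
  proof -
    have r0: "\<beta> r = 0" using \<beta> by (simp add: K_def multis_def)
    have "(\<Sum>mm\<in>K. a mm * b mm \<beta>) = (\<Sum>mm\<in>K. if mm = \<beta> then a mm * \<kappa> mm else 0)"
    proof (intro sum.cong refl)
      fix mm assume "mm \<in> K"
      then show "a mm * b mm \<beta> = (if mm = \<beta> then a mm * \<kappa> mm else 0)"
        using \<kappa>(2)[of mm \<beta>, OF _ r0] by (cases "mm = \<beta>") simp_all
    qed
    then show ?thesis using \<beta> fA by (simp add: K_def sum.delta)
  qed
  show "a mm = 0" if "\<And>\<beta>. (\<Sum>mm\<in>K. a mm * b mm \<beta>) = 0" "mm \<in> K" for mm
    using ev[OF that(2), of a] that \<kappa>(1) by simp
  show "\<exists>a. c = (\<lambda>\<beta>. \<Sum>mm\<in>K. a mm * b mm \<beta>)" if c: "c \<in> ker_coeffs C \<epsilon> N"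
  proof
    \<comment> \<open>Chosen so that \<open>c\<close> and the combination agree at exponent 0 in
      \<open>x_r\<close>. Their difference is written as a sum over two truth values so that
      \<open>ker_coeffs_sum\<close> applies.\<close>
    let ?a = "\<lambda>mm. c mm / \<kappa> mm"
    have "(\<lambda>\<beta>. \<Sum>t\<in>{True, False}. (if t then 1 else -1) * (if t then c else (\<lambda>\<beta>. \<Sum>mm\<in>K. ?a mm * b mm \<beta>)) \<beta>) \<in> ker_coeffs C \<epsilon> N"
    proof (rule ker_coeffs_sum)
      fix t :: bool
      show "(if t then c else (\<lambda>\<beta>. \<Sum>mm\<in>K. ?a mm * b mm \<beta>)) \<in> ker_coeffs C \<epsilon> N"
        using c ker_coeffs_sum[of K b C \<epsilon> N ?a, OF 1] by simp
    qed
    then have dh: "(\<lambda>\<beta>. c \<beta> - (\<Sum>mm\<in>K. ?a mm * b mm \<beta>)) \<in> ker_coeffs C \<epsilon> N" by simp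
    have "(\<lambda>\<beta>. c \<beta> - (\<Sum>mm\<in>K. ?a mm * b mm \<beta>)) = (\<lambda>_. 0)"
    proof (rule ker_coeffs_eq_zero[OF C \<epsilon> dh])
      fix \<beta> assume "\<beta> \<in> multis C N" "\<beta> r = 0"
      then have "\<beta> \<in> K" using C by (auto simp: K_def multis_def sum.remove)
      then show "c \<beta> - (\<Sum>mm\<in>K. ?a mm * b mm \<beta>) = 0" using ev[of \<beta> ?a] \<kappa>(1) by simp
    qed
    from fun_cong[OF this] show "c = (\<lambda>\<beta>. \<Sum>mm\<in>K. ?a mm * b mm \<beta>)"
      by (rule ext[OF eq_iff_diff_eq_0[THEN iffD2]])
  qed
qed

text \<open>Membership in \<open>Hsp\<close> prescribes values only on the open simplex; with
  \<open>polyfun\<close> they determine the polynomial everywhere, so the face space is exactly a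
  kernel of forms in the variables outside \<open>S\<close>.\<close>

lemma Hsp_eq:
  assumes S: "S \<subseteq> {1..d+1}" "card S < d" and \<epsilon>: "\<And>i. i \<in> {1..d+1} - S \<Longrightarrow> \<epsilon> i > -1"
  shows "Hsp d (int N) S \<epsilon> = hp d N ` ker_coeffs ({1..d+1} - S) \<epsilon> N"
proof -
  let ?r = "rchoice d S" and ?A = "Aset d S" and ?C = "{1..d+1} - S"
  let ?b = "\<lambda>mm. rodw ?r (word ?A mm) \<epsilon>"
  note r = rchoice_props[OF S]
  have H: "Hsp d (int N) S \<epsilon> = {p. polyfun d p \<and> (\<exists>c. \<forall>x\<in>Tint d. p x = (\<Sum>mm\<in>multis ?A N. c mm * hp d N (?b mm) x))}"
    unfolding Hsp_def using S(2) Rfun_eq[OF S] by (simp cong: conj_cong)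
  have fC: "finite ?C" by simp
  note rC = r(1)
  note basis = ker_coeffs_basis[OF fC rC, where \<epsilon> = \<epsilon> and N = N, folded r(3)]
  show ?thesis unfolding H
  proof (intro equalityI subsetI)
    fix p assume "p \<in> {p. polyfun d p \<and> (\<exists>c. \<forall>x\<in>Tint d. p x = (\<Sum>mm\<in>multis ?A N. c mm * hp d N (?b mm) x))}"
    then obtain c M where p: "poly_le d M p" "\<And>x. x \<in> Tint d \<Longrightarrow> p x = (\<Sum>mm\<in>multis ?A N. c mm * hp d N (?b mm) x)"
      by (auto simp: polyfun_def)
    have "p = hp d N (\<lambda>\<alpha>. \<Sum>mm\<in>multis ?A N. c mm * ?b mm \<alpha>)"
      by (rule poly_le_Tint_eq[OF p(1) poly_le_hp]) (simp add: p(2) hp_sum[symmetric])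
    moreover have "(\<lambda>\<alpha>. \<Sum>mm\<in>multis ?A N. c mm * ?b mm \<alpha>) \<in> ker_coeffs ?C \<epsilon> N"
      by (rule ker_coeffs_sum) (use basis(1) \<epsilon> rC in auto)
    ultimately show "p \<in> hp d N ` ker_coeffs ?C \<epsilon> N" by blast
  next
    fix p assume "p \<in> hp d N ` ker_coeffs ?C \<epsilon> N"
    then obtain c where c: "c \<in> ker_coeffs ?C \<epsilon> N" "p = hp d N c" by blast
    then obtain a where a: "c = (\<lambda>\<beta>. \<Sum>mm\<in>multis ?A N. a mm * ?b mm \<beta>)"
      using basis(2) \<epsilon> rC by blast
    have "p = (\<lambda>x. \<Sum>mm\<in>multis ?A N. a mm * hp d N (?b mm) x)"
      unfolding c(2) a hp_sum ..
    then show "p \<in> {p. polyfun d p \<and> (\<exists>c. \<forall>x\<in>Tint d. p x = (\<Sum>mm\<in>multis ?A N. c mm * hp d N (?b mm) x))}"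
      using poly_le_hp[of d N c] c(2) unfolding polyfun_def mem_Collect_eq
      by (intro conjI exI[of _ N] exI[of _ a]) simp_all
  qed
qed

section \<open>Dimension of sums and of multiplied kernels\<close>

lemma has_dimI:
  assumes K: "finite K" and "\<And>k. k \<in> K \<Longrightarrow> b k \<in> P"
    and ind: "\<And>a k. (\<lambda>x. \<Sum>k\<in>K. a k * b k x) = (\<lambda>x. 0) \<Longrightarrow> k \<in> K \<Longrightarrow> a k = 0"
    and P: "P = {(\<lambda>x. \<Sum>k\<in>K. a k * b k x) | a. True}"
  shows "has_dim P (card K)"
proof -
  obtain h where h: "bij_betw h {..<card K} K"
    using ex_bij_betw_nat_finite[OF K] by (auto simp: lessThan_atLeast0)
  define g where "g = the_inv_into {..<card K} h"
  have gh: "g (h i) = i" if "i < card K" for i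
    using h that by (auto simp: g_def bij_betw_def intro: the_inv_into_f_f)
  have re: "(\<lambda>x. \<Sum>i<card K. a i * b (h i) x) = (\<lambda>x. \<Sum>k\<in>K. a (g k) * b k x)" for a
  proof
    fix x
    have "(\<Sum>k\<in>K. a (g k) * b k x) = (\<Sum>i<card K. a (g (h i)) * b (h i) x)"
      using sum.reindex_bij_betw[OF h, of "\<lambda>k. a (g k) * b k x"] by simp
    then show "(\<Sum>i<card K. a i * b (h i) x) = (\<Sum>k\<in>K. a (g k) * b k x)"
      by (simp add: gh)
  qed
  have re': "(\<lambda>x. \<Sum>k\<in>K. a k * b k x) = (\<lambda>x. \<Sum>i<card K. a (h i) * b (h i) x)" for a
    using sum.reindex_bij_betw[OF h, symmetric] by (intro ext)
  have hK: "h i \<in> K" if "i < card K" for i using h that by (auto simp: bij_betw_def)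
  show ?thesis unfolding has_dim_def
  proof (intro exI[of _ "\<lambda>i. b (h i)"] conjI allI impI)
    fix i assume "i < card K" then show "b (h i) \<in> P" using assms(2) hK by blast
  next
    fix a i assume a: "(\<lambda>x. \<Sum>i<card K. a i * b (h i) x) = (\<lambda>x. 0)" and i: "i < card K"
    from ind[OF a[unfolded re] hK[OF i]] show "a i = 0" using gh[OF i] by simp
  next
    show "P = {\<lambda>x. \<Sum>i<card K. a i * b (h i) x | a. True}"
    proof (intro equalityI subsetI)
      fix f assume "f \<in> P"
      then obtain a where "f = (\<lambda>x. \<Sum>k\<in>K. a k * b k x)" unfolding P by blast
      then show "f \<in> {\<lambda>x. \<Sum>i<card K. a i * b (h i) x | a. True}"
        unfolding re' by (intro CollectI exI[of _ "\<lambda>i. a (h i)"]) simp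
    next
      fix f assume "f \<in> {\<lambda>x. \<Sum>i<card K. a i * b (h i) x | a. True}"
      then obtain a where "f = (\<lambda>x. \<Sum>i<card K. a i * b (h i) x)" by blast
      then show "f \<in> P"
        unfolding re P by (intro CollectI exI[of _ "\<lambda>k. a (g k)"]) simp
    qed
  qed
qed

lemma has_dim_zero: "has_dim {\<lambda>x. 0} 0"
  unfolding has_dim_def by (rule exI[of _ "\<lambda>_ _. 0"]) simp

lemma has_dim_sum_sp:
  assumes I: "finite I" and dim: "\<And>J. J \<in> I \<Longrightarrow> has_dim (U J) (N J)" and dir: "direct_sp I U"
  shows "has_dim (sum_sp I U) (\<Sum>J\<in>I. N J)"
proof -
  have "\<forall>J\<in>I. \<exists>b. (\<forall>i<N J. b i \<in> U J) \<and>
      (\<forall>a. (\<lambda>x. \<Sum>i<N J. a i * b i x) = (\<lambda>x. 0) \<longrightarrow> (\<forall>i<N J. a i = 0)) \<and>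
      U J = {(\<lambda>x. \<Sum>i<N J. a i * b i x) | a. True}"
    using dim unfolding has_dim_def by blast
  then obtain b where b: "\<And>J i. J \<in> I \<Longrightarrow> i < N J \<Longrightarrow> b J i \<in> U J"
      "\<And>J a i. J \<in> I \<Longrightarrow> (\<lambda>x. \<Sum>i<N J. a i * b J i x) = (\<lambda>x. 0) \<Longrightarrow> i < N J \<Longrightarrow> a i = 0"
      "\<And>J. J \<in> I \<Longrightarrow> U J = {(\<lambda>x. \<Sum>i<N J. a i * b J i x) | a. True}"
    unfolding bchoice_iff by blast
  define K where "K = (SIGMA J:I. {..<N J})"
  have fK: "finite K" using I by (simp add: K_def)
  have cK: "card K = (\<Sum>J\<in>I. N J)" using I by (simp add: K_def)
  have dbl: "(\<Sum>k\<in>K. a k * b (fst k) (snd k) x) = (\<Sum>J\<in>I. \<Sum>i<N J. a (J, i) * b J i x)" for a x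
    unfolding K_def using I by (subst sum.Sigma) (auto simp: case_prod_beta)
  have inU: "(\<lambda>x. \<Sum>i<N J. a i * b J i x) \<in> U J" if "J \<in> I" for a J
    using b(3)[OF that] by blast
  have "has_dim (sum_sp I U) (card K)"
  proof (rule has_dimI[OF fK, of "\<lambda>k. b (fst k) (snd k)"])
    fix k assume k: "k \<in> K"
    obtain J i where J: "k = (J, i)" "J \<in> I" "i < N J" using k by (auto simp: K_def)
    let ?f = "\<lambda>J'. if J' = J then b J i else (\<lambda>x. 0)"
    have "?f J' \<in> U J'" if "J' \<in> I" for J'
      using b(1)[OF J(2,3)] inU[OF that, of "\<lambda>_. 0"] by simp
    moreover have "b (fst k) (snd k) = (\<lambda>x. \<Sum>J'\<in>I. ?f J' x)"
      using J I by (simp add: fun_eq_iff if_distrib[of "\<lambda>f. f _"] sum.delta)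
    ultimately show "b (fst k) (snd k) \<in> sum_sp I U"
      unfolding sum_sp_def mem_Collect_eq by (intro exI[of _ ?f] conjI ballI)
  next
    fix a k assume a: "(\<lambda>x. \<Sum>k\<in>K. a k * b (fst k) (snd k) x) = (\<lambda>x. 0)" and k: "k \<in> K"
    obtain J i where J: "k = (J, i)" "J \<in> I" "i < N J" using k by (auto simp: K_def)
    let ?f = "\<lambda>J x. \<Sum>i<N J. a (J, i) * b J i x"
    have "\<forall>J\<in>I. ?f J \<in> U J" by (intro ballI inU)
    moreover have "(\<lambda>x. \<Sum>J\<in>I. ?f J x) = (\<lambda>x. 0)" using a unfolding dbl .
    ultimately have "?f J = (\<lambda>x. 0)" using dir[unfolded direct_sp_def, THEN spec, of ?f] J(2) by blast
    then show "a k = 0" using b(2)[OF J(2) _ J(3), of "\<lambda>i. a (J, i)"] J(1) by simp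
  next
    show "sum_sp I U = {\<lambda>x. \<Sum>k\<in>K. a k * b (fst k) (snd k) x | a. True}"
    proof (intro equalityI subsetI)
      fix g assume "g \<in> sum_sp I U"
      then obtain f where f: "g = (\<lambda>x. \<Sum>J\<in>I. f J x)" "\<And>J. J \<in> I \<Longrightarrow> f J \<in> U J"
        by (auto simp: sum_sp_def)
      have "\<forall>J\<in>I. \<exists>a. f J = (\<lambda>x. \<Sum>i<N J. a i * b J i x)" using f(2) b(3) by blast
      then obtain a where a: "\<And>J. J \<in> I \<Longrightarrow> f J = (\<lambda>x. \<Sum>i<N J. a J i * b J i x)"
        unfolding bchoice_iff by blast
      have "g = (\<lambda>x. \<Sum>k\<in>K. a (fst k) (snd k) * b (fst k) (snd k) x)"
        unfolding dbl f(1) using a by simp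
      then show "g \<in> {\<lambda>x. \<Sum>k\<in>K. a k * b (fst k) (snd k) x | a. True}"
        by (intro CollectI exI[of _ "\<lambda>k. a (fst k) (snd k)"]) simp
    next
      fix g assume "g \<in> {\<lambda>x. \<Sum>k\<in>K. a k * b (fst k) (snd k) x | a. True}"
      then obtain a where a: "g = (\<lambda>x. \<Sum>k\<in>K. a k * b (fst k) (snd k) x)" by blast
      have "\<forall>J\<in>I. (\<lambda>x. \<Sum>i<N J. a (J, i) * b J i x) \<in> U J"
        by (intro ballI inU)
      then show "g \<in> sum_sp I U" unfolding a dbl sum_sp_def
        by (intro CollectI exI[of _ "\<lambda>J x. \<Sum>i<N J. a (J, i) * b J i x"]) simp
    qed
  qed
  then show ?thesis by (simp add: cK)
qed

lemma xprod_pos: "x \<in> Tint d \<Longrightarrow> J \<subseteq> {1..d+1} \<Longrightarrow> xprod d J x > 0"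
  unfolding xprod_def by (intro prod_pos) (use Tint_pos in blast)

text \<open>Multiplication by \<open>xprod d J\<close> is injective on polynomials, since this
  product is positive on the open simplex. The basis is indexed by the multi-indices of degree
  \<open>m\<close> in the variables of \<open>C\<close> other than \<open>r\<close>.\<close>

lemma has_dim_times_ker:
  assumes C: "C \<subseteq> {1..d+1}" "r \<in> C" and J: "J \<subseteq> {1..d+1}" and \<epsilon>: "\<epsilon> r > -1"
  shows "has_dim (times_sp d J (hp d m ` ker_coeffs C \<epsilon> m)) ((m + (card C - 1) - 1) choose m)"
proof -
  have fC: "finite C" using C finite_subset by blast
  let ?K = "multis (C - {r}) m" and ?b = "\<lambda>mm. rodw r (word (C - {r}) mm) \<epsilon>"
  note basis = ker_coeffs_basis[OF fC C(2), where \<epsilon> = \<epsilon> and N = m, OF \<epsilon>]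
  have sum: "(\<lambda>x. \<Sum>k\<in>?K. a k * (xprod d J x * hp d m (?b k) x))
     = (\<lambda>x. xprod d J x * hp d m (\<lambda>\<beta>. \<Sum>k\<in>?K. a k * ?b k \<beta>) x)" for a
    unfolding hp_sum[symmetric] by (simp add: sum_distrib_left mult.left_commute)
  have "has_dim (times_sp d J (hp d m ` ker_coeffs C \<epsilon> m)) (card ?K)"
  proof (rule has_dimI[where K = ?K and b = "\<lambda>k x. xprod d J x * hp d m (?b k) x"])
    show "finite ?K" using fC by simp
    show "(\<lambda>x. xprod d J x * hp d m (?b k) x) \<in> times_sp d J (hp d m ` ker_coeffs C \<epsilon> m)" if "k \<in> ?K" for k
      using basis(1)[OF that] by (auto simp: times_sp_def)
    show "a k = 0" if z: "(\<lambda>x. \<Sum>k\<in>?K. a k * (xprod d J x * hp d m (?b k) x)) = (\<lambda>x. 0)" and "k \<in> ?K" for a k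
    proof (rule basis(3)[OF _ \<open>k \<in> ?K\<close>])
      fix \<beta>
      have h: "(\<lambda>\<beta>. \<Sum>k\<in>?K. a k * ?b k \<beta>) \<in> ker_coeffs C \<epsilon> m" by (rule ker_coeffs_sum[OF basis(1)])
      have "hp d m (\<lambda>\<beta>. \<Sum>k\<in>?K. a k * ?b k \<beta>) x = 0" if "x \<in> Tint d" for x
        using fun_cong[OF z[unfolded sum], of x] xprod_pos[OF that J] by simp
      from hp_zero_Tint[OF this] show "(\<Sum>k\<in>?K. a k * ?b k \<beta>) = 0"
        using ker_coeffs_supp[OF h, of \<beta>] multis_mono[OF C(1), of m] by auto
    qed
    show "times_sp d J (hp d m ` ker_coeffs C \<epsilon> m) = {\<lambda>x. \<Sum>k\<in>?K. a k * (xprod d J x * hp d m (?b k) x) | a. True}"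
      unfolding sum
    proof (intro equalityI subsetI)
      fix f assume "f \<in> times_sp d J (hp d m ` ker_coeffs C \<epsilon> m)"
      then obtain c where c: "c \<in> ker_coeffs C \<epsilon> m" "f = (\<lambda>x. xprod d J x * hp d m c x)"
        by (auto simp: times_sp_def)
      then show "f \<in> {\<lambda>x. xprod d J x * hp d m (\<lambda>\<beta>. \<Sum>k\<in>?K. a k * ?b k \<beta>) x | a. True}"
        using basis(2)[OF c(1)] by blast
    next
      fix f assume "f \<in> {\<lambda>x. xprod d J x * hp d m (\<lambda>\<beta>. \<Sum>k\<in>?K. a k * ?b k \<beta>) x | a. True}"
      then obtain a where "f = (\<lambda>x. xprod d J x * hp d m (\<lambda>\<beta>. \<Sum>k\<in>?K. a k * ?b k \<beta>) x)" by blast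
      moreover have "(\<lambda>\<beta>. \<Sum>k\<in>?K. a k * ?b k \<beta>) \<in> ker_coeffs C \<epsilon> m" by (rule ker_coeffs_sum[OF basis(1)])
      ultimately show "f \<in> times_sp d J (hp d m ` ker_coeffs C \<epsilon> m)"
        unfolding times_sp_def by blast
    qed
  qed
  moreover have "card ?K = (m + (card C - 1) - 1) choose m"
    using fC C(2) by (simp add: card_multis)
  ultimately show ?thesis by simp
qed

text \<open>Records which variables can occur: all of \<open>J\<close> and none outside
  \<open>C\<close>. With \<open>C\<close> the complement of \<open>B - J\<close>, this recovers
  \<open>J\<close> from any monomial present.\<close>

lemma times_ker_hp:
  assumes J: "J \<subseteq> C" "C \<subseteq> {1..d+1}" and c: "c \<in> ker_coeffs C \<epsilon> m"
  shows "\<exists>e. (\<lambda>x. xprod d J x * hp d m c x) = hp d (m + card J) e \<and>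
    (\<forall>\<alpha>. e \<alpha> \<noteq> 0 \<longrightarrow> (\<forall>i\<in>J. \<alpha> i > 0) \<and> (\<forall>i\<in>-C. \<alpha> i = 0))"
proof -
  let ?K = "multis C m" and ?e = "\<lambda>\<gamma> \<alpha>. of_bool (\<alpha> = addJ J \<gamma>)"
  have fC: "finite C" using J finite_subset by blast
  have JD: "J \<subseteq> {1..d+1}" using J by auto
  have "(\<lambda>x. xprod d J x * hp d m c x) = (\<lambda>x. \<Sum>\<gamma>\<in>?K. c \<gamma> * hp d (m + card J) (?e \<gamma>) x)"
  proof
    fix x
    have "(\<Sum>\<gamma>\<in>?K. c \<gamma> * hp d (m + card J) (?e \<gamma>) x) = (\<Sum>\<gamma>\<in>?K. c \<gamma> * mon d (addJ J \<gamma>) x)"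
      by (intro sum.cong refl arg_cong2[where f = "(*)"] fun_cong[OF hp_single] addJ_multis)
        (use J JD in auto)
    then show "xprod d J x * hp d m c x = (\<Sum>\<gamma>\<in>?K. c \<gamma> * hp d (m + card J) (?e \<gamma>) x)"
      using hp_restrict[OF J(2), of m c x] ker_coeffs_supp[OF c]
      by (simp add: mon_addJ[OF JD] sum_distrib_left mult.left_commute)
  qed
  also have "\<dots> = hp d (m + card J) (\<lambda>\<alpha>. \<Sum>\<gamma>\<in>?K. c \<gamma> * ?e \<gamma> \<alpha>)" by (rule hp_sum)
  finally have 1: "(\<lambda>x. xprod d J x * hp d m c x) = hp d (m + card J) (\<lambda>\<alpha>. \<Sum>\<gamma>\<in>?K. c \<gamma> * ?e \<gamma> \<alpha>)" .
  have "(\<forall>i\<in>J. \<alpha> i > 0) \<and> (\<forall>i\<in>-C. \<alpha> i = 0)" if nz: "(\<Sum>\<gamma>\<in>?K. c \<gamma> * ?e \<gamma> \<alpha>) \<noteq> 0" for \<alpha>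
  proof -
    obtain \<gamma> where \<gamma>: "\<gamma> \<in> ?K" "c \<gamma> * ?e \<gamma> \<alpha> \<noteq> 0"
      using nz by (rule sum.not_neutral_contains_not_neutral)
    then have "\<alpha> = addJ J \<gamma>" by (cases "\<alpha> = addJ J \<gamma>") auto
    with \<gamma>(1) show ?thesis using J by (auto simp: addJ_def multis_def)
  qed
  with 1 show ?thesis by blast
qed

text \<open>\<open>Lop\<close> is built from \<open>deriv\<close>, so additivity is not formal; on
  forms it follows from the explicit formula, which is linear in the coefficients.\<close>

lemma Lop_hp_sum:
  "Lop d \<epsilon> (\<lambda>x. \<Sum>k\<in>K. hp d N (c k) x) x = (\<Sum>k\<in>K. Lop d \<epsilon> (hp d N (c k)) x)"
proof -
  define \<Phi> where "\<Phi> \<alpha> = (\<Sum>i=1..d+1. real (\<alpha> i) * (real (\<alpha> i) + \<epsilon> i) * mon d (dec i \<alpha>) x)" for \<alpha>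
  define l where "l = real N * (real N + (\<Sum>l=1..d+1. \<epsilon> l) + real d)"
  have L: "Lop d \<epsilon> (hp d N c) x = (\<Sum>\<alpha>\<in>multis {1..d+1} N. c \<alpha> * (\<Phi> \<alpha> - l * mon d \<alpha> x))" for c
    unfolding hp_def[abs_def] sum_combine2 \<Phi>_def l_def by (rule Lop_mon_sum) auto
  have "(\<lambda>x. \<Sum>k\<in>K. hp d N (c k) x) = hp d N (\<lambda>\<alpha>. \<Sum>k\<in>K. 1 * c k \<alpha>)"
    unfolding hp_sum[symmetric] by simp
  then have "Lop d \<epsilon> (\<lambda>x. \<Sum>k\<in>K. hp d N (c k) x) x
     = (\<Sum>\<alpha>\<in>multis {1..d+1} N. (\<Sum>k\<in>K. 1 * c k \<alpha>) * (\<Phi> \<alpha> - l * mon d \<alpha> x))"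
    by (simp only: L)
  also have "\<dots> = (\<Sum>k\<in>K. \<Sum>\<alpha>\<in>multis {1..d+1} N. c k \<alpha> * (\<Phi> \<alpha> - l * mon d \<alpha> x))"
    unfolding sum_distrib_right mult_1 by (rule sum.swap)
  finally show ?thesis by (simp only: L)
qed

section \<open>Dirichlet integrals\<close>

text \<open>The truncated power makes the indicator of the simplex part of the integrand, so that
  integrating out one variable is a convolution. At 0 the value is 0 for every \<open>e\<close>, as
  \<open>powr\<close> has it.\<close>

definition gpow :: "real \<Rightarrow> real \<Rightarrow> real" where
  "gpow e t = indicator {0..} t * t powr e"

lemma gpow_nonneg [simp]: "gpow e t \<ge> 0"
  by (simp add: gpow_def)

lemma gpow_measurable [measurable]: "gpow e \<in> borel_measurable borel"
  unfolding gpow_def by measurable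

text \<open>A convolution of two powers: for \<open>u > 0\<close> the substitution y = u t splits
  off a power of \<open>u\<close> and leaves Euler's Beta integral.\<close>

lemma nn_integral_gpow_beta:
  assumes "a > -1" "b > -1"
  shows "(\<integral>\<^sup>+y. ennreal (gpow a y * gpow b (u - y)) \<partial>lborel)
    = ennreal (Beta (a + 1) (b + 1) * gpow (a + b + 1) u)"
proof -
  consider "u < 0" | "u = 0" | "u > 0" by linarith
  then show ?thesis
  proof cases
    case 1
    then have z: "gpow a y * gpow b (u - y) = 0" for y by (auto simp: gpow_def indicator_def)
    show ?thesis unfolding z using 1 by (simp add: gpow_def)
  next
    case 2
    then have z: "gpow a y * gpow b (u - y) = 0" for y by (auto simp: gpow_def indicator_def)
    show ?thesis unfolding z using 2 by (simp add: gpow_def)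
  next
    case 3
    have sc: "gpow e (u * t) = u powr e * gpow e t" for e t
      using 3 by (auto simp: gpow_def powr_mult zero_le_mult_iff indicator_def)
    have "(\<integral>\<^sup>+y. ennreal (gpow a y * gpow b (u - y)) \<partial>lborel)
       = \<bar>u\<bar> * (\<integral>\<^sup>+y. ennreal (gpow a (0 + u * y) * gpow b (u - (0 + u * y))) \<partial>lborel)"
      by (rule nn_integral_real_affine) (use 3 in \<open>measurable, auto\<close>)
    also have "(\<lambda>y. ennreal (gpow a (0 + u * y) * gpow b (u - (0 + u * y))))
       = (\<lambda>y. ennreal (u powr (a + b)) * ennreal (gpow a y * gpow b (1 - y)))"
    proof
      fix y
      have "u - (0 + u * y) = u * (1 - y)" by (simp add: algebra_simps)
      then show "ennreal (gpow a (0 + u * y) * gpow b (u - (0 + u * y)))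
        = ennreal (u powr (a + b)) * ennreal (gpow a y * gpow b (1 - y))"
        by (simp add: sc powr_add ennreal_mult[symmetric] mult_ac)
    qed
    also have "(\<integral>\<^sup>+y. ennreal (u powr (a + b)) * ennreal (gpow a y * gpow b (1 - y)) \<partial>lborel)
       = ennreal (u powr (a + b)) * (\<integral>\<^sup>+y. ennreal (gpow a y * gpow b (1 - y)) \<partial>lborel)"
      by (rule nn_integral_cmult) measurable
    also have "(\<integral>\<^sup>+y. ennreal (gpow a y * gpow b (1 - y)) \<partial>lborel)
       = (\<integral>\<^sup>+y. ennreal (y powr a * (1 - y) powr b) * indicator {0..1} y \<partial>lborel)"
      by (intro nn_integral_cong) (auto simp: gpow_def indicator_def)
    also have "\<dots> = ennreal (Beta (a + 1) (b + 1))"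
      by (rule nn_integral_has_integral_lebesgue')
        (use has_integral_Beta_real[of "a + 1" "b + 1"] assms in auto)
    also have "ennreal \<bar>u\<bar> * (ennreal (u powr (a + b)) * ennreal (Beta (a + 1) (b + 1)))
       = ennreal (\<bar>u\<bar> * (u powr (a + b) * Beta (a + 1) (b + 1)))"
      using assms 3 by (simp add: ennreal_mult' Beta_def Gamma_real_nonneg flip: ennreal_mult)
    also have "\<bar>u\<bar> * (u powr (a + b) * Beta (a + 1) (b + 1)) = Beta (a + 1) (b + 1) * gpow (a + b + 1) u"
      using 3 by (simp add: gpow_def powr_add)
    finally show ?thesis .
  qed
qed

abbreviation lebd :: "nat \<Rightarrow> pt measure" where
  "lebd d \<equiv> PiM {1..d} (\<lambda>_. lborel)"

lemma xx_measurable: "i \<in> {1..d+1} \<Longrightarrow> (\<lambda>x. xx d x i) \<in> borel_measurable (lebd d)"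
proof -
  assume i: "i \<in> {1..d+1}"
  have comp: "(\<lambda>x. x j) \<in> borel_measurable (lebd d)" if "j \<in> {1..d}" for j
    using measurable_component_singleton[OF that, of "\<lambda>_. lborel"] by simp
  show ?thesis
  proof (cases "i = d + 1")
    case True
    have "(\<lambda>x. 1 - (\<Sum>j=1..d. x j)) \<in> borel_measurable (lebd d)"
      by (intro borel_measurable_diff borel_measurable_const borel_measurable_sum comp)
    then show ?thesis using True by (simp add: xx_def)
  next
    case False
    then show ?thesis using comp[of i] i by (simp add: xx_def)
  qed
qed

lemma prod_gpow_measurable:
  "(\<lambda>x. \<Prod>i=1..d+1. gpow (\<epsilon> i) (xx d x i)) \<in> borel_measurable (lebd d)"
  by (intro borel_measurable_prod measurable_compose[OF xx_measurable gpow_measurable])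

text \<open>Induction on the dimension. Integrating out the last variable merges the two last
  exponents, and the Beta factor is the quotient of Gamma values needed to pass between the two
  Dirichlet formulas.\<close>

lemma nn_integral_dirichlet:
  assumes "\<And>i. i \<in> {1..d+1} \<Longrightarrow> \<epsilon> i > -1"
  shows "(\<integral>\<^sup>+x. ennreal (\<Prod>i=1..d+1. gpow (\<epsilon> i) (xx d x i)) \<partial>lebd d)
    = ennreal ((\<Prod>i=1..d+1. Gamma (\<epsilon> i + 1)) / Gamma (\<Sum>i=1..d+1. \<epsilon> i + 1))"
  using assms
proof (induction d arbitrary: \<epsilon>)
  case 0
  \<comment> \<open>In dimension 0 the only barycentric coordinate is constantly 1 and the measure
    is a point mass.\<close>
  have "Gamma (\<epsilon> 1 + 1) > 0" using 0[of 1] by (intro Gamma_real_pos) auto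
  then show ?case by (simp add: PiM_empty nn_integral_count_space_finite xx_def gpow_def)
next
  case (Suc d)
  interpret product_sigma_finite "\<lambda>_::nat. lborel :: real measure"
    by standard
  let ?a = "\<epsilon> (d+1)" and ?b = "\<epsilon> (d+2)"
  have ab: "?a > -1" "?b > -1" using Suc.prems by auto
  \<comment> \<open>The exponent \<open>?a + ?b + 1\<close> is that of the convolution of the two
    last powers.\<close>
  define \<epsilon>' where "\<epsilon>' = \<epsilon>(d+1 := ?a + ?b + 1)"
  define P where "P x = (\<Prod>i=1..d. gpow (\<epsilon> i) (x i))" for x :: pt
  have P0: "P x \<ge> 0" for x by (simp add: P_def prod_nonneg)
  have split: "(\<Prod>i=1..Suc d+1. gpow (\<epsilon> i) (xx (Suc d) (x(Suc d := y)) i))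
     = P x * (gpow ?a y * gpow ?b (xx d x (d+1) - y))" for x y
  proof -
    have "(\<Sum>j=1..d. (x(Suc d := y)) j) = (\<Sum>j=1..d. x j)" by (rule sum.cong) auto
    then have u: "xx (Suc d) (x(Suc d := y)) (d+2) = xx d x (d+1) - y" by (simp add: xx_def)
    have "(\<Prod>i=1..d. gpow (\<epsilon> i) (xx (Suc d) (x(Suc d := y)) i)) = P x"
      unfolding P_def by (rule prod.cong) (auto simp: xx_def)
    moreover have "xx (Suc d) (x(Suc d := y)) (d+1) = y" by (simp add: xx_def)
    ultimately show ?thesis using u by (simp add: mult.assoc)
  qed
  have P': "(\<Prod>i=1..d+1. gpow (\<epsilon>' i) (xx d x i)) = P x * gpow (?a + ?b + 1) (xx d x (d+1))" for x
  proof -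
    have "(\<Prod>i=1..d. gpow (\<epsilon>' i) (xx d x i)) = P x"
      unfolding P_def by (rule prod.cong) (auto simp: xx_def \<epsilon>'_def)
    then show ?thesis by (simp add: \<epsilon>'_def)
  qed
  have e1: "- 1 < \<epsilon> (Suc d) + \<epsilon> (Suc (Suc d)) + 1" using ab by simp
  have ins: "{1..Suc d} = insert (Suc d) {1..d}" by auto
  let ?f = "\<lambda>x. ennreal (\<Prod>i=1..Suc d+1. gpow (\<epsilon> i) (xx (Suc d) x i))"
  have meas: "?f \<in> borel_measurable (PiM (insert (Suc d) {1..d}) (\<lambda>_. lborel))"
    unfolding ins[symmetric]
    by (rule measurable_compose[OF prod_gpow_measurable[of \<epsilon> "Suc d"] measurable_ennreal])
  have "(\<integral>\<^sup>+x. ?f x \<partial>lebd (Suc d)) = (\<integral>\<^sup>+x. (\<integral>\<^sup>+y. ?f (x(Suc d := y)) \<partial>lborel) \<partial>lebd d)"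
    unfolding ins by (rule product_nn_integral_insert[OF _ _ meas]) simp_all
  also have "\<dots> = (\<integral>\<^sup>+x. ennreal (Beta (?a + 1) (?b + 1)) * ennreal (\<Prod>i=1..d+1. gpow (\<epsilon>' i) (xx d x i)) \<partial>lebd d)"
  proof (rule nn_integral_cong)
    fix x :: pt
    have "(\<integral>\<^sup>+y. ?f (x(Suc d := y)) \<partial>lborel)
       = (\<integral>\<^sup>+y. ennreal (P x) * ennreal (gpow ?a y * gpow ?b (xx d x (d+1) - y)) \<partial>lborel)"
      unfolding split by (intro nn_integral_cong ennreal_mult P0) simp
    also have "\<dots> = ennreal (P x) * (\<integral>\<^sup>+y. ennreal (gpow ?a y * gpow ?b (xx d x (d+1) - y)) \<partial>lborel)"
      by (rule nn_integral_cmult) measurable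
    also have "(\<integral>\<^sup>+y. ennreal (gpow ?a y * gpow ?b (xx d x (d+1) - y)) \<partial>lborel)
       = ennreal (Beta (?a + 1) (?b + 1) * gpow (?a + ?b + 1) (xx d x (d+1)))"
      by (rule nn_integral_gpow_beta[OF ab])
    also have "ennreal (P x) * \<dots> = ennreal (Beta (?a + 1) (?b + 1)) * ennreal (\<Prod>i=1..d+1. gpow (\<epsilon>' i) (xx d x i))"
      unfolding P' using ab P0 by (simp add: Beta_def Gamma_real_nonneg mult_ac flip: ennreal_mult)
    finally show "(\<integral>\<^sup>+y. ?f (x(Suc d := y)) \<partial>lborel)
       = ennreal (Beta (?a + 1) (?b + 1)) * ennreal (\<Prod>i=1..d+1. gpow (\<epsilon>' i) (xx d x i))" .
  qed
  also have "\<dots> = ennreal (Beta (?a + 1) (?b + 1)) * (\<integral>\<^sup>+x. ennreal (\<Prod>i=1..d+1. gpow (\<epsilon>' i) (xx d x i)) \<partial>lebd d)"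
    by (rule nn_integral_cmult) (use prod_gpow_measurable in measurable)
  also have "(\<integral>\<^sup>+x. ennreal (\<Prod>i=1..d+1. gpow (\<epsilon>' i) (xx d x i)) \<partial>lebd d)
     = ennreal ((\<Prod>i=1..d+1. Gamma (\<epsilon>' i + 1)) / Gamma (\<Sum>i=1..d+1. \<epsilon>' i + 1))"
    by (rule Suc.IH) (use Suc.prems e1 in \<open>simp add: \<epsilon>'_def\<close>)
  also have "(\<Prod>i=1..d+1. Gamma (\<epsilon>' i + 1)) = (\<Prod>i=1..d. Gamma (\<epsilon> i + 1)) * Gamma (?a + ?b + 2)"
  proof -
    have "(\<Prod>i=1..d. Gamma (\<epsilon>' i + 1)) = (\<Prod>i=1..d. Gamma (\<epsilon> i + 1))"
      by (rule prod.cong) (auto simp: \<epsilon>'_def)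
    then show ?thesis by (simp add: \<epsilon>'_def algebra_simps)
  qed
  also have "(\<Sum>i=1..d+1. \<epsilon>' i + 1) = (\<Sum>i=1..Suc d+1. \<epsilon> i + 1)"
  proof -
    have "(\<Sum>i=1..d. \<epsilon>' i + 1) = (\<Sum>i=1..d. \<epsilon> i + 1)"
      by (rule sum.cong) (auto simp: \<epsilon>'_def)
    then show ?thesis by (simp add: \<epsilon>'_def)
  qed
  also have "ennreal (Beta (?a + 1) (?b + 1)) *
      ennreal ((\<Prod>i=1..d. Gamma (\<epsilon> i + 1)) * Gamma (?a + ?b + 2) / Gamma (\<Sum>i=1..Suc d+1. \<epsilon> i + 1))
    = ennreal ((\<Prod>i=1..Suc d+1. Gamma (\<epsilon> i + 1)) / Gamma (\<Sum>i=1..Suc d+1. \<epsilon> i + 1))"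
  proof -
    have "?a + ?b + 2 > 0" using ab by linarith
    then have "Gamma (?a + ?b + 2) \<noteq> 0" using Gamma_real_pos[of "?a + ?b + 2"] by linarith
    moreover have "Beta (?a + 1) (?b + 1) \<ge> 0" using ab by (simp add: Beta_def Gamma_real_nonneg)
    moreover have B: "Beta (?a + 1) (?b + 1) = Gamma (?a + 1) * Gamma (?b + 1) / Gamma (?a + ?b + 2)"
    proof -
      have "?a + 1 + (?b + 1) = ?a + ?b + 2" by simp
      then show ?thesis by (simp only: Beta_def)
    qed
    moreover have "(\<Prod>i=1..Suc d+1. Gamma (\<epsilon> i + 1)) = (\<Prod>i=1..d. Gamma (\<epsilon> i + 1)) * Gamma (?a + 1) * Gamma (?b + 1)"
      by simp
    moreover have "x * y / z * (p * z / t) = p * x * y / t" if "z \<noteq> 0" for x y z p t :: real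
      using that by simp
    ultimately show ?thesis
      by (simp only: ennreal_mult'[symmetric] simp_thms)
  qed
  finally show ?case .
qed

section \<open>Moments of forms and orthogonality of the kernel\<close>

definition gam :: "nat \<Rightarrow> (nat \<Rightarrow> real) \<Rightarrow> (nat \<Rightarrow> nat) \<Rightarrow> real" where
  "gam d \<epsilon> \<alpha> = (\<Prod>i=1..d+1. Gamma (\<epsilon> i + 1 + real (\<alpha> i)))"

text \<open>The denominator of the Dirichlet moment depends on the exponent only through its degree.
  For products of forms of fixed degrees it is a common factor, so vanishing of integrals is decided
  by \<open>gam\<close> alone.\<close>

definition gtot :: "nat \<Rightarrow> (nat \<Rightarrow> real) \<Rightarrow> nat \<Rightarrow> real" where
  "gtot d \<epsilon> n = Gamma ((\<Sum>i=1..d+1. \<epsilon> i + 1) + real n)"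

lemma Tsimp_iff: "x \<in> Tsimp d \<longleftrightarrow> (\<forall>i\<in>{1..d+1}. 0 \<le> xx d x i)"
  by (auto simp: Tsimp_def xx_def)

lemma has_integral_mon:
  assumes \<epsilon>: "\<And>i. i \<in> {1..d+1} \<Longrightarrow> \<epsilon> i > -1" and \<alpha>: "\<alpha> \<in> multis {1..d+1} n"
  shows "has_bochner_integral (lebd d) (\<lambda>x. indicator (Tsimp d) x * (mon d \<alpha> x * weight d \<epsilon> x))
    (gam d \<epsilon> \<alpha> / gtot d \<epsilon> n)"
proof -
  let ?e = "\<lambda>i. \<epsilon> i + real (\<alpha> i)"
  have f: "indicator (Tsimp d) x * (mon d \<alpha> x * weight d \<epsilon> x) = (\<Prod>i=1..d+1. gpow (?e i) (xx d x i))" for x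
  proof -
    have "indicator (Tsimp d) x = (\<Prod>i=1..d+1. indicator {0..} (xx d x i) :: real)"
    proof (cases "x \<in> Tsimp d")
      case True
      then show ?thesis using Tsimp_iff[of x d] by (simp add: indicator_def prod.neutral)
    next
      case False
      then obtain i where i: "i \<in> {1..d+1}" "xx d x i < 0" unfolding Tsimp_iff by force
      then have "(\<Prod>i=1..d+1. indicator {0..} (xx d x i) :: real) = 0"
        by (intro prod_zero bexI[of _ i]) auto
      then show ?thesis using False by simp
    qed
    then have "indicator (Tsimp d) x * (mon d \<alpha> x * weight d \<epsilon> x)
       = (\<Prod>i=1..d+1. indicator {0..} (xx d x i) * (xx d x i ^ \<alpha> i * xx d x i powr \<epsilon> i))"
      by (simp only: mon_def weight_def prod.distrib)
    also have "\<dots> = (\<Prod>i=1..d+1. gpow (?e i) (xx d x i))"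
    proof (intro prod.cong refl)
      fix i
      show "indicator {0..} (xx d x i) * (xx d x i ^ \<alpha> i * xx d x i powr \<epsilon> i) = gpow (?e i) (xx d x i)"
      proof (cases "xx d x i > 0")
        case True
        then show ?thesis by (simp add: gpow_def powr_add powr_realpow mult.commute)
      next
        case False
        then show ?thesis by (cases "xx d x i = 0") (auto simp: gpow_def)
      qed
    qed
    finally show ?thesis .
  qed
  have e: "?e i > -1" if "i \<in> {1..d+1}" for i using \<epsilon>[OF that] by simp
  have s: "(\<Sum>i=1..d+1. ?e i + 1) = (\<Sum>i=1..d+1. \<epsilon> i + 1) + real n"
  proof -
    have "real n = (\<Sum>i=1..d+1. real (\<alpha> i))" using \<alpha> unfolding multis_def by force
    then show ?thesis by (simp add: sum.distrib)
  qed
  have v: "gam d \<epsilon> \<alpha> / gtot d \<epsilon> n = (\<Prod>i=1..d+1. Gamma (?e i + 1)) / Gamma (\<Sum>i=1..d+1. ?e i + 1)"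
    unfolding s gtot_def gam_def by (simp add: add.commute add.left_commute)
  have "gam d \<epsilon> \<alpha> / gtot d \<epsilon> n \<ge> 0"
  proof -
    have "(\<Prod>i=1..d+1. Gamma (?e i + 1)) \<ge> 0"
      by (intro prod_nonneg Gamma_real_nonneg) (use e in force)
    moreover have "(\<Sum>i=1..d+1. ?e i + 1) > 0" by (intro sum_pos) (use e in force)+
    ultimately show ?thesis unfolding v by (intro divide_nonneg_nonneg Gamma_real_nonneg)
  qed
  then show ?thesis unfolding f
  proof (intro has_bochner_integral_nn_integral prod_gpow_measurable AE_I2)
    show "0 \<le> (\<Prod>i=1..d+1. gpow (?e i) (xx d x i))" for x
      by (rule prod_nonneg) simp
    show "(\<integral>\<^sup>+x. ennreal (\<Prod>i=1..d+1. gpow (?e i) (xx d x i)) \<partial>lebd d) = ennreal (gam d \<epsilon> \<alpha> / gtot d \<epsilon> n)"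
      unfolding v by (rule nn_integral_dirichlet[OF e])
  qed
qed

abbreviation plus_exp :: "(nat \<Rightarrow> nat) \<Rightarrow> (nat \<Rightarrow> nat) \<Rightarrow> nat \<Rightarrow> nat" where
  "plus_exp \<alpha> \<beta> \<equiv> (\<lambda>i. \<alpha> i + \<beta> i)"

lemma plus_exp_multis: "\<alpha> \<in> multis A n \<Longrightarrow> \<beta> \<in> multis A m \<Longrightarrow> plus_exp \<alpha> \<beta> \<in> multis A (n + m)"
  by (simp add: multis_def sum.distrib)

lemma has_integral_hp_mult:
  assumes \<epsilon>: "\<And>i. i \<in> {1..d+1} \<Longrightarrow> \<epsilon> i > -1"
  shows "has_bochner_integral (lebd d)
    (\<lambda>x. indicator (Tsimp d) x *\<^sub>R (hp d n c x * hp d m c' x * weight d \<epsilon> x))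
    ((\<Sum>\<beta>\<in>multis {1..d+1} m. c' \<beta> * (\<Sum>\<alpha>\<in>multis {1..d+1} n. c \<alpha> * gam d \<epsilon> (plus_exp \<alpha> \<beta>))) / gtot d \<epsilon> (n + m))"
proof -
  let ?I = "\<lambda>\<alpha> x. indicator (Tsimp d) x * (mon d \<alpha> x * weight d \<epsilon> x)"
  have f: "indicator (Tsimp d) x *\<^sub>R (hp d n c x * hp d m c' x * weight d \<epsilon> x)
     = (\<Sum>\<beta>\<in>multis {1..d+1} m. \<Sum>\<alpha>\<in>multis {1..d+1} n. c' \<beta> * c \<alpha> * ?I (plus_exp \<alpha> \<beta>) x)" for x
  proof -
    have "mon d (plus_exp \<alpha> \<beta>) x = mon d \<alpha> x * mon d \<beta> x" for \<alpha> \<beta>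
      by (simp add: mon_def power_add prod.distrib)
    then have "hp d n c x * hp d m c' x
       = (\<Sum>\<beta>\<in>multis {1..d+1} m. \<Sum>\<alpha>\<in>multis {1..d+1} n. c' \<beta> * c \<alpha> * mon d (plus_exp \<alpha> \<beta>) x)"
      unfolding hp_def sum_product by (subst sum.swap) (simp add: mult_ac)
    then show ?thesis
      by (simp add: sum_distrib_left sum_distrib_right mult_ac)
  qed
  have v: "(\<Sum>\<beta>\<in>multis {1..d+1} m. c' \<beta> * (\<Sum>\<alpha>\<in>multis {1..d+1} n. c \<alpha> * gam d \<epsilon> (plus_exp \<alpha> \<beta>))) / gtot d \<epsilon> (n + m)
     = (\<Sum>\<beta>\<in>multis {1..d+1} m. \<Sum>\<alpha>\<in>multis {1..d+1} n. c' \<beta> * c \<alpha> * (gam d \<epsilon> (plus_exp \<alpha> \<beta>) / gtot d \<epsilon> (n + m)))"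
    by (simp add: sum_distrib_left sum_divide_distrib mult.assoc)
  show ?thesis unfolding f v
    by (intro has_bochner_integral_sum has_bochner_integral_mult_right has_integral_mon \<epsilon> plus_exp_multis)
qed

lemma gam_inc:
  assumes \<epsilon>: "\<And>i. i \<in> {1..d+1} \<Longrightarrow> \<epsilon> i > -1" and i: "i \<in> {1..d+1}" "\<alpha> i > 0"
  shows "(real (\<alpha> i) + \<epsilon> i) * gam d \<epsilon> (dec i \<alpha>) = gam d \<epsilon> \<alpha>"
proof -
  have r: "(\<Prod>j\<in>{1..d+1}-{i}. Gamma (\<epsilon> j + 1 + real (dec i \<alpha> j))) = (\<Prod>j\<in>{1..d+1}-{i}. Gamma (\<epsilon> j + 1 + real (\<alpha> j)))"
    by (rule prod.cong) auto
  have 1: "\<epsilon> i + 1 + real (dec i \<alpha> i) = real (\<alpha> i) + \<epsilon> i" using i by (simp add: of_nat_diff)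
  have p: "real (\<alpha> i) + \<epsilon> i > 0" using \<epsilon>[OF i(1)] i(2) by linarith
  have "Gamma (\<epsilon> i + 1 + real (\<alpha> i)) = Gamma (real (\<alpha> i) + \<epsilon> i + 1)" by (simp add: add_ac)
  also have "\<dots> = (real (\<alpha> i) + \<epsilon> i) * Gamma (real (\<alpha> i) + \<epsilon> i)"
    by (rule Gamma_plus1) (use p in \<open>auto elim!: nonpos_Ints_cases\<close>)
  finally have 2: "Gamma (\<epsilon> i + 1 + real (\<alpha> i)) = (real (\<alpha> i) + \<epsilon> i) * Gamma (real (\<alpha> i) + \<epsilon> i)" .
  show ?thesis
    unfolding gam_def prod.remove[OF finite_atLeastAtMost i(1), of "\<lambda>j. Gamma (\<epsilon> j + 1 + real (dec i \<alpha> j))"]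
      prod.remove[OF finite_atLeastAtMost i(1), of "\<lambda>j. Gamma (\<epsilon> j + 1 + real (\<alpha> j))"] r 1 2 by simp
qed

text \<open>Green's formula for the Dirichlet moments: as \<open>a (a + \<epsilon>) - b (b + \<epsilon>) = (a - b) (a + b + \<epsilon>)\<close>,
  the functional equation of the Gamma function turns each summand into a multiple of the right-hand moment.\<close>
lemma gam_green:
  assumes \<epsilon>: "\<And>i. i \<in> {1..d+1} \<Longrightarrow> \<epsilon> i > -1"
    and \<alpha>: "\<alpha> \<in> multis {1..d+1} n" and \<beta>: "\<beta> \<in> multis {1..d+1} m"
  shows "(\<Sum>i=1..d+1. real (\<alpha> i) * (real (\<alpha> i) + \<epsilon> i) * gam d \<epsilon> (plus_exp (dec i \<alpha>) \<beta>))
    - (\<Sum>i=1..d+1. real (\<beta> i) * (real (\<beta> i) + \<epsilon> i) * gam d \<epsilon> (plus_exp \<alpha> (dec i \<beta>)))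
    = (real n - real m) * gam d \<epsilon> (plus_exp \<alpha> \<beta>)"
proof -
  have nm: "real n = (\<Sum>i=1..d+1. real (\<alpha> i))" "real m = (\<Sum>i=1..d+1. real (\<beta> i))"
    using \<alpha> \<beta> unfolding multis_def by force+
  have "real (\<alpha> i) * (real (\<alpha> i) + \<epsilon> i) * gam d \<epsilon> (plus_exp (dec i \<alpha>) \<beta>)
     - real (\<beta> i) * (real (\<beta> i) + \<epsilon> i) * gam d \<epsilon> (plus_exp \<alpha> (dec i \<beta>))
     = (real (\<alpha> i) - real (\<beta> i)) * gam d \<epsilon> (plus_exp \<alpha> \<beta>)" if i: "i \<in> {1..d+1}" for i
  proof -
    let ?g = "gam d \<epsilon> (dec i (plus_exp \<alpha> \<beta>))"
    have a: "real (\<alpha> i) * gam d \<epsilon> (plus_exp (dec i \<alpha>) \<beta>) = real (\<alpha> i) * ?g"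
    proof (cases "\<alpha> i = 0")
      case False
      then have "plus_exp (dec i \<alpha>) \<beta> = dec i (plus_exp \<alpha> \<beta>)" by (auto simp: fun_eq_iff)
      then show ?thesis by simp
    qed simp
    have b: "real (\<beta> i) * gam d \<epsilon> (plus_exp \<alpha> (dec i \<beta>)) = real (\<beta> i) * ?g"
    proof (cases "\<beta> i = 0")
      case False
      then have "plus_exp \<alpha> (dec i \<beta>) = dec i (plus_exp \<alpha> \<beta>)" by (auto simp: fun_eq_iff)
      then show ?thesis by simp
    qed simp
    have "real (\<alpha> i) * (real (\<alpha> i) + \<epsilon> i) * gam d \<epsilon> (plus_exp (dec i \<alpha>) \<beta>)
       - real (\<beta> i) * (real (\<beta> i) + \<epsilon> i) * gam d \<epsilon> (plus_exp \<alpha> (dec i \<beta>))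
       = (real (\<alpha> i) + \<epsilon> i) * (real (\<alpha> i) * gam d \<epsilon> (plus_exp (dec i \<alpha>) \<beta>))
       - (real (\<beta> i) + \<epsilon> i) * (real (\<beta> i) * gam d \<epsilon> (plus_exp \<alpha> (dec i \<beta>)))"
      by (simp only: mult_ac)
    also have "\<dots> = (real (\<alpha> i) - real (\<beta> i)) * ((real (\<alpha> i) + real (\<beta> i) + \<epsilon> i) * ?g)"
      unfolding a b by algebra
    also have "\<dots> = (real (\<alpha> i) - real (\<beta> i)) * gam d \<epsilon> (plus_exp \<alpha> \<beta>)"
    proof (cases "\<alpha> i + \<beta> i = 0")
      case False
      then show ?thesis using gam_inc[where \<epsilon> = \<epsilon> and \<alpha> = "plus_exp \<alpha> \<beta>", OF \<epsilon> i] by simp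
    qed simp
    finally show ?thesis .
  qed
  then show ?thesis
    unfolding nm sum_subtractf[symmetric] sum_distrib_right by (intro sum.cong refl)
qed

text \<open>Induction on the degree of the test monomial. Green's formula expresses
  \<open>n - m\<close> times the pairing as the pairing with the operator applied to the kernel
  form, which is 0, minus pairings with test monomials of lower degree, which vanish by
  induction.\<close>

lemma ker_coeffs_orthogonal:
  assumes \<epsilon>: "\<And>i. i \<in> {1..d+1} \<Longrightarrow> \<epsilon> i > -1" and c: "c \<in> ker_coeffs {1..d+1} \<epsilon> n"
    and "m < n" "\<beta> \<in> multis {1..d+1} m"
  shows "(\<Sum>\<alpha>\<in>multis {1..d+1} n. c \<alpha> * gam d \<epsilon> (plus_exp \<alpha> \<beta>)) = 0"
  using assms(3,4)
proof (induction m arbitrary: \<beta>)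
  case (0 \<beta>)
  let ?S = "\<lambda>\<beta>. \<Sum>\<alpha>\<in>multis {1..d+1} n. c \<alpha> * gam d \<epsilon> (plus_exp \<alpha> \<beta>)"
  have \<beta>: "\<beta> = (\<lambda>_. 0)" using 0 by (simp add: multis_0)
  have "(real n - 0) * ?S \<beta> = (\<Sum>\<alpha>\<in>multis {1..d+1} n. c \<alpha> * ((real n - real 0) * gam d \<epsilon> (plus_exp \<alpha> \<beta>)))"
    unfolding sum_distrib_left by (intro sum.cong refl) simp
  also have "\<dots> = (\<Sum>\<alpha>\<in>multis {1..d+1} n. c \<alpha> * (\<Sum>i\<in>{1..d+1}. real (\<alpha> i) * (real (\<alpha> i) + \<epsilon> i) * gam d \<epsilon> (plus_exp (dec i \<alpha>) \<beta>)))"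
  proof (intro sum.cong refl arg_cong2[where f = "(*)"])
    fix \<alpha> assume "\<alpha> \<in> multis {1..d+1} n"
    from gam_green[where \<epsilon> = \<epsilon>, OF \<epsilon> this 0(2)] show "(real n - real 0) * gam d \<epsilon> (plus_exp \<alpha> \<beta>)
      = (\<Sum>i\<in>{1..d+1}. real (\<alpha> i) * (real (\<alpha> i) + \<epsilon> i) * gam d \<epsilon> (plus_exp (dec i \<alpha>) \<beta>))"
      using \<beta> by simp
  qed
  also have "\<dots> = 0" by (rule ker_coeffs_sum_lower[OF finite_atLeastAtMost c])
  finally show ?case using 0(1) by simp
next
  case (Suc m \<beta>)
  let ?S = "\<lambda>\<beta>. \<Sum>\<alpha>\<in>multis {1..d+1} n. c \<alpha> * gam d \<epsilon> (plus_exp \<alpha> \<beta>)"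
  have low: "real (\<beta> i) * (real (\<beta> i) + \<epsilon> i) * ?S (dec i \<beta>) = 0" if i: "i \<in> {1..d+1}" for i
  proof (cases "\<beta> i = 0")
    case False
    then have m: "dec i \<beta> \<in> multis {1..d+1} m"
      using dec_mem_multis[OF finite_atLeastAtMost i, of \<beta> m] Suc.prems by simp
    have "?S (dec i \<beta>) = 0" by (rule Suc.IH[OF _ m]) (use Suc.prems(1) in simp)
    then show ?thesis by simp
  qed simp
  have "(real n - real (Suc m)) * ?S \<beta>
     = (\<Sum>\<alpha>\<in>multis {1..d+1} n. c \<alpha> * ((real n - real (Suc m)) * gam d \<epsilon> (plus_exp \<alpha> \<beta>)))"
    unfolding sum_distrib_left by (intro sum.cong refl) (simp only: mult.left_commute)
  also have "\<dots> = (\<Sum>\<alpha>\<in>multis {1..d+1} n. c \<alpha> * (\<Sum>i\<in>{1..d+1}. real (\<alpha> i) * (real (\<alpha> i) + \<epsilon> i) * gam d \<epsilon> (plus_exp (dec i \<alpha>) \<beta>)))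
     - (\<Sum>\<alpha>\<in>multis {1..d+1} n. c \<alpha> * (\<Sum>i\<in>{1..d+1}. real (\<beta> i) * (real (\<beta> i) + \<epsilon> i) * gam d \<epsilon> (plus_exp \<alpha> (dec i \<beta>))))"
  proof -
    have "(\<Sum>\<alpha>\<in>multis {1..d+1} n. c \<alpha> * ((real n - real (Suc m)) * gam d \<epsilon> (plus_exp \<alpha> \<beta>)))
      = (\<Sum>\<alpha>\<in>multis {1..d+1} n. c \<alpha> * ((\<Sum>i\<in>{1..d+1}. real (\<alpha> i) * (real (\<alpha> i) + \<epsilon> i) * gam d \<epsilon> (plus_exp (dec i \<alpha>) \<beta>))
         - (\<Sum>i\<in>{1..d+1}. real (\<beta> i) * (real (\<beta> i) + \<epsilon> i) * gam d \<epsilon> (plus_exp \<alpha> (dec i \<beta>)))))"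
      by (intro sum.cong refl arg_cong2[where f = "(*)"] gam_green[where \<epsilon> = \<epsilon>, OF \<epsilon> _ Suc.prems(2), symmetric])
    then show ?thesis by (simp only: right_diff_distrib sum_subtractf)
  qed
  also have "(\<Sum>\<alpha>\<in>multis {1..d+1} n. c \<alpha> * (\<Sum>i\<in>{1..d+1}. real (\<alpha> i) * (real (\<alpha> i) + \<epsilon> i) * gam d \<epsilon> (plus_exp (dec i \<alpha>) \<beta>))) = 0"
    by (rule ker_coeffs_sum_lower[OF finite_atLeastAtMost c])
  also have "(\<Sum>\<alpha>\<in>multis {1..d+1} n. c \<alpha> * (\<Sum>i\<in>{1..d+1}. real (\<beta> i) * (real (\<beta> i) + \<epsilon> i) * gam d \<epsilon> (plus_exp \<alpha> (dec i \<beta>))))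
     = (\<Sum>i\<in>{1..d+1}. real (\<beta> i) * (real (\<beta> i) + \<epsilon> i) * ?S (dec i \<beta>))"
    unfolding sum_distrib_left by (subst sum.swap) (simp only: mult.left_commute)
  also have "\<dots> = 0" by (rule sum.neutral) (use low in blast)
  finally show ?case using Suc.prems(1) by simp
qed

section \<open>Orthogonal polynomials on the simplex\<close>

lemma xx_cong: "(\<And>i. i \<in> {1..d} \<Longrightarrow> x i = y i) \<Longrightarrow> j \<in> {1..d+1} \<Longrightarrow> xx d x j = xx d y j"
  by (auto simp: xx_def intro: sum.cong)

lemma hp_cong: "(\<And>i. i \<in> {1..d} \<Longrightarrow> x i = y i) \<Longrightarrow> hp d n c x = hp d n c y"
  unfolding hp_def mon_def
  by (intro sum.cong refl arg_cong2[where f = "(*)"] prod.cong arg_cong2[where f = "(^)"] xx_cong)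

lemma continuous_xx: "continuous_on UNIV (\<lambda>x. xx d x i)"
  unfolding xx_def
  by (cases "i = d + 1") (auto intro!: continuous_intros continuous_on_product_coordinates)

lemma continuous_hp: "continuous_on UNIV (hp d n c)"
  unfolding hp_def[abs_def] mon_def
  by (intro continuous_intros continuous_xx)

lemma emeasure_lborel_open_pos:
  fixes U :: "real set"
  assumes "open U" "x \<in> U" shows "emeasure lborel U > 0"
proof -
  obtain e where e: "e > 0" "ball x e \<subseteq> U" using assms open_contains_ball by blast
  have "0 < emeasure lborel {x - e<..<x + e}" using e(1) by simp
  also have "\<dots> \<le> emeasure lborel U"
    using assms(1) e(2) by (intro emeasure_mono) (auto simp: dist_real_def ball_def subset_iff)
  finally show ?thesis .
qed

text \<open>The integrand is nonnegative, hence zero almost everywhere; a nonzero value in the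
  interior would persist on an open box of positive measure.\<close>

lemma hp_square_integral_zero:
  assumes int: "has_bochner_integral (lebd d) (\<lambda>x. indicator (Tsimp d) x *\<^sub>R (hp d n g x * hp d n g x * weight d \<epsilon> x)) 0"
    and x: "x \<in> Tint d"
  shows "hp d n g x = 0"
proof (rule ccontr)
  assume nz: "hp d n g x \<noteq> 0"
  interpret product_sigma_finite "\<lambda>_::nat. lborel :: real measure"
    by standard
  let ?f = "\<lambda>x. indicator (Tsimp d) x *\<^sub>R (hp d n g x * hp d n g x * weight d \<epsilon> x)"
  define U where "U = {y. hp d n g y \<noteq> 0} \<inter> (\<Inter>i\<in>{1..d+1}. {y. xx d y i > 0})"
  have oU: "open U"
    unfolding U_def
    by (intro open_Int open_INT ballI open_Collect_neq open_Collect_less continuous_on_const continuous_xx continuous_hp) simp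
  have xU: "x \<in> U" using nz Tint_pos[OF x] by (auto simp: U_def)
  \<comment> \<open>A basic open box in the topology on all functions \<open>nat => real\<close>;
    the measure only sees its projection \<open>B\<close> to the coordinates 1..d.\<close>
  obtain X where X: "x \<in> (\<Pi>\<^sub>E i\<in>UNIV. X i)" "\<And>i. open (X i)" "(\<Pi>\<^sub>E i\<in>UNIV. X i) \<subseteq> U"
    using product_topology_open_contains_basis[of "\<lambda>_. euclidean" UNIV U x] oU xU
    unfolding open_fun_def open_openin[symmetric] by blast
  define B where "B = (\<Pi>\<^sub>E i\<in>{1..d}. X i)"
  have Bpos: "emeasure (lebd d) B > 0"
  proof -
    have "emeasure (lebd d) B = (\<Prod>i\<in>{1..d}. emeasure lborel (X i))"
      unfolding B_def by (rule emeasure_PiM) (use X(2) in auto)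
    also have "\<dots> \<noteq> 0"
    proof
      assume "(\<Prod>i\<in>{1..d}. emeasure lborel (X i)) = 0"
      then obtain i where "emeasure lborel (X i) = 0" by auto
      moreover have "x i \<in> X i" using X(1) by auto
      ultimately show False using emeasure_lborel_open_pos[OF X(2)[of i]] by simp
    qed
    finally show ?thesis by (simp add: zero_less_iff_neq_zero)
  qed
  have Bset: "B \<in> sets (lebd d)" unfolding B_def
    by (rule sets_PiM_I_finite) (use X(2) in auto)
  have fB: "?f z \<noteq> 0" if z: "z \<in> B" for z
  proof -
    \<comment> \<open>Points of \<open>B\<close> are undefined outside 1..d; filling in the
      coordinates of \<open>x\<close> there gives a point of the box, and neither \<open>hp\<close>
      nor the relevant \<open>xx\<close> notices the change.\<close>
    let ?z = "\<lambda>i. if i \<in> {1..d} then z i else x i"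
    have "?z \<in> (\<Pi>\<^sub>E i\<in>UNIV. X i)" using z X(1) by (auto simp: B_def PiE_iff)
    then have zU: "?z \<in> U" using X(3) by blast
    have "hp d n g ?z = hp d n g z" by (rule hp_cong) simp
    then have 1: "hp d n g z \<noteq> 0" using zU by (simp add: U_def)
    have pos: "xx d z i > 0" if "i \<in> {1..d+1}" for i
    proof -
      have "xx d ?z i = xx d z i" by (rule xx_cong) (use that in auto)
      moreover have "xx d ?z i > 0" using zU that by (auto simp: U_def)
      ultimately show ?thesis by simp
    qed
    have "weight d \<epsilon> z > 0" unfolding weight_def by (intro prod_pos ballI) (use pos in force)
    moreover have "z \<in> Tsimp d" unfolding Tsimp_iff using pos by force
    ultimately show ?thesis using 1 by simp
  qed
  have nonneg: "?f z \<ge> 0" for z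
  proof -
    have "weight d \<epsilon> z \<ge> 0" unfolding weight_def by (intro prod_nonneg) auto
    then show ?thesis by simp
  qed
  have "AE z in lebd d. ?f z = 0"
    using int nonneg integral_nonneg_eq_0_iff_AE[of "lebd d" ?f] by (simp add: has_bochner_integral_iff)
  then have "AE z in lebd d. z \<notin> B" by eventually_elim (use fB in blast)
  then have "emeasure (lebd d) B = 0" using Bset AE_iff_measurable[of B "lebd d" "\<lambda>z. z \<notin> B"] sets.sets_into_space[OF Bset] by auto
  then show False using Bpos by simp
qed

lemma gtot_pos:
  assumes "\<And>i. i \<in> {1..d+1} \<Longrightarrow> \<epsilon> i > -1" shows "gtot d \<epsilon> n > 0"
proof -
  have "(\<Sum>i=1..d+1. \<epsilon> i + 1) > 0" by (intro sum_pos) (use assms in force)+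
  then show ?thesis unfolding gtot_def by (intro Gamma_real_pos) simp
qed

text \<open>One inclusion is \<open>ker_coeffs_orthogonal\<close>. For the other, Green's formula
  moves the operator onto test monomials of degree \<open>n - 1\<close>, where the assumed
  orthogonality applies; positivity of the weighted square then finishes.\<close>

lemma Vsp_eq:
  assumes \<epsilon>: "\<And>i. i \<in> {1..d+1} \<Longrightarrow> \<epsilon> i > -1"
  shows "Vsp d (int n) \<epsilon> = hp d n ` ker_coeffs {1..d+1} \<epsilon> n"
proof (intro equalityI subsetI)
  let ?D = "{1..d+1}"
  let ?I = "\<lambda>c m c'. (\<Sum>\<beta>\<in>multis ?D m. c' \<beta> * (\<Sum>\<alpha>\<in>multis ?D n. c \<alpha> * gam d \<epsilon> (plus_exp \<alpha> \<beta>))) / gtot d \<epsilon> (n + m)"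
  have int: "(LINT x:Tsimp d|lebd d. hp d n c x * hp d m c' x * weight d \<epsilon> x) = ?I c m c'" for c m c'
    unfolding set_lebesgue_integral_def
    by (rule has_bochner_integral_integral_eq[OF has_integral_hp_mult]) (rule \<epsilon>)
  {
    fix p assume "p \<in> hp d n ` ker_coeffs ?D \<epsilon> n"
    then obtain c where c: "c \<in> ker_coeffs ?D \<epsilon> n" "p = hp d n c" by blast
    have "(LINT x:Tsimp d|lebd d. p x * q x * weight d \<epsilon> x) = 0" if N: "N < n" and q: "poly_le d N q" for q N
    proof -
      obtain c' where c': "q = hp d N c'" using q by (auto simp: poly_le_iff_hp)
      have "?I c N c' = 0"
        using ker_coeffs_orthogonal[where \<epsilon> = \<epsilon>, OF \<epsilon> c(1) N] by simp
      then show ?thesis unfolding c' c(2) int .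
    qed
    then show "p \<in> Vsp d (int n) \<epsilon>"
      using poly_le_hp[of d n c] unfolding Vsp_def c(2) by simp
  next
    fix p assume p: "p \<in> Vsp d (int n) \<epsilon>"
    then have "poly_le d n p" by (simp add: Vsp_def)
    then obtain c0 where c0: "p = hp d n c0" by (auto simp: poly_le_iff_hp)
    define c where "c \<alpha> = (if \<alpha> \<in> multis ?D n then c0 \<alpha> else 0)" for \<alpha>
    have pc: "p = hp d n c" unfolding c0 hp_eq_iff by (simp add: c_def)
    have orth: "(LINT x:Tsimp d|lebd d. p x * q x * weight d \<epsilon> x) = 0" if "N < n" "poly_le d N q" for q N
      using p that unfolding Vsp_def by simp
    \<comment> \<open>The coefficients of the operator applied to the form of \<open>c\<close>, of
      degree one less; the goal is that they vanish.\<close>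
    define g where "g \<beta> = (\<Sum>j\<in>?D. (real (\<beta> j) + 1) * (real (\<beta> j) + 1 + \<epsilon> j) * c (inc j \<beta>))" for \<beta>
    have "g \<beta> = 0" for \<beta>
    proof (cases n)
      case 0
      have "c (inc j \<beta>) = 0" if "j \<in> ?D" for j
        using inc_mem_multis[OF finite_atLeastAtMost that, of \<beta> n] 0 by (simp add: c_def)
      then show ?thesis unfolding g_def by (intro sum.neutral) simp
    next
      case (Suc m)
      let ?S = "\<lambda>\<beta>. \<Sum>\<alpha>\<in>multis ?D n. c \<alpha> * gam d \<epsilon> (plus_exp \<alpha> \<beta>)"
      \<comment> \<open>Orthogonality tested on a single monomial, after cancelling the nonzero
        \<open>gtot\<close>.\<close>
      have S0: "?S \<beta> = 0" if N: "N < n" and \<beta>: "\<beta> \<in> multis ?D N" for \<beta> N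
      proof -
        have 1: "(\<Sum>\<beta>'\<in>multis ?D N. of_bool (\<beta>' = \<beta>) * ?S \<beta>') = ?S \<beta>"
        proof -
          have "(\<Sum>\<beta>'\<in>multis ?D N. of_bool (\<beta>' = \<beta>) * ?S \<beta>') = (\<Sum>\<beta>'\<in>multis ?D N. if \<beta>' = \<beta> then ?S \<beta>' else 0)"
            by (rule sum.cong) auto
          then show ?thesis using \<beta> by (simp only: sum.delta finite_multis finite_atLeastAtMost if_True)
        qed
        have 2: "?I c N (\<lambda>\<beta>'. of_bool (\<beta>' = \<beta>)) = 0"
          using orth[OF N poly_le_hp] unfolding pc int .
        have "gtot d \<epsilon> (n + N) \<noteq> 0"
          using gtot_pos[where \<epsilon> = \<epsilon> and d = d and n = "n + N", OF \<epsilon>] by force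
        then show ?thesis using 2 unfolding 1 by (simp only: divide_eq_0_iff simp_thms)
      qed
      \<comment> \<open>\<open>g\<close> pairs to 0 with every monomial of its own degree, since
        both terms of Green's formula involve only test monomials of degree below
        \<open>n\<close>.\<close>
      have gS: "(\<Sum>\<gamma>\<in>multis ?D m. g \<gamma> * gam d \<epsilon> (plus_exp \<gamma> \<beta>)) = 0" if \<beta>: "\<beta> \<in> multis ?D m" for \<beta>
      proof -
        have low: "real (\<beta> i) * (real (\<beta> i) + \<epsilon> i) * ?S (dec i \<beta>) = 0" if i: "i \<in> ?D" for i
        proof (cases "\<beta> i = 0")
          case False
          then obtain m' where m': "m = Suc m'"
            using \<beta> i dec_mem_multis[OF finite_atLeastAtMost i, of \<beta>] by (cases m) (auto simp: multis_0)
          then have "dec i \<beta> \<in> multis ?D m'"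
            using dec_mem_multis[OF finite_atLeastAtMost i, of \<beta> m'] \<beta> False by simp
          then have "?S (dec i \<beta>) = 0" by (rule S0[rotated]) (use Suc m' in simp)
          then show ?thesis by simp
        qed simp
        have "(\<Sum>\<gamma>\<in>multis ?D m. g \<gamma> * gam d \<epsilon> (plus_exp \<gamma> \<beta>))
          = (\<Sum>\<alpha>\<in>multis ?D n. c \<alpha> * (\<Sum>i\<in>?D. real (\<alpha> i) * (real (\<alpha> i) + \<epsilon> i) * gam d \<epsilon> (plus_exp (dec i \<alpha>) \<beta>)))"
          unfolding g_def Suc by (rule sum_lower_exponents[OF finite_atLeastAtMost, symmetric])
        also have "\<dots> = (\<Sum>\<alpha>\<in>multis ?D n. c \<alpha> * ((real n - real m) * gam d \<epsilon> (plus_exp \<alpha> \<beta>)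
           + (\<Sum>i\<in>?D. real (\<beta> i) * (real (\<beta> i) + \<epsilon> i) * gam d \<epsilon> (plus_exp \<alpha> (dec i \<beta>)))))"
        proof (intro sum.cong refl arg_cong2[where f = "(*)"])
          fix \<alpha> assume "\<alpha> \<in> multis ?D n"
          from gam_green[where \<epsilon> = \<epsilon>, OF \<epsilon> this \<beta>]
          show "(\<Sum>i\<in>?D. real (\<alpha> i) * (real (\<alpha> i) + \<epsilon> i) * gam d \<epsilon> (plus_exp (dec i \<alpha>) \<beta>))
            = (real n - real m) * gam d \<epsilon> (plus_exp \<alpha> \<beta>)
             + (\<Sum>i\<in>?D. real (\<beta> i) * (real (\<beta> i) + \<epsilon> i) * gam d \<epsilon> (plus_exp \<alpha> (dec i \<beta>)))"
            by linarith
        qed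
        also have "\<dots> = (real n - real m) * ?S \<beta>
          + (\<Sum>\<alpha>\<in>multis ?D n. c \<alpha> * (\<Sum>i\<in>?D. real (\<beta> i) * (real (\<beta> i) + \<epsilon> i) * gam d \<epsilon> (plus_exp \<alpha> (dec i \<beta>))))"
          unfolding distrib_left sum.distrib sum_distrib_left[of "real n - real m"] by (simp only: mult.left_commute)
        also have "?S \<beta> = 0" by (rule S0[OF _ \<beta>]) (use Suc in simp)
        also have "(\<Sum>\<alpha>\<in>multis ?D n. c \<alpha> * (\<Sum>i\<in>?D. real (\<beta> i) * (real (\<beta> i) + \<epsilon> i) * gam d \<epsilon> (plus_exp \<alpha> (dec i \<beta>))))
          = (\<Sum>i\<in>?D. real (\<beta> i) * (real (\<beta> i) + \<epsilon> i) * ?S (dec i \<beta>))"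
          unfolding sum_distrib_left by (subst sum.swap) (simp only: mult.left_commute)
        also have "\<dots> = 0" by (rule sum.neutral) (use low in blast)
        finally show ?thesis by simp
      qed
      \<comment> \<open>The form of \<open>g\<close> is paired with itself.\<close>
      have "has_bochner_integral (lebd d) (\<lambda>x. indicator (Tsimp d) x *\<^sub>R (hp d m g x * hp d m g x * weight d \<epsilon> x))
        ((\<Sum>\<beta>\<in>multis ?D m. g \<beta> * (\<Sum>\<alpha>\<in>multis ?D m. g \<alpha> * gam d \<epsilon> (plus_exp \<alpha> \<beta>))) / gtot d \<epsilon> (m + m))"
        by (rule has_integral_hp_mult) (rule \<epsilon>)
      also have "(\<Sum>\<beta>\<in>multis ?D m. g \<beta> * (\<Sum>\<alpha>\<in>multis ?D m. g \<alpha> * gam d \<epsilon> (plus_exp \<alpha> \<beta>))) / gtot d \<epsilon> (m + m) = 0"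
        using gS by simp
      finally have I: "has_bochner_integral (lebd d) (\<lambda>x. indicator (Tsimp d) x *\<^sub>R (hp d m g x * hp d m g x * weight d \<epsilon> x)) 0" .
      have z: "g \<gamma> = 0" if "\<gamma> \<in> multis ?D m" for \<gamma>
        by (rule hp_zero_Tint[OF hp_square_integral_zero[OF I] that])
      show "g \<beta> = 0"
      proof (cases "\<beta> \<in> multis ?D m")
        case False
        then have "c (inc j \<beta>) = 0" if "j \<in> ?D" for j
          using inc_mem_multis_Suc[OF finite_atLeastAtMost that, of \<beta> m] Suc by (simp add: c_def)
        then show ?thesis unfolding g_def by (intro sum.neutral) simp
      qed (rule z)
    qed
    then have "c \<in> ker_coeffs ?D \<epsilon> n" unfolding ker_coeffs_def g_def by (simp add: c_def)
    then show "p \<in> hp d n ` ker_coeffs ?D \<epsilon> n" unfolding pc by blast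
  }
qed

section \<open>The solution spaces\<close>

lemma pd_const [simp]: "pd i (\<lambda>x. a) = (\<lambda>x. 0)"
  by (rule ext) (simp add: pd_def)

lemma Lop_const: "Lop d \<epsilon> (\<lambda>x. a) x = 0"
  by (simp add: Lop_def)

lemma Bset_props:
  assumes "1 \<le> k" "k \<le> d + 1"
  shows "Bset d k \<subseteq> {1..d+1}" "finite (Bset d k)" "card (Bset d k) = k"
    "i \<in> {1..d+1} \<Longrightarrow> i \<notin> Bset d k \<longleftrightarrow> i \<in> {1..d+1-k}"
  using assms by (auto simp: Bset_def)

text \<open>The k entries -1 produce the shift by k in the eigenvalue of the theorem.\<close>

lemma sum_epsneg:
  assumes "1 \<le> k" "k \<le> d + 1"
  shows "(\<Sum>l=1..d+1. epsneg d k \<gamma> l) = (\<Sum>i=1..d+1-k. \<gamma> i) - real k"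
proof -
  have "{1..d+1} = {1..d+1-k} \<union> Bset d k" "{1..d+1-k} \<inter> Bset d k = {}"
    using assms by (auto simp: Bset_def)
  then have "(\<Sum>l=1..d+1. epsneg d k \<gamma> l) = (\<Sum>l\<in>{1..d+1-k}. epsneg d k \<gamma> l) + (\<Sum>l\<in>Bset d k. epsneg d k \<gamma> l)"
    using Bset_props(2)[OF assms] by (simp add: sum.union_disjoint)
  also have "(\<Sum>l\<in>{1..d+1-k}. epsneg d k \<gamma> l) = (\<Sum>l\<in>{1..d+1-k}. \<gamma> l)"
    by (rule sum.cong) (auto simp: epsneg_def)
  also have "(\<Sum>l\<in>Bset d k. epsneg d k \<gamma> l) = (\<Sum>l\<in>Bset d k. -1)"
    by (rule sum.cong) (use assms in \<open>auto simp: epsneg_def Bset_def\<close>)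
  finally show ?thesis using Bset_props(3)[OF assms] by simp
qed

lemma Iset_sub: "1 \<le> k \<Longrightarrow> Iset d k \<subseteq> Pow (Bset d k)"
  by (auto simp: Iset_def)

lemma Iset_Pow:
  assumes "1 \<le> k" "k \<le> d" shows "Iset d k = Pow (Bset d k)"
proof (cases "k = 1")
  case True
  then have "Bset d k = {d+1}" using assms by (auto simp: Bset_def)
  then show ?thesis using True by (auto simp: Iset_def)
qed (use assms in \<open>auto simp: Iset_def\<close>)

lemma finite_Iset: "1 \<le> k \<Longrightarrow> k \<le> d + 1 \<Longrightarrow> finite (Iset d k)"
  by (rule finite_subset[OF Iset_sub]) (simp_all add: Bset_props(2))

lemma times_sp_zero: "times_sp d J {\<lambda>x. 0} = {\<lambda>x. 0}"
  by (auto simp: times_sp_def)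

text \<open>Exactly the degrees in which \<open>Ucal\<close> is given by the displayed sum.\<close>

locale singular_weight =
  fixes d k n :: nat and \<gamma> :: "nat \<Rightarrow> real"
  assumes d: "2 \<le> d" and k: "1 \<le> k" "k \<le> d + 1"
    and \<gamma>: "\<forall>i\<in>{1..d+1-k}. \<gamma> i > -1"
    and n: "if k = d + 1 then 2 \<le> n else 1 \<le> n"
begin

abbreviation "face J \<equiv> {1..d+1} - (Bset d k - J)"

lemma J_props:
  assumes J: "J \<in> Iset d k"
  shows "J \<subseteq> Bset d k" "finite J" "J \<subseteq> face J" "card (Bset d k - J) = k - card J" "card J \<le> k"
    "card (face J) = d + 1 - k + card J" "k = d + 1 \<Longrightarrow> 2 \<le> card J"
proof -
  note B = Bset_props[OF k]
  show 1: "J \<subseteq> Bset d k" using J Iset_sub k by blast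
  show 2: "finite J" using 1 B(2) finite_subset by blast
  show "J \<subseteq> face J" using 1 B(1) by blast
  show 3: "card J \<le> k" using card_mono[OF B(2) 1] B(3) by simp
  show 4: "card (Bset d k - J) = k - card J" using card_Diff_subset[OF 2 1] B(3) by simp
  have "card (face J) = card {1..d+1} - card (Bset d k - J)"
    by (rule card_Diff_subset) (use B in auto)
  then show "card (face J) = d + 1 - k + card J" using 3 4 k by simp
  show "2 \<le> card J" if "k = d + 1" using J that d by (simp add: Iset_def)
qed

text \<open>No exponent -1 is left on the face: singular variables are either removed or, if they
  lie in \<open>J\<close>, have exponent 1. So both the basis and the orthogonality results
  apply.\<close>

lemma epsJ_gt:
  assumes "J \<subseteq> Bset d k" "i \<in> face J" shows "epsJ d k \<gamma> J i > -1"
proof (cases "i \<in> Bset d k")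
  case True
  then have "i \<in> J" using assms by blast
  then show ?thesis using True k(2) \<gamma> by (auto simp: epsJ_def Bset_def)
next
  case False
  then have "i \<in> {1..d+1-k}" using assms(2) Bset_props(4)[OF k, of i] by blast
  then show ?thesis using \<gamma> by (simp add: epsJ_def)
qed

text \<open>Either the degree is negative, or \<open>d\<close> singular coordinates are all removed
  and the face is a single vertex, where the convention for \<open>Hsp\<close> applies.\<close>

lemma summand_zero:
  assumes J: "J \<in> Iset d k" and z: "n < card J \<or> (k = d \<and> J = {})"
  shows "summand d k \<gamma> n J = {\<lambda>x. 0}"
proof (cases "J = Bset d k")
  case True
  then have "card J = k" using Bset_props(3)[OF k] by simp
  then have "n < k" using z k by auto
  then show ?thesis using True by (simp add: summand_def Vsp_def times_sp_zero)
next
  case False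
  have "Hsp d (int n - int (card J)) (Bset d k - J) (epsJ d k \<gamma> J) = {\<lambda>x. 0}"
    using z J_props(4)[OF J] by (auto simp: Hsp_def)
  then show ?thesis using False by (simp add: summand_def times_sp_zero)
qed

lemma summand_main:
  assumes J: "J \<in> Iset d k" and z: "\<not> (n < card J \<or> (k = d \<and> J = {}))"
  shows "summand d k \<gamma> n J
    = times_sp d J (hp d (n - card J) ` ker_coeffs (face J) (epsJ d k \<gamma> J) (n - card J))"
proof (cases "J = Bset d k")
  case True
  have "int n - int k = int (n - card J)" using True Bset_props(3)[OF k] z by simp
  moreover have "Vsp d (int (n - card J)) (epsJ d k \<gamma> J) = hp d (n - card J) ` ker_coeffs {1..d+1} (epsJ d k \<gamma> J) (n - card J)"
    by (rule Vsp_eq) (use epsJ_gt[of J] True in auto)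
  ultimately show ?thesis using True by (simp add: summand_def)
next
  case False
  have i: "int n - int (card J) = int (n - card J)" using z by simp
  have "card J \<noteq> 0" if "k = d" using z that J_props(2)[OF J] by auto
  then have "card (Bset d k - J) < d"
    using J_props(4,5,7)[OF J] k d by (cases "k = d + 1"; cases "k = d") auto
  then have "Hsp d (int (n - card J)) (Bset d k - J) (epsJ d k \<gamma> J)
     = hp d (n - card J) ` ker_coeffs (face J) (epsJ d k \<gamma> J) (n - card J)"
    using Bset_props(1)[OF k] J_props(1)[OF J] by (intro Hsp_eq epsJ_gt) auto
  then show ?thesis using False by (simp add: summand_def i)
qed

text \<open>The face has d + 1 - k + j variables, one of which is lost on restriction, and the
  degree is n - j. The upper index (n - j) + (d - k + j) - 1 does not contain j, which is what
  Vandermonde's identity requires.\<close>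

definition dimJ :: "nat \<Rightarrow> nat" where
  "dimJ j = (if n < j then 0 else (n + d - 1 - k) choose (n - j))"

text \<open>The formula also covers the summands that vanish by convention: for \<open>k = d\<close>
  and empty \<open>J\<close> it gives (n - 1) choose n = 0.\<close>

lemma has_dim_summand:
  assumes J: "J \<in> Iset d k" shows "has_dim (summand d k \<gamma> n J) (dimJ (card J))"
proof (cases "n < card J \<or> (k = d \<and> J = {})")
  case True
  then have "dimJ (card J) = 0" using n by (auto simp: dimJ_def)
  then show ?thesis using summand_zero[OF J True] has_dim_zero by simp
next
  case False
  note P = J_props[OF J]
  have pos: "card (face J) > 0" using P(6,7) k by (cases "k = d + 1") auto
  then have "face J \<noteq> {}" unfolding card_gt_0_iff by blast
  then obtain r where r: "r \<in> face J" by blast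
  have JD: "J \<subseteq> {1..d+1}" using P(1) Bset_props(1)[OF k] by blast
  have "has_dim (summand d k \<gamma> n J) ((n - card J + (card (face J) - 1) - 1) choose (n - card J))"
    unfolding summand_main[OF J False]
    by (rule has_dim_times_ker[where C = "face J" and r = r and \<epsilon> = "epsJ d k \<gamma> J"])
      (use r JD epsJ_gt[OF P(1) r] in blast)+
  moreover have "n - card J + (card (face J) - 1) - 1 = n + d - 1 - k"
    using False P(6,7) k n by (cases "k = d + 1") auto
  ultimately show ?thesis using False by (simp add: dimJ_def)
qed

lemma sum_dims: "(\<Sum>J\<in>Iset d k. dimJ (card J)) = (n + d - 1) choose n"
proof -
  let ?B = "Bset d k"
  note B = Bset_props[OF k]
  have "(\<Sum>J\<in>Iset d k. dimJ (card J)) = (\<Sum>J\<in>Pow ?B. dimJ (card J))"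
  proof (cases "k = d + 1")
    case True
    \<comment> \<open>For \<open>k = d + 1\<close> the upper index is n - 2, so the omitted sets of
      size 0 and 1 would contribute (n - 2) choose n and (n - 2) choose (n - 1), both zero; the sum
      may run over all subsets.\<close>
    have "dimJ (card J) = 0" if "J \<in> Pow ?B - Iset d k" for J
    proof -
      have "card J < 2" using that True d by (auto simp: Iset_def)
      then show ?thesis unfolding dimJ_def using True n by (simp add: binomial_eq_0)
    qed
    then show ?thesis using Iset_sub[OF k(1), of d] B(2) by (intro sum.mono_neutral_left) auto
  next
    case False
    then show ?thesis using Iset_Pow[of k d] k by simp
  qed
  also have "\<dots> = (\<Sum>j\<le>k. \<Sum>J\<in>{J \<in> Pow ?B. card J = j}. dimJ (card J))"
    by (rule sum.group[symmetric]) (use B card_mono[OF B(2)] in auto)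
  also have "\<dots> = (\<Sum>j\<le>k. (k choose j) * dimJ j)"
  proof (rule sum.cong[OF refl])
    fix j
    have "(\<Sum>J\<in>{J \<in> Pow ?B. card J = j}. dimJ (card J)) = card {J. J \<subseteq> ?B \<and> card J = j} * dimJ j"
      by simp
    then show "(\<Sum>J\<in>{J \<in> Pow ?B. card J = j}. dimJ (card J)) = (k choose j) * dimJ j"
      using n_subsets[OF B(2), of j] B(3) by simp
  qed
  also have "\<dots> = (\<Sum>j\<le>max k n. (k choose j) * dimJ j)"
    by (rule sum.mono_neutral_left) (auto simp: binomial_eq_0)
  also have "\<dots> = (\<Sum>j\<le>n. (k choose j) * dimJ j)"
    by (rule sum.mono_neutral_right) (auto simp: dimJ_def)
  also have "\<dots> = (\<Sum>j\<le>n. (k choose j) * ((n + d - 1 - k) choose (n - j)))"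
    by (rule sum.cong) (auto simp: dimJ_def)
  also have "\<dots> = (k + (n + d - 1 - k)) choose n" by (rule vandermonde)
  \<comment> \<open>No truncation occurs: \<open>n \<ge> 1\<close> suffices for
    \<open>k \<le> d\<close>, and \<open>n \<ge> 2\<close> for \<open>k = d + 1\<close>.\<close>
  also have "k + (n + d - 1 - k) = n + d - 1" using k n by (auto split: if_splits)
  finally show ?thesis .
qed

text \<open>Every monomial of an element of the summand \<open>J\<close> contains precisely the
  singular variables in \<open>J\<close>; this support condition is what separates the
  summands.\<close>

lemma summand_repr:
  assumes J: "J \<in> Iset d k" and f: "f \<in> summand d k \<gamma> n J"
  shows "\<exists>e. f = hp d n e \<and> (\<forall>\<alpha>. e \<alpha> \<noteq> 0 \<longrightarrow> {i \<in> Bset d k. \<alpha> i > 0} = J)"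
    and "Lop d (epsneg d k \<gamma>) f x
      = - (real n * (real n + (\<Sum>i=1..d+1-k. \<gamma> i) + real d - real k)) * f x"
proof -
  note P = J_props[OF J]
  have "(\<exists>e. f = hp d n e \<and> (\<forall>\<alpha>. e \<alpha> \<noteq> 0 \<longrightarrow> {i \<in> Bset d k. \<alpha> i > 0} = J)) \<and>
    Lop d (epsneg d k \<gamma>) f x = - (real n * (real n + (\<Sum>i=1..d+1-k. \<gamma> i) + real d - real k)) * f x"
  proof (cases "n < card J \<or> (k = d \<and> J = {})")
    case True
    then have f0: "f = (\<lambda>x. 0)" using summand_zero[OF J] f by simp
    have "hp d n (\<lambda>\<alpha>. 0) = (\<lambda>x. 0)" by (simp add: hp_def[abs_def])
    then have "\<exists>e. f = hp d n e \<and> (\<forall>\<alpha>. e \<alpha> \<noteq> 0 \<longrightarrow> {i \<in> Bset d k. \<alpha> i > 0} = J)"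
      using f0 by (intro exI[of _ "\<lambda>\<alpha>. 0"]) simp
    then show ?thesis using f0 Lop_const[of d "epsneg d k \<gamma>" 0 x] by simp
  next
    case False
    let ?m = "n - card J"
    have nm: "?m + card J = n" using False by simp
    obtain c where c: "c \<in> ker_coeffs (face J) (epsJ d k \<gamma> J) ?m" and fc: "f = (\<lambda>x. xprod d J x * hp d ?m c x)"
      using f unfolding summand_main[OF J False] times_sp_def by blast
    have CD: "face J \<subseteq> {1..d+1}" by blast
    obtain e where e: "f = hp d n e" "\<And>\<alpha>. e \<alpha> \<noteq> 0 \<Longrightarrow> (\<forall>i\<in>J. \<alpha> i > 0) \<and> (\<forall>i\<in>-face J. \<alpha> i = 0)"
      using times_ker_hp[OF P(3) CD c] unfolding fc nm by blast
    have "{i \<in> Bset d k. \<alpha> i > 0} = J" if "e \<alpha> \<noteq> 0" for \<alpha>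
    proof
      show "{i \<in> Bset d k. \<alpha> i > 0} \<subseteq> J"
      proof
        fix i assume i: "i \<in> {i \<in> Bset d k. \<alpha> i > 0}"
        then have "i \<in> face J" using e(2)[OF that] by force
        then show "i \<in> J" using i by blast
      qed
      show "J \<subseteq> {i \<in> Bset d k. \<alpha> i > 0}" using e(2)[OF that] P(1) by blast
    qed
    moreover have "Lop d (epsneg d k \<gamma>) (\<lambda>x. xprod d J x * hp d ?m c x) x
      = - (real (?m + card J) * (real (?m + card J) + (\<Sum>l=1..d+1. epsneg d k \<gamma> l) + real d)) * (xprod d J x * hp d ?m c x)"
    proof (rule Lop_ker[OF P(3) CD c])
      fix i
      show "epsneg d k \<gamma> i = -1 \<and> epsJ d k \<gamma> J i = 1" if "i \<in> J"
      proof -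
        have "i \<in> Bset d k" using that P(1) by blast
        then show ?thesis using that k by (auto simp: epsneg_def epsJ_def Bset_def)
      qed
      show "epsneg d k \<gamma> i = epsJ d k \<gamma> J i" if "i \<in> face J - J"
      proof -
        have "i \<in> {1..d+1-k}" using that Bset_props(4)[OF k, of i] by blast
        then show ?thesis by (simp add: epsneg_def epsJ_def)
      qed
    qed
    moreover have eq: "real n + ((\<Sum>i=1..d+1-k. \<gamma> i) - real k) + real d = real n + (\<Sum>i=1..d+1-k. \<gamma> i) + real d - real k"
      by simp
    ultimately have "Lop d (epsneg d k \<gamma>) f x
      = - (real n * (real n + (\<Sum>i=1..d+1-k. \<gamma> i) + real d - real k)) * f x"
      and "\<forall>\<alpha>. e \<alpha> \<noteq> 0 \<longrightarrow> {i \<in> Bset d k. \<alpha> i > 0} = J"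
      unfolding fc nm sum_epsneg[OF k] eq by blast+
    then show ?thesis using e(1) by blast
  qed
  then show "\<exists>e. f = hp d n e \<and> (\<forall>\<alpha>. e \<alpha> \<noteq> 0 \<longrightarrow> {i \<in> Bset d k. \<alpha> i > 0} = J)"
    and "Lop d (epsneg d k \<gamma>) f x
      = - (real n * (real n + (\<Sum>i=1..d+1-k. \<gamma> i) + real d - real k)) * f x" by blast+
qed

lemma family_repr:
  assumes "\<forall>J\<in>Iset d k. f J \<in> summand d k \<gamma> n J"
  shows "\<exists>e. \<forall>J\<in>Iset d k. f J = hp d n (e J) \<and> (\<forall>\<alpha>. e J \<alpha> \<noteq> 0 \<longrightarrow> {i \<in> Bset d k. \<alpha> i > 0} = J)"
proof (rule bchoice)
  show "\<forall>J\<in>Iset d k. \<exists>e. f J = hp d n e \<and> (\<forall>\<alpha>. e \<alpha> \<noteq> 0 \<longrightarrow> {i \<in> Bset d k. \<alpha> i > 0} = J)"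
    using summand_repr(1) assms by blast
qed

text \<open>As forms of the common degree \<open>n\<close>, the summands have pairwise disjoint
  supports, so a vanishing sum vanishes coefficient by coefficient in each of them.\<close>

lemma summands_direct: "direct_sp (Iset d k) (summand d k \<gamma> n)"
  unfolding direct_sp_def
proof (intro allI impI ballI)
  fix f J
  assume f: "\<forall>J\<in>Iset d k. f J \<in> summand d k \<gamma> n J" and z: "(\<lambda>x. \<Sum>J\<in>Iset d k. f J x) = (\<lambda>x. 0)"
    and J: "J \<in> Iset d k"
  from family_repr[OF f] obtain e where
    e': "\<forall>J\<in>Iset d k. f J = hp d n (e J) \<and> (\<forall>\<alpha>. e J \<alpha> \<noteq> 0 \<longrightarrow> {i \<in> Bset d k. \<alpha> i > 0} = J)" ..
  have e: "\<And>J. J \<in> Iset d k \<Longrightarrow> f J = hp d n (e J)"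
    "\<And>J \<alpha>. J \<in> Iset d k \<Longrightarrow> e J \<alpha> \<noteq> 0 \<Longrightarrow> {i \<in> Bset d k. \<alpha> i > 0} = J"
    using e' by blast+
  have "hp d n (\<lambda>\<alpha>. \<Sum>J\<in>Iset d k. 1 * e J \<alpha>) x = 0" for x
  proof -
    have "(\<Sum>J\<in>Iset d k. 1 * hp d n (e J) x) = (\<Sum>J\<in>Iset d k. f J x)"
      by (rule sum.cong) (simp_all add: e(1))
    then show ?thesis using fun_cong[OF z, of x] unfolding hp_sum[symmetric] by simp
  qed
  then have s0: "(\<Sum>J\<in>Iset d k. 1 * e J \<alpha>) = 0" if "\<alpha> \<in> multis {1..d+1} n" for \<alpha>
    by (rule hp_zero_Tint[OF _ that])
  have "e J \<alpha> = 0" if \<alpha>: "\<alpha> \<in> multis {1..d+1} n" for \<alpha>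
  proof (rule ccontr)
    assume nz: "e J \<alpha> \<noteq> 0"
    have "e J' \<alpha> = 0" if "J' \<in> Iset d k - {J}" for J'
      using e(2)[OF J nz] e(2)[of J' \<alpha>] that by blast
    then have "(\<Sum>J\<in>Iset d k. 1 * e J \<alpha>) = e J \<alpha>"
      using sum.remove[OF finite_Iset[OF k] J, of "\<lambda>J. 1 * e J \<alpha>"] by simp
    then show False using s0[OF \<alpha>] nz by simp
  qed
  then show "f J = (\<lambda>x. 0)" unfolding e(1)[OF J] by (simp add: hp_def[abs_def])
qed

lemma sum_sp_solution:
  assumes u: "u \<in> sum_sp (Iset d k) (summand d k \<gamma> n)"
  shows "polyfun d u" "Lop d (epsneg d k \<gamma>) u x
      = - (real n * (real n + (\<Sum>i=1..d+1-k. \<gamma> i) + real d - real k)) * u x"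
proof -
  obtain f where uf: "u = (\<lambda>x. \<Sum>J\<in>Iset d k. f J x)" and f: "\<forall>J\<in>Iset d k. f J \<in> summand d k \<gamma> n J"
    using u unfolding sum_sp_def by blast
  from family_repr[OF f] obtain e where
    e': "\<forall>J\<in>Iset d k. f J = hp d n (e J) \<and> (\<forall>\<alpha>. e J \<alpha> \<noteq> 0 \<longrightarrow> {i \<in> Bset d k. \<alpha> i > 0} = J)" ..
  then have e: "f J = hp d n (e J)" if "J \<in> Iset d k" for J using that by blast
  have ue: "u = (\<lambda>x. \<Sum>J\<in>Iset d k. hp d n (e J) x)"
    unfolding uf by (rule ext, rule sum.cong[OF refl]) (simp only: e)
  have "poly_le d n u" unfolding ue by (rule poly_le_sum) (rule poly_le_hp)
  then show "polyfun d u" by (auto simp: polyfun_def)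
  have "Lop d (epsneg d k \<gamma>) u x = (\<Sum>J\<in>Iset d k. Lop d (epsneg d k \<gamma>) (hp d n (e J)) x)"
    unfolding ue by (rule Lop_hp_sum)
  also have "\<dots> = (\<Sum>J\<in>Iset d k. Lop d (epsneg d k \<gamma>) (f J) x)"
    by (rule sum.cong[OF refl]) (simp only: e)
  also have "\<dots> = (\<Sum>J\<in>Iset d k. - (real n * (real n + (\<Sum>i=1..d+1-k. \<gamma> i) + real d - real k)) * f J x)"
  proof (rule sum.cong[OF refl])
    fix J assume J: "J \<in> Iset d k"
    show "Lop d (epsneg d k \<gamma>) (f J) x
      = - (real n * (real n + (\<Sum>i=1..d+1-k. \<gamma> i) + real d - real k)) * f J x"
      by (rule summand_repr(2)[OF J bspec[OF f J]])
  qed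
  also have "\<dots> = - (real n * (real n + (\<Sum>i=1..d+1-k. \<gamma> i) + real d - real k)) * u x"
    unfolding uf by (rule sum_distrib_left[symmetric])
  finally show "Lop d (epsneg d k \<gamma>) u x
      = - (real n * (real n + (\<Sum>i=1..d+1-k. \<gamma> i) + real d - real k)) * u x" .
qed

lemma has_dim_sum_summands: "has_dim (sum_sp (Iset d k) (summand d k \<gamma> n)) ((n + d - 1) choose n)"
  using has_dim_sum_sp[OF finite_Iset[OF k] has_dim_summand summands_direct] unfolding sum_dims .

end

section \<open>The exceptional low degrees\<close>

lemma has_dim_const: "has_dim {(\<lambda>x. a) | a. True} 1"
proof -
  have "has_dim {(\<lambda>x. a) | a. True} (card {0::nat})"
  proof (rule has_dimI[where b = "\<lambda>_ _. 1"])
    show "{(\<lambda>x::pt. a :: real) | a. True} = {(\<lambda>x. \<Sum>k\<in>{0::nat}. a k * 1) | a. True}"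
    proof (intro equalityI subsetI)
      fix f :: fn assume "f \<in> {(\<lambda>x. a) | a. True}"
      then obtain a where "f = (\<lambda>x. a)" by blast
      then show "f \<in> {(\<lambda>x. \<Sum>k\<in>{0::nat}. a k * 1) | a. True}"
        by (intro CollectI exI[of _ "\<lambda>_. a"]) simp
    qed auto
    show "a k = 0" if "(\<lambda>x::pt. \<Sum>k\<in>{0::nat}. a k * 1) = (\<lambda>x. 0)" "k \<in> {0}" for a :: "nat \<Rightarrow> real" and k
      using fun_cong[OF that(1)] that(2) by simp
  qed auto
  then show ?thesis by simp
qed

lemma has_dim_affine: "has_dim {(\<lambda>x. \<Sum>i=1..d. a i * (x i + c i)) | a. True} d"
proof -
  have "has_dim {(\<lambda>x. \<Sum>i=1..d. a i * (x i + c i)) | a. True} (card {1..d})"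
  proof (rule has_dimI[where b = "\<lambda>i x. x i + c i"])
    fix k assume k: "k \<in> {1..d}"
    have "(\<Sum>i=1..d. of_bool (i = k) * (x i + c i)) = x k + c k" for x :: pt
    proof -
      have "(\<Sum>i=1..d. of_bool (i = k) * (x i + c i)) = (\<Sum>i=1..d. if i = k then x i + c i else 0)"
        by (rule sum.cong) auto
      then show ?thesis using k by (simp add: sum.delta)
    qed
    then show "(\<lambda>x. x k + c k) \<in> {(\<lambda>x. \<Sum>i=1..d. a i * (x i + c i)) | a. True}"
      by (intro CollectI exI[of _ "\<lambda>i. of_bool (i = k)"]) simp
  next
    fix a :: "nat \<Rightarrow> real" and k
    assume k: "k \<in> {1..d}" and z: "(\<lambda>x::pt. \<Sum>k=1..d. a k * (x k + c k)) = (\<lambda>x. 0)"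
    \<comment> \<open>Subtracting the values of the combination at the origin and at the k-th unit
      vector eliminates the constants \<open>c\<close> and isolates \<open>a k\<close>.\<close>
    let ?e = "(\<lambda>_. 0 :: real)(k := 1)"
    have "(\<Sum>i=1..d. a i * (?e i + c i)) = (\<Sum>i=1..d. a i * (0 + c i)) + (\<Sum>i=1..d. if i = k then a i else 0)"
      unfolding sum.distrib[symmetric] by (rule sum.cong) (auto simp: algebra_simps)
    then show "a k = 0"
      using fun_cong[OF z, of "\<lambda>_. 0"] fun_cong[OF z, of ?e] k by (simp add: sum.delta)
  qed auto
  then show ?thesis by simp
qed

text \<open>With all parameters -1 the sum of the parameters plus d + 1 is 0, so every first-order
  coefficient vanishes, and second derivatives of affine functions are zero.\<close>

lemma affine_solution:
  fixes a c :: "nat \<Rightarrow> real" and d :: nat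
  defines "u \<equiv> (\<lambda>x. \<Sum>i=1..d. a i * (x i + c i))"
  shows "polyfun d u" "Lop d (epsneg d (d + 1) \<gamma>) u x = 0"
proof -
  have "poly_le d 1 (\<lambda>x. x i + c i)" if "i \<in> {1..d}" for i
    using poly_le_diff[OF poly_le_mult_var[OF poly_le_const[of d 0 1] that] poly_le_const[of d "Suc 0" "- c i"]]
    by simp
  then have "poly_le d 1 u" unfolding u_def by (intro poly_le_sum poly_le_cmult)
  then show "polyfun d u" by (auto simp: polyfun_def)
  have "has_pd i (\<lambda>x. x j + c j) (\<lambda>x. of_bool (j = i))" for i j
    unfolding has_pd_def by (cases "j = i") (auto intro!: derivative_eq_intros)
  then have "has_pd i u (\<lambda>x. \<Sum>j=1..d. a j * of_bool (j = i))" for i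
    unfolding u_def by (intro has_pd_sum has_pd_cmult)
  then have p: "pd i u = (\<lambda>x. \<Sum>j=1..d. a j * of_bool (j = i))" for i by (rule pd_eq)
  have s: "(\<Sum>l=1..d+1. epsneg d (d+1) \<gamma> l) = - real d - 1"
    using sum_epsneg[of "d+1" d \<gamma>] by simp
  have "epsneg d (d+1) \<gamma> i = -1" if "i \<in> {1..d}" for i using that by (simp add: epsneg_def)
  then have "(\<Sum>i=1..d. (epsneg d (d+1) \<gamma> i + 1 - ((\<Sum>l=1..d+1. epsneg d (d+1) \<gamma> l) + real d + 1) * x i) * pd i u x) = 0"
    unfolding s by (intro sum.neutral ballI) simp
  then show "Lop d (epsneg d (d + 1) \<gamma>) u x = 0"
    unfolding Lop_def p pd_const by simp
qed

theorem theorem3p5: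
  fixes d k n :: nat and \<gamma> c :: "nat \<Rightarrow> real"
  assumes "2 \<le> d" and "1 \<le> k" and "k \<le> d + 1"
    and "\<forall>i\<in>{1..d+1-k}. \<gamma> i > -1"
  shows "(\<forall>u\<in>Ucal d k \<gamma> c n. polyfun d u \<and>
            (\<forall>x. Lop d (epsneg d k \<gamma>) u x =
                 - (real n * (real n + (\<Sum>i=1..d+1-k. \<gamma> i) + real d - real k)) * u x))
       \<and> has_dim (Ucal d k \<gamma> c n) ((n + d - 1) choose n)
       \<and> ((if k = d + 1 then 2 \<le> n else 1 \<le> n) \<longrightarrow> direct_sp (Iset d k) (summand d k \<gamma> n))"
proof -
  consider "n = 0" | "k = d + 1" "n = 1" | "if k = d + 1 then 2 \<le> n else 1 \<le> n"
    by (cases "n = 0"; cases "n = 1"; cases "k = d + 1") auto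
  then show ?thesis
  proof cases
    case 1
    have U: "Ucal d k \<gamma> c n = {(\<lambda>x. a) | a. True}" using 1 by (simp add: Ucal_def)
    have p: "polyfun d (\<lambda>x. a)" for a using poly_le_const[of d 0 a] by (auto simp: polyfun_def)
    have "has_dim (Ucal d k \<gamma> c n) ((n + d - 1) choose n)"
      unfolding U using has_dim_const 1 by simp
    moreover have "polyfun d u \<and> (\<forall>x. Lop d (epsneg d k \<gamma>) u x = 0)" if "u \<in> Ucal d k \<gamma> c n" for u
      using that p unfolding U by (auto simp: Lop_const)
    moreover have "\<not> (if k = d + 1 then 2 \<le> n else 1 \<le> n)" "real n = 0" using 1 by auto
    ultimately show ?thesis by simp
  next
    case 2
    have U: "Ucal d k \<gamma> c n = {(\<lambda>x. \<Sum>i=1..d. a i * (x i + c i)) | a. True}"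
      using 2 by (simp add: Ucal_def)
    \<comment> \<open>For \<open>n = 1\<close> and \<open>k = d + 1\<close> the eigenvalue is 0,
      which is why the additive constants can be arbitrary.\<close>
    have z: "real n + (\<Sum>i=1..d+1-k. \<gamma> i) + real d - real k = 0" using 2 by simp
    have "polyfun d u \<and> (\<forall>x. Lop d (epsneg d k \<gamma>) u x = 0)" if Uu: "u \<in> Ucal d k \<gamma> c n" for u
    proof -
      obtain a where u: "u = (\<lambda>x. \<Sum>i=1..d. a i * (x i + c i))"
        using Uu unfolding U by blast
      show ?thesis unfolding u 2(1)
        by (intro conjI allI affine_solution)
    qed
    moreover have "has_dim (Ucal d k \<gamma> c n) ((n + d - 1) choose n)"
      unfolding U using has_dim_affine[where d = d and c = c] 2 by simp
    moreover have "\<not> (if k = d + 1 then 2 \<le> n else 1 \<le> n)" using 2 by simp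
    ultimately show ?thesis unfolding z mult_zero_right minus_zero mult_zero_left by blast
  next
    case 3
    interpret singular_weight d k n \<gamma>
      using assms 3 by unfold_locales
    have "Ucal d k \<gamma> c n = sum_sp (Iset d k) (summand d k \<gamma> n)"
      using 3 by (auto simp: Ucal_def split: if_splits)
    then show ?thesis
      using sum_sp_solution has_dim_sum_summands summands_direct by (simp only: simp_thms) blast
  qed
qed

end
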